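(* The vector space $\mathbf{ASM}$, endowed with the product and coproduct of $\mathbf{PM}_1$, forms a free, cofree, and self-dual bigraded combinatorial Hopf algebra which admits a bidendriform bialgebra structure.
   Context: Let $\mathbb{K}$ be a field of characteristic zero. A $1$-packed matrix of size $n$ is an $n \times n$ matrix with entries in $\{0,1\}$ with at least one $1$ in each row and column. $\mathbf{PM}_1$ is the bigraded (by size and number of nonzero entries) combinatorial Hopf algebra with basis $(\mathbf{F}_M)$ indexed by $1$-packed matrices, with product $\mathbf{F}_{M_1}\cdot\mathbf{F}_{M_2} = \sum_{M \in \mathrm{Sh}_c(M_1,M_2)} \mathbf{F}_M$ (for sizes $n_1,n_2$, $\mathrm{Sh}_c(M_1,M_2)$ is the set of all matrices obtained by shuffling the columns of $M_1$ with an $n_2 \times n_1$ zero block placed below it, with the columns of $M_2$ with an $n_1 \times n_2$ zero block placed above it) and coproduct $\Delta(\mathbf{F}_M) = \sum_{M = [L|R]} \mathbf{F}_{\operatorname{cp}(L)} \otimes \mathbf{F}_{\operatorname{cp}(R)}$ (sum over splittings of $M$ into a left and a right block of columns whose compressions, obtained by deleting null rows and columns, are square). $\mathbf{PM}_1$ has a bidendriform bialgebra structure (in Foissy's sense), where $\mathbf{F}_{M_1}\prec\mathbf{F}_{M_2}$ (resp. $\succ$) keeps the terms of the product whose last column comes from $M_1$ (resp. $M_2$), and $\Delta_\prec$ (resp. $\Delta_\succ$) keeps the terms $(L,R)$ of the reduced coproduct where the last row of $M$ has its nonzero entries in $L$ (resp. $R$). An alternating sign matrix (ASM) of size $n$ is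 an $n\times n$ matrix with entries in $\{0, +, -\}$ such that every row and column starts and ends (ignoring zeros) with $+$ and in every row and column the $+$ and $-$ alternate. For an ASM $\delta$, $M^\delta$ is the $1$-packed matrix with $M^\delta_{ij} = 1$ if $\delta_{ij} \in \{+,-\}$ and $0$ otherwise; $\delta \mapsto M^\delta$ is injective. $\mathbf{ASM}$ is the subspace of $\mathbf{PM}_1$ spanned by the $\mathbf{F}_{M^\delta}$, $\delta$ ranging over ASMs. *)

theory Defs
  imports Main
begin

text \<open>A (0/1) matrix of size n is encoded as a pair (n, S) where S is the set of
  positions (row, column), 0-indexed, carrying a nonzero entry (a 1).\<close>

type_synonym mat = "nat \<times> (nat \<times> nat) set"

definition e0 :: mat where "e0 = (0, {})"

definition pm1 :: "mat \<Rightarrow> bool" where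
  "pm1 M \<longleftrightarrow> snd M \<subseteq> {..<fst M} \<times> {..<fst M}
      \<and> (\<forall>i<fst M. \<exists>j. (i, j) \<in> snd M) \<and> (\<forall>j<fst M. \<exists>i. (i, j) \<in> snd M)"

definition alternating :: "int list \<Rightarrow> bool" where
  "alternating xs \<longleftrightarrow> xs \<noteq> [] \<and> hd xs = 1 \<and> last xs = 1
      \<and> (\<forall>k. Suc k < length xs \<longrightarrow> xs ! Suc k = - (xs ! k))"

definition is_asm :: "nat \<Rightarrow> (nat \<Rightarrow> nat \<Rightarrow> int) \<Rightarrow> bool" where
  "is_asm n d \<longleftrightarrow> (\<forall>i j. d i j \<in> {-1, 0, 1})
      \<and> (\<forall>i j. (n \<le> i \<or> n \<le> j) \<longrightarrow> d i j = 0)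
      \<and> (\<forall>i<n. alternating (filter (\<lambda>x. x \<noteq> 0) (map (\<lambda>j. d i j) [0..<n])))
      \<and> (\<forall>j<n. alternating (filter (\<lambda>x. x \<noteq> 0) (map (\<lambda>i. d i j) [0..<n])))"

definition asm_matrix :: "nat \<Rightarrow> (nat \<Rightarrow> nat \<Rightarrow> int) \<Rightarrow> mat" where
  "asm_matrix n d = (n, {(i, j). i < n \<and> j < n \<and> d i j \<noteq> 0})"

definition asm_mats :: "mat set" where
  "asm_mats = {asm_matrix n d | n d. is_asm n d}"

definition shc :: "mat \<Rightarrow> mat \<Rightarrow> mat set" where
  "shc M1 M2 = {(fst M1 + fst M2,
        (\<lambda>(i, j). (i, f j)) ` snd M1 \<union> (\<lambda>(i, j). (fst M1 + i, g j)) ` snd M2) | f g.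
        strict_mono_on {..<fst M1} f \<and> strict_mono_on {..<fst M2} g
        \<and> f ` {..<fst M1} \<union> g ` {..<fst M2} = {..<fst M1 + fst M2}
        \<and> f ` {..<fst M1} \<inter> g ` {..<fst M2} = {}}"

text \<open>Compression: delete null rows and columns (relabel by rank).\<close>
definition compress :: "(nat \<times> nat) set \<Rightarrow> mat" where
  "compress T = (card (fst ` T),
      (\<lambda>(i, j). (card {r \<in> fst ` T. r < i}, card {c \<in> snd ` T. c < j})) ` T)"

definition left_block :: "mat \<Rightarrow> nat \<Rightarrow> (nat \<times> nat) set" where
  "left_block M k = {(i, j) \<in> snd M. j < k}"

definition right_block :: "mat \<Rightarrow> nat \<Rightarrow> (nat \<times> nat) set" where
  "right_block M k = {(i, j) \<in> snd M. k \<le> j}"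

definition square_set :: "(nat \<times> nat) set \<Rightarrow> bool" where
  "square_set T \<longleftrightarrow> card (fst ` T) = card (snd ` T)"

definition splits :: "mat \<Rightarrow> (mat \<times> mat) set" where
  "splits M = {(compress (left_block M k), compress (right_block M k)) | k.
      k \<le> fst M \<and> square_set (left_block M k) \<and> square_set (right_block M k)}"

type_synonym 'k vec = "mat \<Rightarrow> 'k"
type_synonym 'k tens = "mat \<times> mat \<Rightarrow> 'k"
type_synonym 'k tens3 = "mat \<times> mat \<times> mat \<Rightarrow> 'k"

definition supp :: "('a \<Rightarrow> 'k::zero) \<Rightarrow> 'a set" where
  "supp v = {x. v x \<noteq> 0}"

definition fspace :: "mat set \<Rightarrow> ('k::zero) vec set" where
  "fspace Mats = {v. finite (supp v) \<and> supp v \<subseteq> Mats}"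

definition basis :: "mat \<Rightarrow> ('k::{zero,one}) vec" where
  "basis M = (\<lambda>N. if N = M then 1 else 0)"

definition tens :: "('k::times) vec \<Rightarrow> 'k vec \<Rightarrow> 'k tens" where
  "tens v w = (\<lambda>(A, B). v A * w B)"

text \<open>Bilinear extension of structure coefficients c A B M (coefficient of F_M in F_A op F_B).\<close>
definition bil :: "(mat \<Rightarrow> mat \<Rightarrow> mat \<Rightarrow> 'k) \<Rightarrow> ('k::comm_ring_1) vec \<Rightarrow> 'k vec \<Rightarrow> 'k vec" where
  "bil c v w = (\<lambda>M. \<Sum>A\<in>supp v. \<Sum>B\<in>supp w. v A * w B * c A B M)"

text \<open>Linear extension of co-structure coefficients d M A B (coefficient of F_A (x) F_B in d(F_M)).\<close>
definition cobil :: "(mat \<Rightarrow> mat \<Rightarrow> mat \<Rightarrow> 'k) \<Rightarrow> ('k::comm_ring_1) vec \<Rightarrow> 'k tens" where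
  "cobil d v = (\<lambda>(A, B). \<Sum>M\<in>supp v. v M * d M A B)"

definition multc :: "mat \<Rightarrow> mat \<Rightarrow> mat \<Rightarrow> 'k::comm_ring_1" where
  "multc A B M = (if M \<in> shc A B then 1 else 0)"

definition copc :: "mat \<Rightarrow> mat \<Rightarrow> mat \<Rightarrow> 'k::comm_ring_1" where
  "copc M A B = (if (A, B) \<in> splits M then 1 else 0)"

definition rcopc :: "mat \<Rightarrow> mat \<Rightarrow> mat \<Rightarrow> 'k::comm_ring_1" where
  "rcopc M A B = copc M A B - (if A = M \<and> B = e0 then 1 else 0)
                             - (if A = e0 \<and> B = M then 1 else 0)"

definition mult :: "('k::comm_ring_1) vec \<Rightarrow> 'k vec \<Rightarrow> 'k vec" where
  "mult = bil multc"

definition cop :: "('k::comm_ring_1) vec \<Rightarrow> 'k tens" where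
  "cop = cobil copc"

definition redcop :: "('k::comm_ring_1) vec \<Rightarrow> 'k tens" where
  "redcop = cobil rcopc"

definition tbil :: "(mat \<Rightarrow> mat \<Rightarrow> mat \<Rightarrow> 'k) \<Rightarrow> (mat \<Rightarrow> mat \<Rightarrow> mat \<Rightarrow> 'k)
     \<Rightarrow> ('k::comm_ring_1) tens \<Rightarrow> 'k tens \<Rightarrow> 'k tens" where
  "tbil c1 c2 X Y = (\<lambda>(A, B). \<Sum>p\<in>supp X. \<Sum>q\<in>supp Y.
       X p * Y q * c1 (fst p) (fst q) A * c2 (snd p) (snd q) B)"

definition coL :: "(mat \<Rightarrow> mat \<Rightarrow> mat \<Rightarrow> 'k) \<Rightarrow> ('k::comm_ring_1) tens \<Rightarrow> 'k tens3" where
  "coL d X = (\<lambda>(A, B, C). \<Sum>M\<in>fst ` supp X. X (M, C) * d M A B)"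

definition coR :: "(mat \<Rightarrow> mat \<Rightarrow> mat \<Rightarrow> 'k) \<Rightarrow> ('k::comm_ring_1) tens \<Rightarrow> 'k tens3" where
  "coR d X = (\<lambda>(A, B, C). \<Sum>M\<in>snd ` supp X. X (A, M) * d M B C)"

text \<open>Multiplication map on tensors and (S (x) id), (id (x) S) for a linear map with
  coefficients s A M (coefficient of F_M in S(F_A)).\<close>
definition mtens :: "(mat \<Rightarrow> mat \<Rightarrow> mat \<Rightarrow> 'k) \<Rightarrow> ('k::comm_ring_1) tens \<Rightarrow> 'k vec" where
  "mtens c X = (\<lambda>M. \<Sum>p\<in>supp X. X p * c (fst p) (snd p) M)"

definition appL :: "(mat \<Rightarrow> mat \<Rightarrow> 'k) \<Rightarrow> ('k::comm_ring_1) tens \<Rightarrow> 'k tens" where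
  "appL s X = (\<lambda>(A, B). \<Sum>A'\<in>fst ` supp X. X (A', B) * s A' A)"

definition appR :: "(mat \<Rightarrow> mat \<Rightarrow> 'k) \<Rightarrow> ('k::comm_ring_1) tens \<Rightarrow> 'k tens" where
  "appR s X = (\<lambda>(A, B). \<Sum>B'\<in>snd ` supp X. X (A, B') * s B' B)"

section \<open>Hopf algebra structure (counit: epsilon(v) = v e0, unit: F_e0)\<close>

definition hopf_alg :: "('k::comm_ring_1) vec set \<Rightarrow> mat set \<Rightarrow> bool" where
  "hopf_alg V Mats \<longleftrightarrow>
     basis e0 \<in> V
   \<and> (\<forall>v\<in>V. \<forall>w\<in>V. mult v w \<in> V)
   \<and> (\<forall>v\<in>V. finite (supp (cop v)) \<and> supp (cop v) \<subseteq> Mats \<times> Mats)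
   \<and> (\<forall>u\<in>V. \<forall>v\<in>V. \<forall>w\<in>V. mult (mult u v) w = mult u (mult v w))
   \<and> (\<forall>v\<in>V. mult (basis e0) v = v \<and> mult v (basis e0) = v)
   \<and> (\<forall>v\<in>V. coL copc (cop v) = coR copc (cop v))
   \<and> (\<forall>v\<in>V. (\<lambda>B. cop v (e0, B)) = v \<and> (\<lambda>A. cop v (A, e0)) = v)
   \<and> (\<forall>v\<in>V. \<forall>w\<in>V. cop (mult v w) = tbil multc multc (cop v) (cop w))
   \<and> (\<forall>v\<in>V. \<forall>w\<in>V. mult v w e0 = v e0 * w e0)
   \<and> cop (basis e0 :: 'k vec) = tens (basis e0) (basis e0)
   \<and> (\<exists>s. (\<forall>A\<in>Mats. finite {M. s A M \<noteq> 0} \<and> {M. s A M \<noteq> 0} \<subseteq> Mats)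
          \<and> (\<forall>v\<in>V. mtens multc (appL s (cop v)) = (\<lambda>M. v e0 * basis e0 M)
                 \<and> mtens multc (appR s (cop v)) = (\<lambda>M. v e0 * basis e0 M)))"

definition bigraded_connected :: "mat set \<Rightarrow> bool" where
  "bigraded_connected Mats \<longleftrightarrow>
     (\<forall>A\<in>Mats. \<forall>B\<in>Mats. \<forall>M\<in>shc A B.
        fst M = fst A + fst B \<and> card (snd M) = card (snd A) + card (snd B))
   \<and> (\<forall>M\<in>Mats. \<forall>(A, B)\<in>splits M.
        fst A + fst B = fst M \<and> card (snd A) + card (snd B) = card (snd M))
   \<and> (\<forall>n k. finite {M \<in> Mats. fst M = n \<and> card (snd M) = k})
   \<and> {M \<in> Mats. fst M = 0} = {e0}"

definition bihomog :: "('k::zero) vec \<Rightarrow> bool" where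
  "bihomog v \<longleftrightarrow> (\<exists>n k. \<forall>M\<in>supp v. fst M = n \<and> card (snd M) = k)"

definition lincomb :: "('i \<Rightarrow> 'k::comm_ring_1) \<Rightarrow> 'i set \<Rightarrow> ('i \<Rightarrow> 'k vec) \<Rightarrow> 'k vec" where
  "lincomb c W b = (\<lambda>M. \<Sum>w\<in>W. c w * b w M)"

definition is_basis_fam :: "('k::comm_ring_1) vec set \<Rightarrow> 'i set \<Rightarrow> ('i \<Rightarrow> 'k vec) \<Rightarrow> bool" where
  "is_basis_fam V I b \<longleftrightarrow> (\<forall>i\<in>I. b i \<in> V)
     \<and> (\<forall>W c. finite W \<and> W \<subseteq> I \<and> lincomb c W b = (\<lambda>_. 0) \<longrightarrow> (\<forall>w\<in>W. c w = 0))
     \<and> (\<forall>v\<in>V. \<exists>W c. finite W \<and> W \<subseteq> I \<and> v = lincomb c W b)"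

fun wprod :: "(nat \<Rightarrow> ('k::comm_ring_1) vec) \<Rightarrow> nat list \<Rightarrow> 'k vec" where
  "wprod g [] = basis e0"
| "wprod g (i # w) = mult (g i) (wprod g w)"

definition free_alg :: "('k::comm_ring_1) vec set \<Rightarrow> bool" where
  "free_alg V \<longleftrightarrow> (\<exists>G g. (\<forall>i\<in>G. g i \<in> V \<and> bihomog (g i)) \<and> is_basis_fam V (lists G) (wprod g))"

text \<open>Cofree: isomorphic to a tensor coalgebra with deconcatenation coproduct.\<close>
definition cofree_coalg :: "('k::comm_ring_1) vec set \<Rightarrow> bool" where
  "cofree_coalg V \<longleftrightarrow> (\<exists>(G :: nat set) (e :: nat list \<Rightarrow> 'k vec).
      is_basis_fam V (lists G) e
    \<and> (\<forall>w\<in>lists G. bihomog (e w)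
         \<and> cop (e w) = (\<lambda>(A, B). \<Sum>k\<le>length w. e (take k w) A * e (drop k w) B)))"

definition pairing :: "(mat \<Rightarrow> mat \<Rightarrow> 'k) \<Rightarrow> ('k::comm_ring_1) vec \<Rightarrow> 'k vec \<Rightarrow> 'k" where
  "pairing P v w = (\<Sum>A\<in>supp v. \<Sum>B\<in>supp w. v A * P A B * w B)"

text \<open>Self-dual: a bigraded Hopf isomorphism V \<rightarrow> V^*(graded dual), given by a
  nondegenerate bidegree-preserving pairing P (phi(F_A)(F_B) = P A B) such that
  phi is an algebra and coalgebra morphism and respects unit and counit.\<close>
definition self_dual :: "('k::comm_ring_1) vec set \<Rightarrow> mat set \<Rightarrow> bool" where
  "self_dual V Mats \<longleftrightarrow> (\<exists>P :: mat \<Rightarrow> mat \<Rightarrow> 'k.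
      (\<forall>A\<in>Mats. \<forall>B\<in>Mats. P A B \<noteq> 0 \<longrightarrow> fst A = fst B \<and> card (snd A) = card (snd B))
    \<and> (\<forall>v\<in>V. v \<noteq> (\<lambda>_. 0) \<longrightarrow> (\<exists>w\<in>V. pairing P v w \<noteq> 0))
    \<and> (\<forall>A\<in>Mats. \<forall>B\<in>Mats. \<forall>C\<in>Mats.
         (\<Sum>M\<in>shc A B. P M C) = (\<Sum>(C1, C2)\<in>splits C. P A C1 * P B C2))
    \<and> (\<forall>A\<in>Mats. \<forall>B\<in>Mats. \<forall>C\<in>Mats.
         (\<Sum>M\<in>shc B C. P A M) = (\<Sum>(A1, A2)\<in>splits A. P A1 B * P A2 C))
    \<and> (\<forall>C\<in>Mats. P e0 C = (if C = e0 then 1 else 0))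
    \<and> (\<forall>A\<in>Mats. P A e0 = (if A = e0 then 1 else 0)))"

section \<open>Bidendriform bialgebras (Foissy)\<close>

text \<open>On the augmentation ideal V+ (vectors with v e0 = 0, spanned by Mats - {e0}),
  operations given by structure coefficients (lt, gt: left/right products,
  dlt, dgt: left/right half-coproducts) with lt + gt = product and
  dlt + dgt = reduced coproduct, satisfying the dendriform, codendriform and
  the four compatibility relations (x' (x) x'' denotes the reduced coproduct).\<close>
definition bidendriform :: "('k::comm_ring_1) vec set \<Rightarrow> mat set
    \<Rightarrow> (mat \<Rightarrow> mat \<Rightarrow> mat \<Rightarrow> 'k) \<Rightarrow> (mat \<Rightarrow> mat \<Rightarrow> mat \<Rightarrow> 'k)
    \<Rightarrow> (mat \<Rightarrow> mat \<Rightarrow> mat \<Rightarrow> 'k) \<Rightarrow> (mat \<Rightarrow> mat \<Rightarrow> mat \<Rightarrow> 'k) \<Rightarrow> bool" where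
  "bidendriform V Mats lt gt dlt dgt \<longleftrightarrow>
    (let Mp = Mats - {e0}; Vp = {v \<in> V. v e0 = 0} in
      (\<forall>A\<in>Mp. \<forall>B\<in>Mp. finite {M. lt A B M \<noteq> 0} \<and> {M. lt A B M \<noteq> 0} \<subseteq> Mp
                     \<and> finite {M. gt A B M \<noteq> 0} \<and> {M. gt A B M \<noteq> 0} \<subseteq> Mp
                     \<and> (\<forall>M. lt A B M + gt A B M = multc A B M))
    \<and> (\<forall>M\<in>Mp. finite {(A, B). dlt M A B \<noteq> 0} \<and> {(A, B). dlt M A B \<noteq> 0} \<subseteq> Mp \<times> Mp
              \<and> finite {(A, B). dgt M A B \<noteq> 0} \<and> {(A, B). dgt M A B \<noteq> 0} \<subseteq> Mp \<times> Mp
              \<and> (\<forall>A B. dlt M A B + dgt M A B = rcopc M A B))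
    \<and> (\<forall>x\<in>Vp. \<forall>y\<in>Vp. \<forall>z\<in>Vp.
         bil lt (bil lt x y) z = bil lt x (mult y z)
       \<and> bil lt (bil gt x y) z = bil gt x (bil lt y z)
       \<and> bil gt (mult x y) z = bil gt x (bil gt y z))
    \<and> (\<forall>x\<in>Vp.
         coL dlt (cobil dlt x) = coR rcopc (cobil dlt x)
       \<and> coL dgt (cobil dlt x) = coR dlt (cobil dgt x)
       \<and> coL rcopc (cobil dgt x) = coR dgt (cobil dgt x))
    \<and> (\<forall>a\<in>Vp. \<forall>b\<in>Vp.
         cobil dgt (bil gt a b) = (\<lambda>p.
              tbil multc gt (redcop a) (cobil dgt b) p
            + tbil multc gt (redcop a) (tens (basis e0) b) p
            + tbil multc gt (tens (basis e0) a) (cobil dgt b) p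
            + tbil multc multc (tens a (basis e0)) (cobil dgt b) p
            + tens a b p)
       \<and> cobil dgt (bil lt a b) = (\<lambda>p.
              tbil multc lt (redcop a) (cobil dgt b) p
            + tbil multc lt (redcop a) (tens (basis e0) b) p
            + tbil multc lt (tens (basis e0) a) (cobil dgt b) p)
       \<and> cobil dlt (bil gt a b) = (\<lambda>p.
              tbil multc gt (redcop a) (cobil dlt b) p
            + tbil multc multc (tens a (basis e0)) (cobil dlt b) p
            + tbil multc gt (tens (basis e0) a) (cobil dlt b) p)
       \<and> cobil dlt (bil lt a b) = (\<lambda>p.
              tbil multc lt (redcop a) (cobil dlt b) p
            + tbil multc multc (redcop a) (tens b (basis e0)) p
            + tbil multc lt (tens (basis e0) a) (cobil dlt b) p
            + tens b a p)))"

definition admits_bidendriform :: "('k::comm_ring_1) vec set \<Rightarrow> mat set \<Rightarrow> bool" where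
  "admits_bidendriform V Mats \<longleftrightarrow> (\<exists>lt gt dlt dgt. bidendriform V Mats lt gt dlt dgt)"

end

theory Submission
  imports Defs "HOL-Library.Countable_Set"
begin

text \<open>A sub-block of an ASM that is a union of complete rows and of complete columns has all
  row sums and column sums equal to 1, hence is square, and its compression is again an ASM.
  This makes cuts of an ASM along rows and along columns commute, which gives the compatibility of
  product and coproduct. It fails for general 1-packed matrices, where the four blocks cut
  out by a row cut and a column cut need not be square.

  For ASMs, \<open>M\<close> occurs in \<open>F_A F_B\<close> iff \<open>A \<otimes> B\<close>, transposed, occurs in the coproduct of the transpose
  of \<open>M\<close>. Transposition therefore identifies the algebra with its graded dual and turns
  every statement on the product into one on the coproduct.

  In \<open>F_A F_B\<close> the block diagonal matrix is the unique term with the least number of inversions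
  among its nonzero entries, so the products of words in the indecomposable ASMs are unitriangular in
  the basis \<open>F\<close>: the algebra is free on them. The dual basis of these products shows cofreeness.\<close>

section \<open>Ranks and compression\<close>

text \<open>The signs of an ASM enter only through an existential, so blocks are handled as
  \<open>asm_shape\<close>: sets of positions that carry some valid choice of signs. This property
  survives relabelling, transposition and cutting, and it makes sense for a block that has not been
  compressed yet. Iterated cuts can therefore be compared as subsets of one fixed matrix, without
  following relabellings from one compression to the next.

  Only row cuts are developed. A shuffle is recognised by a row cut of the matrix, a splitting by a
  row cut of its converse.

  The four compatibility relations come from one statement on half products and unreduced half
  coproducts: the last row of a product term lies in the second factor when that is nonempty, its
  last column in the right part when that is nonempty, so only these two pieces carry a label.
  Separating the unit terms afterwards produces the unsymmetric lists of summands.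

  The antipode exists because only \<open>e0\<close> has size 0, which makes the identity minus the
  unit-counit map locally nilpotent for convolution.\<close>

definition rnk :: "nat set \<Rightarrow> nat \<Rightarrow> nat" where
  "rnk X x = card {y \<in> X. y < x}"

text \<open>Only \<open>x\<close> has to lie in \<open>X\<close>. The other argument
  \<open>k\<close> is a cut position, which may fall between two elements of \<open>X\<close>; this
  asymmetric form is what carries a cut of a set over to its compression.\<close>

lemma rnk_less_iff:
  assumes "finite X" "x \<in> X"
  shows "rnk X x < rnk X k \<longleftrightarrow> x < k"
proof
  assume "x < k"
  then have "{y \<in> X. y < x} \<subset> {y \<in> X. y < k}" using assms by auto
  then show "rnk X x < rnk X k" unfolding rnk_def using assms by (intro psubset_card_mono) auto
next
  assume *: "rnk X x < rnk X k"
  show "x < k"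
  proof (rule ccontr)
    assume "\<not> x < k"
    then have "{y \<in> X. y < k} \<subseteq> {y \<in> X. y < x}" by auto
    then have "rnk X k \<le> rnk X x" unfolding rnk_def using assms by (intro card_mono) auto
    with * show False by simp
  qed
qed

lemma strict_mono_on_rnk: "finite X \<Longrightarrow> strict_mono_on X (rnk X)"
  by (auto simp: strict_mono_on_def rnk_less_iff)

text \<open>A rank is smaller than the cardinality, and ranks of distinct elements differ, so
  counting gives surjectivity.\<close>

lemma rnk_image:
  assumes "finite X"
  shows "rnk X ` X = {..<card X}"
proof (rule card_subset_eq)
  show "rnk X ` X \<subseteq> {..<card X}"
  proof
    fix r assume "r \<in> rnk X ` X"
    then obtain x where x: "x \<in> X" "r = rnk X x" by auto
    have "{y \<in> X. y < x} \<subset> X" using x by auto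
    then show "r \<in> {..<card X}" using x assms psubset_card_mono[OF assms] by (simp add: rnk_def)
  qed
  show "card (rnk X ` X) = card {..<card X}"
    using assms by (simp add: card_image strict_mono_on_imp_inj_on strict_mono_on_rnk)
qed simp

lemma rnk_strict_mono_image:
  assumes "strict_mono_on X \<phi>" "x \<in> X"
  shows "rnk (\<phi> ` X) (\<phi> x) = rnk X x"
proof -
  have "{y \<in> \<phi> ` X. y < \<phi> x} = \<phi> ` {y \<in> X. y < x}"
    using assms by (auto simp: strict_mono_on_less)
  moreover have "inj_on \<phi> {y \<in> X. y < x}"
    using strict_mono_on_imp_inj_on[OF assms(1)] by (rule inj_on_subset) auto
  ultimately show ?thesis by (simp add: rnk_def card_image)
qed

lemma rnk_lessThan: "x \<le> n \<Longrightarrow> rnk {..<n} x = x"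
proof -
  assume "x \<le> n"
  then have "{y \<in> {..<n}. y < x} = {..<x}" by auto
  then show ?thesis by (simp add: rnk_def)
qed

lemma rnk_atLeastLessThan: "x \<le> n \<Longrightarrow> rnk {a..<n} x = x - a"
proof -
  assume "x \<le> n"
  then have "{y \<in> {a..<n}. y < x} = {a..<x}" by auto
  then show ?thesis by (simp add: rnk_def)
qed

text \<open>The inverse of the rank is the increasing enumeration of \<open>X\<close>. It later
  supplies the column maps of a shuffle when only the column sets of the two blocks are
  known.\<close>

lemma unrank:
  assumes "finite X"
  obtains \<phi> where "strict_mono_on {..<card X} \<phi>" "\<phi> ` {..<card X} = X"
    "\<And>x. x \<in> X \<Longrightarrow> \<phi> (rnk X x) = x"
proof
  let ?f = "the_inv_into X (rnk X)"
  have inj: "inj_on (rnk X) X" using assms by (simp add: strict_mono_on_imp_inj_on strict_mono_on_rnk)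
  show inv: "?f (rnk X x) = x" if "x \<in> X" for x
    using that inj by (simp add: the_inv_into_f_f)
  show "?f ` {..<card X} = X"
    unfolding rnk_image[OF assms, symmetric] image_image using inv by simp
  show "strict_mono_on {..<card X} ?f"
  proof (rule strict_mono_onI)
    fix r s assume rs: "r \<in> {..<card X}" "s \<in> {..<card X}" "r < s"
    then obtain x y where "x \<in> X" "y \<in> X" "r = rnk X x" "s = rnk X y"
      unfolding rnk_image[OF assms, symmetric] by blast
    then show "?f r < ?f s" using rs inv rnk_less_iff[OF assms, of x y] by simp
  qed
qed

lemma compress_eq:
  "compress T = (card (fst ` T), map_prod (rnk (fst ` T)) (rnk (snd ` T)) ` T)"
  unfolding compress_def rnk_def map_prod_def by simp

lemma fst_map_prod_image: "fst ` map_prod f g ` T = f ` fst ` T"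
  by force

lemma snd_map_prod_image: "snd ` map_prod f g ` T = g ` snd ` T"
  by force

text \<open>Compression sees only the relative order of the nonempty rows and columns, and
  increasing maps do not change it.\<close>

lemma compress_map_prod:
  assumes "strict_mono_on (fst ` T) \<phi>" "strict_mono_on (snd ` T) \<psi>"
  shows "compress (map_prod \<phi> \<psi> ` T) = compress T"
proof -
  have "card (\<phi> ` fst ` T) = card (fst ` T)"
    using assms(1) by (intro card_image strict_mono_on_imp_inj_on)
  moreover have "map_prod (rnk (\<phi> ` fst ` T)) (rnk (\<psi> ` snd ` T)) ` map_prod \<phi> \<psi> ` T
      = map_prod (rnk (fst ` T)) (rnk (snd ` T)) ` T"
  proof (subst image_image[of _ "map_prod \<phi> \<psi>"], rule image_cong)
    fix p assume "p \<in> T"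
    then have "fst p \<in> fst ` T" "snd p \<in> snd ` T" by auto
    then show "map_prod (rnk (\<phi> ` fst ` T)) (rnk (\<psi> ` snd ` T)) (map_prod \<phi> \<psi> p)
        = map_prod (rnk (fst ` T)) (rnk (snd ` T)) p"
      using assms by (cases p) (auto simp: rnk_strict_mono_image)
  qed simp
  ultimately show ?thesis by (simp add: compress_eq fst_map_prod_image snd_map_prod_image)
qed

lemma rows_compress: "finite T \<Longrightarrow> fst ` snd (compress T) = {..<fst (compress T)}"
  by (simp add: compress_eq fst_map_prod_image rnk_image)

lemma cols_compress: "finite T \<Longrightarrow> snd ` snd (compress T) = {..<card (snd ` T)}"
  by (simp add: compress_eq snd_map_prod_image rnk_image)

section \<open>Alternating sign shapes\<close>

definition alt_rows :: "(nat \<times> nat) set \<Rightarrow> (nat \<Rightarrow> nat \<Rightarrow> int) \<Rightarrow> bool" where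
  "alt_rows S d \<longleftrightarrow> (\<forall>i\<in>fst ` S. alternating (map (d i) (sorted_list_of_set (S `` {i}))))"

text \<open>The set of nonzero positions of an ASM, up to insertion of null rows and columns.\<close>

definition asm_shape :: "(nat \<times> nat) set \<Rightarrow> bool" where
  "asm_shape S \<longleftrightarrow> finite S \<and> (\<exists>d. (\<forall>(i, j)\<in>S. d i j \<in> {-1, 1})
      \<and> alt_rows S d \<and> alt_rows (S\<inverse>) (\<lambda>j i. d i j))"

lemma asm_shapeI:
  assumes "finite S" "\<And>i j. (i, j) \<in> S \<Longrightarrow> d i j \<in> {-1, 1}" "alt_rows S d" "alt_rows (S\<inverse>) (\<lambda>j i. d i j)"
  shows "asm_shape S"
  unfolding asm_shape_def using assms by blast

lemma asm_shapeE:
  assumes "asm_shape S"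
  obtains d where "finite S" "\<And>i j. (i, j) \<in> S \<Longrightarrow> d i j \<in> {-1, 1}"
    "alt_rows S d" "alt_rows (S\<inverse>) (\<lambda>j i. d i j)"
  using assms unfolding asm_shape_def by blast

lemma asm_shape_finite: "asm_shape S \<Longrightarrow> finite S"
  by (simp add: asm_shape_def)

lemma asm_shape_converse: "asm_shape (S\<inverse>) \<longleftrightarrow> asm_shape S"
proof -
  have "asm_shape (S\<inverse>)" if "asm_shape S" for S
    using that by (elim asm_shapeE) (rule asm_shapeI[where d = "\<lambda>j i. _ i j"], auto)
  from this[of S] this[of "S\<inverse>"] show ?thesis by auto
qed

lemma alternating_nth:
  assumes "alternating xs" "k < length xs"
  shows "xs ! k = (-1) ^ k"
  using assms(2)
proof (induction k)
  case 0
  then show ?case using assms(1) by (simp add: alternating_def hd_conv_nth)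
next
  case (Suc k)
  then show ?case using assms(1) by (simp add: alternating_def)
qed

text \<open>The entries are the powers of -1 in order. Since the last one is +1, their number is
  odd, and all but one of them cancel in pairs.\<close>

lemma alternating_sum_list:
  assumes "alternating xs"
  shows "sum_list xs = 1"
proof -
  have ne: "xs \<noteq> []" using assms by (simp add: alternating_def)
  have "(-1 :: int) ^ (length xs - 1) = 1"
    using assms ne alternating_nth[OF assms, of "length xs - 1"]
    by (simp add: alternating_def last_conv_nth)
  then have odd: "odd (length xs)"
    using ne by (metis One_nat_def Suc_pred even_Suc length_greater_0_conv minus_one_power_iff
        one_neq_neg_one)
  have "(\<Sum>k<m. (-1 :: int) ^ k) = (if odd m then 1 else 0)" for m
    by (induction m) auto
  moreover have "sum_list xs = (\<Sum>k<length xs. (-1) ^ k)"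
    unfolding sum_list_sum_nth atLeast0LessThan using alternating_nth[OF assms] by (intro sum.cong) auto
  ultimately show ?thesis using odd by simp
qed

lemma alt_rows_sum:
  assumes "finite S" "alt_rows S d"
  shows "(\<Sum>(i, j)\<in>S. d i j) = int (card (fst ` S))"
proof -
  have S: "S = Sigma (fst ` S) (\<lambda>i. S `` {i})" by force
  have fin: "finite (S `` {i})" for i using assms(1) by (rule finite_Image)
  have row: "(\<Sum>j\<in>S `` {i}. d i j) = 1" if "i \<in> fst ` S" for i
  proof -
    have "(\<Sum>j\<in>S `` {i}. d i j) = sum_list (map (d i) (sorted_list_of_set (S `` {i})))"
      using fin by (simp add: sum_list_distinct_conv_sum_set)
    then show ?thesis using that assms(2) alternating_sum_list unfolding alt_rows_def by metis
  qed
  have "(\<Sum>(i, j)\<in>S. d i j) = (\<Sum>i\<in>fst ` S. \<Sum>j\<in>S `` {i}. d i j)"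
    using assms(1) fin by (subst S, subst sum.Sigma) auto
  also have "\<dots> = int (card (fst ` S))" using row by simp
  finally show ?thesis .
qed

text \<open>Double counting: the total of all signs is the number of nonempty rows and, read through
  the converse, the number of nonempty columns. This is where the signs are used; afterwards they
  are only carried along.\<close>

lemma asm_shape_square:
  assumes "asm_shape S"
  shows "card (fst ` S) = card (snd ` S)"
proof -
  obtain d where d: "finite S" "alt_rows S d" "alt_rows (S\<inverse>) (\<lambda>j i. d i j)"
    using assms by (rule asm_shapeE)
  have "(\<Sum>(j, i)\<in>S\<inverse>. d i j) = (\<Sum>(i, j)\<in>S. d i j)"
    by (rule sum.reindex_bij_witness[of _ prod.swap prod.swap]) auto
  moreover have "fst ` (S\<inverse>) = snd ` S" by force
  ultimately show ?thesis
    using alt_rows_sum[OF d(1,2)] alt_rows_sum[OF _ d(3)] d(1) by simp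
qed

lemma sorted_list_of_set_strict_mono_image:
  fixes X :: "nat set" and \<phi> :: "nat \<Rightarrow> nat"
  assumes "finite X" "strict_mono_on X \<phi>"
  shows "sorted_list_of_set (\<phi> ` X) = map \<phi> (sorted_list_of_set X)"
proof -
  have "sorted_wrt (<) (map \<phi> (sorted_list_of_set X))"
    unfolding sorted_wrt_map
    using assms by (auto intro!: sorted_wrt_mono_rel[OF _ strict_sorted_list_of_set] simp: strict_mono_on_def)
  then show ?thesis
    using assms by (intro strict_sorted_equal) (auto simp: strict_sorted_list_of_set)
qed


lemma rows_converse: "fst ` (S\<inverse>) = snd ` S"
  by force

lemma cols_converse: "snd ` (S\<inverse>) = fst ` S"
  by force

text \<open>The signs are pulled back along the inverse relabellings. As the columns keep their
  order, the list of signs of each row is literally the same list as before.\<close>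

lemma alt_rows_map_prod:
  assumes "finite S" "strict_mono_on (fst ` S) \<phi>" "strict_mono_on (snd ` S) \<psi>" "alt_rows S d"
  shows "alt_rows (map_prod \<phi> \<psi> ` S)
    (\<lambda>i j. d (the_inv_into (fst ` S) \<phi> i) (the_inv_into (snd ` S) \<psi> j))"
  unfolding alt_rows_def
proof
  let ?\<phi> = "the_inv_into (fst ` S) \<phi>" and ?\<psi> = "the_inv_into (snd ` S) \<psi>"
  fix i' assume "i' \<in> fst ` map_prod \<phi> \<psi> ` S"
  then obtain i where i: "i \<in> fst ` S" "i' = \<phi> i" by (auto simp: fst_map_prod_image)
  have inj: "inj_on \<phi> (fst ` S)" "inj_on \<psi> (snd ` S)"
    using assms strict_mono_on_imp_inj_on by auto
  have "(map_prod \<phi> \<psi> ` S) `` {\<phi> i} = \<psi> ` (S `` {i})"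
    using i inj(1) by (force simp: inj_on_def)
  moreover have sub: "S `` {i} \<subseteq> snd ` S" by force
  then have "strict_mono_on (S `` {i}) \<psi>" using monotone_on_subset[OF assms(3)] by blast
  ultimately have "sorted_list_of_set ((map_prod \<phi> \<psi> ` S) `` {\<phi> i}) = map \<psi> (sorted_list_of_set (S `` {i}))"
    using assms(1) by (simp add: sorted_list_of_set_strict_mono_image finite_Image)
  moreover have "map (\<lambda>j. d (?\<phi> (\<phi> i)) (?\<psi> j)) (map \<psi> (sorted_list_of_set (S `` {i})))
      = map (d i) (sorted_list_of_set (S `` {i}))"
    using inj i sub assms(1) by (auto simp: the_inv_into_f_f finite_Image subset_iff)
  ultimately show "alternating (map (\<lambda>j. d (?\<phi> i') (?\<psi> j))
      (sorted_list_of_set ((map_prod \<phi> \<psi> ` S) `` {i'})))"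
    using assms(4) i unfolding alt_rows_def by metis
qed

lemma converse_map_prod: "(map_prod \<phi> \<psi> ` S)\<inverse> = map_prod \<psi> \<phi> ` (S\<inverse>)"
  by force

lemma asm_shape_map_prod:
  assumes "strict_mono_on (fst ` S) \<phi>" "strict_mono_on (snd ` S) \<psi>" "asm_shape S"
  shows "asm_shape (map_prod \<phi> \<psi> ` S)"
proof -
  let ?\<phi> = "the_inv_into (fst ` S) \<phi>" and ?\<psi> = "the_inv_into (snd ` S) \<psi>"
  obtain d where d: "finite S" "\<And>i j. (i, j) \<in> S \<Longrightarrow> d i j \<in> {-1, 1}"
    "alt_rows S d" "alt_rows (S\<inverse>) (\<lambda>j i. d i j)"
    using assms(3) by (elim asm_shapeE) blast
  show ?thesis
  proof (rule asm_shapeI[where d = "\<lambda>i j. d (?\<phi> i) (?\<psi> j)"])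
    show "finite (map_prod \<phi> \<psi> ` S)" using d by simp
    show "alt_rows (map_prod \<phi> \<psi> ` S) (\<lambda>i j. d (?\<phi> i) (?\<psi> j))"
      using assms d by (intro alt_rows_map_prod)
    show "alt_rows ((map_prod \<phi> \<psi> ` S)\<inverse>) (\<lambda>j i. d (?\<phi> i) (?\<psi> j))"
      using alt_rows_map_prod[of "S\<inverse>" \<psi> \<phi> "\<lambda>j i. d i j"] assms d
      by (simp add: converse_map_prod rows_converse cols_converse)
    fix i' j' assume "(i', j') \<in> map_prod \<phi> \<psi> ` S"
    then obtain i j where ij: "(i, j) \<in> S" "i' = \<phi> i" "j' = \<psi> j" by auto
    then have "i \<in> fst ` S" "j \<in> snd ` S" by force+
    then have "?\<phi> i' = i" "?\<psi> j' = j"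
      using ij assms(1,2) by (auto intro!: the_inv_into_f_f strict_mono_on_imp_inj_on)
    then show "d (?\<phi> i') (?\<psi> j') \<in> {-1, 1}" using d(2) ij by simp
  qed
qed

lemma filter_upt_eq_sorted_list_of_set:
  "filter P [0..<n] = sorted_list_of_set {j. j < n \<and> P j}"
  by (rule strict_sorted_equal) (auto simp: strict_sorted_list_of_set sorted_wrt_filter)

text \<open>The definition of an ASM runs through all \<open>n\<close> columns of a row and drops
  the zeros; a shape lists the nonzero positions directly. Rows and columns are all occupied because
  an alternating list is nonempty.\<close>

lemma asm_mats_iff:
  "M \<in> asm_mats \<longleftrightarrow> asm_shape (snd M) \<and> fst ` snd M = {..<fst M} \<and> snd ` snd M = {..<fst M}"
proof
  assume "M \<in> asm_mats"
  then obtain n d where d: "is_asm n d" "M = asm_matrix n d" unfolding asm_mats_def by auto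
  define S where "S = {(i, j). i < n \<and> j < n \<and> d i j \<noteq> 0}"
  have M: "M = (n, S)" using d(2) by (simp add: asm_matrix_def S_def)
  have row: "filter (\<lambda>x. x \<noteq> 0) (map (\<lambda>j. d i j) [0..<n]) = map (d i) (sorted_list_of_set (S `` {i}))"
    if "i < n" for i
    using that by (simp add: filter_map filter_upt_eq_sorted_list_of_set o_def S_def Image_def)
  have col: "filter (\<lambda>x. x \<noteq> 0) (map (\<lambda>i. d i j) [0..<n]) = map (\<lambda>i. d i j) (sorted_list_of_set (S\<inverse> `` {j}))"
    if "j < n" for j
    using that by (simp add: filter_map filter_upt_eq_sorted_list_of_set o_def S_def Image_def)
  have alt: "alternating (map (d i) (sorted_list_of_set (S `` {i})))"
    "alternating (map (\<lambda>j. d j i) (sorted_list_of_set (S\<inverse> `` {i})))" if "i < n" for i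
    using d(1) that row[of i] col[of i] by (auto simp: is_asm_def)
  have fin: "finite S" by (rule finite_subset[of _ "{..<n} \<times> {..<n}"]) (auto simp: S_def)
  have "S `` {i} \<noteq> {}" "S\<inverse> `` {i} \<noteq> {}" if "i < n" for i
    using alt[OF that] by (auto simp: alternating_def)
  then have "{..<n} \<subseteq> fst ` S" "{..<n} \<subseteq> snd ` S" by force+
  then have "fst ` S = {..<n}" "snd ` S = {..<n}" by (auto simp: S_def)
  moreover have "asm_shape S"
  proof (rule asm_shapeI[of _ d])
    show "d i j \<in> {-1, 1}" if "(i, j) \<in> S" for i j
      using that d(1) by (auto simp: S_def is_asm_def)
    show "alt_rows S d" "alt_rows (S\<inverse>) (\<lambda>j i. d i j)"
      using alt by (auto simp: alt_rows_def S_def)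
  qed (fact fin)
  ultimately show "asm_shape (snd M) \<and> fst ` snd M = {..<fst M} \<and> snd ` snd M = {..<fst M}"
    by (simp add: M)
next
  assume asm: "asm_shape (snd M) \<and> fst ` snd M = {..<fst M} \<and> snd ` snd M = {..<fst M}"
  obtain n S where M: "M = (n, S)" by (cases M)
  from asm have S: "asm_shape S" "fst ` S = {..<n}" "snd ` S = {..<n}" by (auto simp: M)
  obtain d where d: "finite S" "\<And>i j. (i, j) \<in> S \<Longrightarrow> d i j \<in> {-1, 1}"
    "alt_rows S d" "alt_rows (S\<inverse>) (\<lambda>j i. d i j)"
    using S(1) by (elim asm_shapeE) blast
  \<comment> \<open>The signs witnessing a shape are arbitrary outside \<open>S\<close>, whereas
    \<open>is_asm\<close> asks for zeros there and beyond the grid.\<close>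
  define d' where "d' i j = (if (i, j) \<in> S then d i j else 0)" for i j
  have dS: "d' i j \<noteq> 0 \<longleftrightarrow> (i, j) \<in> S" for i j using d(2)[of i j] by (auto simp: d'_def)
  have lt: "i < n" "j < n" if "(i, j) \<in> S" for i j
  proof -
    have "i \<in> fst ` S" "j \<in> snd ` S" using that by force+
    then show "i < n" "j < n" using S by auto
  qed
  have "{j. j < n \<and> d' i j \<noteq> 0} = S `` {i}" "{j. j < n \<and> d' j i \<noteq> 0} = S\<inverse> `` {i}" for i
    using dS lt by auto
  then have "filter (\<lambda>x. x \<noteq> 0) (map (\<lambda>j. d' i j) [0..<n]) = map (d i) (sorted_list_of_set (S `` {i}))"
    "filter (\<lambda>x. x \<noteq> 0) (map (\<lambda>j. d' j i) [0..<n]) = map (\<lambda>j. d j i) (sorted_list_of_set (S\<inverse> `` {i}))" for i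
    using d(1) by (auto simp: filter_map filter_upt_eq_sorted_list_of_set o_def d'_def finite_Image)
  moreover have "i \<in> fst ` S" "i \<in> fst ` (S\<inverse>)" if "i < n" for i
    using S that by (auto simp: rows_converse)
  moreover have "d' i j \<in> {-1, 0, 1}" for i j using d(2)[of i j] by (auto simp: d'_def)
  moreover have "d' i j = 0" if "n \<le> i \<or> n \<le> j" for i j
    using that lt[of i j] by (auto simp: d'_def)
  ultimately have "is_asm n d'"
    using d(3,4) unfolding is_asm_def alt_rows_def by metis
  moreover have "M = asm_matrix n d'" using dS lt by (auto simp: M asm_matrix_def)
  ultimately show "M \<in> asm_mats" unfolding asm_mats_def by blast
qed

text \<open>Ranking sends the nonempty rows and the nonempty columns onto initial intervals; by
  \<open>asm_shape_square\<close> these have the same length.\<close>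

lemma compress_in_asm_mats:
  assumes "asm_shape T"
  shows "compress T \<in> asm_mats"
proof -
  have fin: "finite T" using assms by (rule asm_shape_finite)
  then have "asm_shape (map_prod (rnk (fst ` T)) (rnk (snd ` T)) ` T)"
    using assms by (intro asm_shape_map_prod strict_mono_on_rnk) auto
  then show ?thesis
    using rows_compress[OF fin] cols_compress[OF fin] asm_shape_square[OF assms]
    by (simp add: asm_mats_iff compress_eq)
qed

lemma compress_asm_mats:
  assumes "M \<in> asm_mats"
  shows "compress (snd M) = M"
proof -
  have M: "fst ` snd M = {..<fst M}" "snd ` snd M = {..<fst M}"
    using assms by (auto simp: asm_mats_iff)
  have "map_prod (rnk {..<fst M}) (rnk {..<fst M}) p = p" if "p \<in> snd M" for p
  proof -
    have "fst p \<in> fst ` snd M" "snd p \<in> snd ` snd M" using that by auto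
    then show ?thesis unfolding M by (cases p) (simp add: rnk_lessThan)
  qed
  then have "map_prod (rnk {..<fst M}) (rnk {..<fst M}) ` snd M = snd M" by force
  then show ?thesis by (simp add: compress_eq M)
qed

definition mat_transp :: "mat \<Rightarrow> mat" where
  "mat_transp M = (fst M, (snd M)\<inverse>)"

lemma mat_transp_mat_transp [simp]: "mat_transp (mat_transp M) = M"
  by (simp add: mat_transp_def)

lemma mat_transp_eq_iff [simp]: "mat_transp M = mat_transp N \<longleftrightarrow> M = N"
  by (metis mat_transp_mat_transp)

lemma fst_mat_transp [simp]: "fst (mat_transp M) = fst M"
  by (simp add: mat_transp_def)

lemma snd_mat_transp: "snd (mat_transp M) = (snd M)\<inverse>"
  by (simp add: mat_transp_def)

lemma mat_transp_asm_mats [simp]: "mat_transp M \<in> asm_mats \<longleftrightarrow> M \<in> asm_mats"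
  by (auto simp: asm_mats_iff asm_shape_converse rows_converse cols_converse mat_transp_def)

text \<open>\<open>compress\<close> takes its size from the rows alone, so it commutes with
  transposition only when there are as many nonempty rows as nonempty columns.\<close>

lemma compress_converse:
  assumes "asm_shape T"
  shows "compress (T\<inverse>) = mat_transp (compress T)"
  using asm_shape_square[OF assms]
  by (simp add: compress_eq mat_transp_def rows_converse cols_converse converse_map_prod)

section \<open>Row cuts\<close>

definition upper :: "nat \<Rightarrow> (nat \<times> nat) set \<Rightarrow> (nat \<times> nat) set" where
  "upper k S = {p \<in> S. fst p < k}"

definition lower :: "nat \<Rightarrow> (nat \<times> nat) set \<Rightarrow> (nat \<times> nat) set" where
  "lower k S = {p \<in> S. k \<le> fst p}"

text \<open>Each nonempty column lies wholly above or wholly below the cut. Both blocks then consist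
  of complete rows and complete columns of \<open>S\<close>.\<close>

definition colsep :: "nat \<Rightarrow> (nat \<times> nat) set \<Rightarrow> bool" where
  "colsep k S \<longleftrightarrow> (\<forall>i i' j. (i, j) \<in> S \<longrightarrow> (i', j) \<in> S \<longrightarrow> (i < k \<longleftrightarrow> i' < k))"

lemma colsepD: "colsep k S \<Longrightarrow> (i, j) \<in> S \<Longrightarrow> (i', j) \<in> S \<Longrightarrow> i < k \<Longrightarrow> i' < k"
  unfolding colsep_def by blast

text \<open>Rows and columns of a block are full rows and columns of \<open>S\<close>, so a choice
  of signs restricts to both blocks; conversely, signs on the two blocks never meet in a row or a
  column and can be joined.\<close>

lemma asm_shape_upper_lower:
  assumes "colsep k S"
  shows "asm_shape S \<longleftrightarrow> asm_shape (upper k S) \<and> asm_shape (lower k S)"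
proof -
  have rU: "upper k S `` {i} = S `` {i}" if "i \<in> fst ` upper k S" for i
    using that by (auto simp: upper_def)
  have rL: "lower k S `` {i} = S `` {i}" if "i \<in> fst ` lower k S" for i
    using that by (auto simp: lower_def)
  have cU: "(upper k S)\<inverse> `` {j} = S\<inverse> `` {j}" if "j \<in> fst ` ((upper k S)\<inverse>)" for j
    using that by (auto simp: upper_def dest: colsepD[OF assms])
  have cL: "(lower k S)\<inverse> `` {j} = S\<inverse> `` {j}" if "j \<in> fst ` ((lower k S)\<inverse>)" for j
    using that by (auto simp: lower_def not_less[symmetric] dest: colsepD[OF assms])
  have un: "S = upper k S \<union> lower k S" by (auto simp: upper_def lower_def)
  show ?thesis
  proof
    assume "asm_shape S"
    then obtain d where d: "finite S" "\<And>i j. (i, j) \<in> S \<Longrightarrow> d i j \<in> {-1, 1}"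
      "alt_rows S d" "alt_rows (S\<inverse>) (\<lambda>j i. d i j)"
      by (elim asm_shapeE) blast
    have sub: "fst ` upper k S \<subseteq> fst ` S" "fst ` lower k S \<subseteq> fst ` S"
      "fst ` ((upper k S)\<inverse>) \<subseteq> fst ` (S\<inverse>)" "fst ` ((lower k S)\<inverse>) \<subseteq> fst ` (S\<inverse>)"
      by (auto simp: upper_def lower_def rows_converse)
    have "asm_shape (upper k S)"
      by (rule asm_shapeI[of _ d])
        (use d rU cU sub in \<open>auto simp: alt_rows_def upper_def subset_iff\<close>)
    moreover have "asm_shape (lower k S)"
      by (rule asm_shapeI[of _ d])
        (use d rL cL sub in \<open>auto simp: alt_rows_def lower_def subset_iff\<close>)
    ultimately show "asm_shape (upper k S) \<and> asm_shape (lower k S)" by blast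
  next
    assume *: "asm_shape (upper k S) \<and> asm_shape (lower k S)"
    obtain d1 where d1: "finite (upper k S)" "\<And>i j. (i, j) \<in> upper k S \<Longrightarrow> d1 i j \<in> {-1, 1}"
      "alt_rows (upper k S) d1" "alt_rows ((upper k S)\<inverse>) (\<lambda>j i. d1 i j)"
      using * by (elim conjE asm_shapeE) blast
    obtain d2 where d2: "finite (lower k S)" "\<And>i j. (i, j) \<in> lower k S \<Longrightarrow> d2 i j \<in> {-1, 1}"
      "alt_rows (lower k S) d2" "alt_rows ((lower k S)\<inverse>) (\<lambda>j i. d2 i j)"
      using * by (elim conjE asm_shapeE) blast
    \<comment> \<open>The row index alone decides which signs to take; by \<open>colsep\<close> a
      whole column also falls under one case.\<close>
    define d where "d i j = (if i < k then d1 i j else d2 i j)" for i j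
    show "asm_shape S"
    proof (rule asm_shapeI[of _ d])
      show "finite S" using d1(1) d2(1) un by (metis finite_UnI)
      show "d i j \<in> {-1, 1}" if "(i, j) \<in> S" for i j
        using that d1(2)[of i j] d2(2)[of i j] by (auto simp: d_def upper_def lower_def)
      show "alt_rows S d"
        unfolding alt_rows_def
      proof
        fix i assume "i \<in> fst ` S"
        then show "alternating (map (d i) (sorted_list_of_set (S `` {i})))"
        proof (cases "i < k")
          case True
          then have "i \<in> fst ` upper k S" using \<open>i \<in> fst ` S\<close> by (force simp: upper_def)
          moreover have "d i = d1 i" using True by (auto simp: d_def)
          ultimately show ?thesis using d1(3) rU unfolding alt_rows_def by metis
        next
          case False
          then have "i \<in> fst ` lower k S" using \<open>i \<in> fst ` S\<close> by (force simp: lower_def)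
          moreover have "d i = d2 i" using False by (auto simp: d_def)
          ultimately show ?thesis using d2(3) rL unfolding alt_rows_def by metis
        qed
      qed
      show "alt_rows (S\<inverse>) (\<lambda>j i. d i j)"
        unfolding alt_rows_def
      proof
        fix j assume "j \<in> fst ` (S\<inverse>)"
        then consider "j \<in> fst ` ((upper k S)\<inverse>)" | "j \<in> fst ` ((lower k S)\<inverse>)"
          by (force simp: upper_def lower_def)
        then show "alternating (map (\<lambda>i. d i j) (sorted_list_of_set (S\<inverse> `` {j})))"
        proof cases
          case 1
          have "map (\<lambda>i. d i j) (sorted_list_of_set ((upper k S)\<inverse> `` {j}))
              = map (\<lambda>i. d1 i j) (sorted_list_of_set ((upper k S)\<inverse> `` {j}))"
            using d1(1) by (auto simp: d_def upper_def finite_Image finite_converse)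
          then show ?thesis using 1 d1(4) cU unfolding alt_rows_def by metis
        next
          case 2
          have "map (\<lambda>i. d i j) (sorted_list_of_set ((lower k S)\<inverse> `` {j}))
              = map (\<lambda>i. d2 i j) (sorted_list_of_set ((lower k S)\<inverse> `` {j}))"
            using d2(1) by (auto simp: d_def lower_def finite_Image finite_converse)
          then show ?thesis using 2 d2(4) cL unfolding alt_rows_def by metis
        qed
      qed
    qed
  qed
qed

section \<open>Shuffles and splittings as cuts\<close>

text \<open>\<open>T\<close> may have null rows and columns, so \<open>k\<close> is a position in
  the coordinates of \<open>T\<close> and need not be the size of \<open>A\<close>.\<close>

definition cut :: "nat \<Rightarrow> (nat \<times> nat) set \<Rightarrow> mat \<Rightarrow> mat \<Rightarrow> bool" where
  "cut k T A B \<longleftrightarrow> colsep k T \<and> compress (upper k T) = A \<and> compress (lower k T) = B"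

lemma colsep_subset: "colsep k S \<Longrightarrow> T \<subseteq> S \<Longrightarrow> colsep k T"
  unfolding colsep_def by blast

lemma fst_compress: "fst (compress T) = card (fst ` T)"
  by (simp add: compress_def)

lemma rows_upper: "fst ` upper k T = {i \<in> fst ` T. i < k}"
  by (auto simp: upper_def)

lemma rows_lower: "fst ` lower k T = {i \<in> fst ` T. k \<le> i}"
  by (auto simp: lower_def)

lemma fst_compress_upper: "fst (compress (upper k T)) = rnk (fst ` T) k"
  by (simp add: fst_compress rows_upper rnk_def)

lemma upper_subset: "upper k T \<subseteq> T" and lower_subset: "lower k T \<subseteq> T"
  by (auto simp: upper_def lower_def)

lemma upper_Un_lower: "upper k T \<union> lower k T = T"
  by (auto simp: upper_def lower_def)

lemma upper_compress:
  assumes "finite T"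
  shows "upper (rnk (fst ` T) k) (snd (compress T)) = map_prod (rnk (fst ` T)) (rnk (snd ` T)) ` upper k T"
proof -
  have "rnk (fst ` T) (fst p) < rnk (fst ` T) k \<longleftrightarrow> fst p < k" if "p \<in> T" for p
    using assms that by (intro rnk_less_iff) auto
  then show ?thesis by (auto simp: upper_def compress_eq)
qed

lemma lower_compress:
  assumes "finite T"
  shows "lower (rnk (fst ` T) k) (snd (compress T)) = map_prod (rnk (fst ` T)) (rnk (snd ` T)) ` lower k T"
proof -
  have "rnk (fst ` T) k \<le> rnk (fst ` T) (fst p) \<longleftrightarrow> k \<le> fst p" if "p \<in> T" for p
    using assms that rnk_less_iff[of "fst ` T" "fst p" k] by (auto simp: not_less[symmetric])
  then show ?thesis by (auto simp: lower_def compress_eq)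
qed

lemma colsep_compress:
  assumes "finite T"
  shows "colsep (rnk (fst ` T) k) (snd (compress T)) \<longleftrightarrow> colsep k T"
proof -
  have r: "rnk (fst ` T) i < rnk (fst ` T) k \<longleftrightarrow> i < k" if "(i, j) \<in> T" for i j
    using assms that by (intro rnk_less_iff) (auto intro: image_eqI[of _ _ "(i, j)"])
  have "inj_on (rnk (snd ` T)) (snd ` T)"
    using assms by (intro strict_mono_on_imp_inj_on strict_mono_on_rnk) simp
  then have c: "rnk (snd ` T) j = rnk (snd ` T) j' \<longleftrightarrow> j = j'" if "(i, j) \<in> T" "(i', j') \<in> T" for i j i' j'
    using that by (metis image_eqI inj_on_eq_iff snd_conv)
  have "colsep (rnk (fst ` T) k) (snd (compress T)) \<longleftrightarrow> (\<forall>(i, j)\<in>T. \<forall>(i', j')\<in>T.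
      rnk (snd ` T) j = rnk (snd ` T) j' \<longrightarrow>
      (rnk (fst ` T) i < rnk (fst ` T) k \<longleftrightarrow> rnk (fst ` T) i' < rnk (fst ` T) k))"
    unfolding colsep_def compress_eq by (simp add: map_prod_def image_iff) fastforce
  also have "\<dots> \<longleftrightarrow> (\<forall>(i, j)\<in>T. \<forall>(i', j')\<in>T. j = j' \<longrightarrow> (i < k \<longleftrightarrow> i' < k))"
    using r c by (simp add: split_def) (metis prod.collapse)
  also have "\<dots> \<longleftrightarrow> colsep k T" unfolding colsep_def by fast
  finally show ?thesis .
qed

lemma compress_compress_image:
  assumes "finite T" "T' \<subseteq> T"
  shows "compress (map_prod (rnk (fst ` T)) (rnk (snd ` T)) ` T') = compress T'"
  using assms
  by (intro compress_map_prod monotone_on_subset[OF strict_mono_on_rnk] image_mono) auto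

text \<open>Cutting commutes with compression once the position is replaced by its rank among the
  nonempty rows. Cuts of a factor can thus be studied as cuts of the block it comes from.\<close>

lemma cut_compress:
  assumes "finite T"
  shows "cut (rnk (fst ` T) k) (snd (compress T)) A B \<longleftrightarrow> cut k T A B"
  using assms unfolding cut_def
  by (simp add: colsep_compress upper_compress lower_compress compress_compress_image
      upper_subset lower_subset)

text \<open>When the nonempty rows and columns are known, the ranks are fixed injections and
  compression loses nothing.\<close>

lemma compress_inj:
  assumes "finite T" "fst ` T = fst ` T'" "snd ` T = snd ` T'" "compress T = compress T'"
  shows "T = T'"
proof -
  let ?R = "map_prod (rnk (fst ` T)) (rnk (snd ` T))"
  have "inj_on (rnk (fst ` T)) (fst ` T)" "inj_on (rnk (snd ` T)) (snd ` T)"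
    using assms(1) by (auto intro!: strict_mono_on_imp_inj_on strict_mono_on_rnk)
  then have "inj_on ?R (fst ` T \<times> snd ` T)" by (rule map_prod_inj_on)
  moreover have "T \<subseteq> fst ` T \<times> snd ` T" "T' \<subseteq> fst ` T \<times> snd ` T"
    using subset_fst_snd[of T] subset_fst_snd[of T'] assms(2,3) by simp_all
  moreover have "?R ` T = ?R ` T'" using assms(2,3,4) by (simp add: compress_eq)
  ultimately show ?thesis by (metis inj_on_image_eq_iff)
qed

lemma asm_matsD:
  assumes "M \<in> asm_mats"
  shows "asm_shape (snd M)" "finite (snd M)" "fst ` snd M = {..<fst M}" "snd ` snd M = {..<fst M}"
  using assms asm_shape_finite by (auto simp: asm_mats_iff)

lemma asm_mats_lt:
  assumes "M \<in> asm_mats" "(i, j) \<in> snd M"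
  shows "i < fst M" "j < fst M"
proof -
  have "i \<in> fst ` snd M" "j \<in> snd ` snd M" using assms(2) by force+
  then show "i < fst M" "j < fst M" using asm_matsD[OF assms(1)] by auto
qed

lemma colsep_disjoint: "colsep k S \<Longrightarrow> snd ` upper k S \<inter> snd ` lower k S = {}"
  unfolding upper_def lower_def by (auto dest: colsepD)

text \<open>A block on consecutive rows differs from its compression by a shift of the rows and an
  increasing relabelling \<open>y\<close> of the columns, which is exactly the form in which
  \<open>shc\<close> places its factors.\<close>

lemma uncompress:
  assumes "asm_shape T" "fst ` T = {c..<c + m}"
  obtains y where "strict_mono_on {..<m} y" "y ` {..<m} = snd ` T"
    "T = map_prod ((+) c) y ` snd (compress T)"
proof -
  have card: "card (snd ` T) = m" using asm_shape_square[OF assms(1)] assms(2) by simp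
  have fin: "finite T" using assms(1) by (rule asm_shape_finite)
  then obtain y where y: "strict_mono_on {..<m} y" "y ` {..<m} = snd ` T"
    "\<And>x. x \<in> snd ` T \<Longrightarrow> y (rnk (snd ` T) x) = x"
    using unrank[of "snd ` T"] card by auto
  have "map_prod ((+) c) y (map_prod (rnk (fst ` T)) (rnk (snd ` T)) p) = p" if "p \<in> T" for p
  proof -
    have "fst p \<in> {c..<c + m}" "snd p \<in> snd ` T" using that assms(2) by auto
    then show ?thesis using y(3) unfolding assms(2) by (cases p) (simp add: rnk_atLeastLessThan)
  qed
  then have "map_prod ((+) c) y ` snd (compress T) = T"
    by (simp add: compress_eq image_image)
  then show thesis using that[OF y(1,2)] by simp
qed

lemma strict_mono_on_plus: "strict_mono_on X ((+) (a :: nat))"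
  by (auto simp: strict_mono_on_def)

text \<open>A shuffle puts \<open>A\<close> into the first \<open>fst A\<close> rows and
  \<open>B\<close> into the others, on complementary sets of columns, so cutting below row
  \<open>fst A\<close> gives the factors back. In the other direction \<open>f\<close> and
  \<open>g\<close> are the increasing enumerations of the column sets of the two blocks.\<close>

lemma shc_iff:
  assumes A: "A \<in> asm_mats" and B: "B \<in> asm_mats"
  shows "M \<in> shc A B \<longleftrightarrow> M \<in> asm_mats \<and> cut (fst A) (snd M) A B"
proof
  let ?a = "fst A" and ?b = "fst B"
  assume "M \<in> shc A B"
  then obtain f g where fg: "strict_mono_on {..<?a} f" "strict_mono_on {..<?b} g"
    "f ` {..<?a} \<union> g ` {..<?b} = {..<?a + ?b}" "f ` {..<?a} \<inter> g ` {..<?b} = {}"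
    and M: "M = (?a + ?b, map_prod id f ` snd A \<union> map_prod ((+) ?a) g ` snd B)"
    unfolding shc_def by (auto simp: map_prod_def)
  have up: "upper ?a (snd M) = map_prod id f ` snd A"
    by (auto simp: M upper_def dest: asm_mats_lt[OF A])
  have lo: "lower ?a (snd M) = map_prod ((+) ?a) g ` snd B"
    by (auto simp: M lower_def dest: asm_mats_lt[OF A])
  have sep: "colsep ?a (snd M)"
    unfolding colsep_def
  proof (intro allI impI)
    have *: "i' < ?a" if "(i, j) \<in> snd M" "(i', j) \<in> snd M" "i < ?a" for i i' j
    proof (rule ccontr)
      assume "\<not> i' < ?a"
      then have "(i', j) \<in> map_prod ((+) ?a) g ` snd B" unfolding lo[symmetric]
        using that by (auto simp: lower_def)
      moreover have "(i, j) \<in> map_prod id f ` snd A" unfolding up[symmetric]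
        using that by (auto simp: upper_def)
      ultimately have "j \<in> f ` {..<?a} \<inter> g ` {..<?b}"
        using asm_mats_lt[OF A] asm_mats_lt[OF B] by auto
      then show False using fg by simp
    qed
    show "i < ?a \<longleftrightarrow> i' < ?a" if "(i, j) \<in> snd M" "(i', j) \<in> snd M" for i i' j
      using *[OF that] *[OF that(2,1)] by blast
  qed
  have "asm_shape (map_prod id f ` snd A)" "asm_shape (map_prod ((+) ?a) g ` snd B)"
    using fg asm_matsD[OF A] asm_matsD[OF B]
    by (auto intro!: asm_shape_map_prod strict_mono_on_plus simp: strict_mono_on_def)
  then have "asm_shape (snd M)" using asm_shape_upper_lower[OF sep] up lo by simp
  moreover have "fst ` snd M = {..<fst M}" "snd ` snd M = {..<fst M}"
    using asm_matsD[OF A] asm_matsD[OF B] fg(3)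
    by (simp_all add: M image_Un fst_map_prod_image snd_map_prod_image lessThan_atLeast0)
      (simp add: ivl_disj_un add.commute)
  ultimately have "M \<in> asm_mats" by (simp add: asm_mats_iff)
  moreover have "compress (map_prod id f ` snd A) = A" "compress (map_prod ((+) ?a) g ` snd B) = B"
    using fg asm_matsD[OF A] asm_matsD[OF B] compress_asm_mats[OF A] compress_asm_mats[OF B]
    by (subst compress_map_prod; simp add: strict_mono_on_plus strict_mono_on_def)+
  ultimately show "M \<in> asm_mats \<and> cut ?a (snd M) A B"
    using sep by (simp add: cut_def up lo)
next
  let ?a = "fst A" and ?b = "fst B" and ?S = "snd M" and ?n = "fst M"
  assume asm: "M \<in> asm_mats \<and> cut ?a (snd M) A B"
  then have M: "M \<in> asm_mats" and sep: "colsep ?a ?S" and cu: "compress (upper ?a ?S) = A"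
    and cl: "compress (lower ?a ?S) = B" by (auto simp: cut_def)
  have sh: "asm_shape (upper ?a ?S)" "asm_shape (lower ?a ?S)"
    using asm_shape_upper_lower[OF sep] asm_matsD[OF M] by auto
  have ru: "fst ` upper ?a ?S = {..<min ?a ?n}" and rl: "fst ` lower ?a ?S = {?a..<?n}"
    using asm_matsD[OF M] by (auto simp: rows_upper rows_lower)
  \<comment> \<open>\<open>cut\<close> does not bound its position; counting the rows of the upper
    block rules out a cut beyond the last row.\<close>
  have "?a = min ?a ?n" using fst_compress[of "upper ?a ?S"] by (simp add: cu ru)
  then have an: "?a \<le> ?n" by simp
  moreover have b: "?b = ?n - ?a" using fst_compress[of "lower ?a ?S"] by (simp add: cl rl)
  ultimately have n: "?n = ?a + ?b" by simp
  obtain f where f: "strict_mono_on {..<?a} f" "f ` {..<?a} = snd ` upper ?a ?S"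
    "upper ?a ?S = map_prod ((+) 0) f ` snd (compress (upper ?a ?S))"
    by (rule uncompress[OF sh(1), of 0 ?a]) (use ru an in \<open>auto simp: atLeast0LessThan\<close>)
  obtain g where g: "strict_mono_on {..<?b} g" "g ` {..<?b} = snd ` lower ?a ?S"
    "lower ?a ?S = map_prod ((+) ?a) g ` snd (compress (lower ?a ?S))"
    by (rule uncompress[OF sh(2), of ?a ?b]) (use rl n in auto)
  have "?S = map_prod ((+) 0) f ` snd A \<union> map_prod ((+) ?a) g ` snd B"
    using upper_Un_lower[of ?a ?S] f(3) g(3) by (simp add: cu cl)
  then have "M = (?a + ?b, (\<lambda>(i, j). (i, f j)) ` snd A \<union> (\<lambda>(i, j). (?a + i, g j)) ` snd B)"
    using n by (cases M) (simp add: map_prod_def)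
  moreover have "f ` {..<?a} \<union> g ` {..<?b} = {..<?a + ?b}"
    using f(2) g(2) upper_Un_lower[of ?a ?S] asm_matsD(4)[OF M] by (simp add: image_Un[symmetric] n)
  moreover have "f ` {..<?a} \<inter> g ` {..<?b} = {}"
    using f(2) g(2) colsep_disjoint[OF sep] by simp
  ultimately show "M \<in> shc A B" using f(1) g(1) unfolding shc_def by blast
qed

lemma asm_shape_upper: "colsep k S \<Longrightarrow> asm_shape S \<Longrightarrow> asm_shape (upper k S)"
  and asm_shape_lower: "colsep k S \<Longrightarrow> asm_shape S \<Longrightarrow> asm_shape (lower k S)"
  using asm_shape_upper_lower by auto

lemma rnk_lessThan_le: "rnk {..<n} k \<le> n"
proof -
  have "rnk {..<n} k \<le> card {..<n}" unfolding rnk_def by (rule card_mono) auto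
  then show ?thesis by simp
qed

text \<open>A splitting by columns is a row cut of the converse. The definition asks for square
  blocks rather than for separation, but squareness forces it: the two blocks occupy
  \<open>k\<close> and \<open>n - k\<close> rows and together all \<open>n\<close>, so they share
  none. Conversely separation makes the blocks ASM shapes, which are square.\<close>

lemma splits_iff:
  assumes M: "M \<in> asm_mats"
  shows "(A, B) \<in> splits M \<longleftrightarrow> A \<in> asm_mats \<and> B \<in> asm_mats
    \<and> cut (fst A) ((snd M)\<inverse>) (mat_transp A) (mat_transp B)"
proof -
  let ?S = "snd M" and ?n = "fst M"
  have lb: "left_block M k = (upper k (?S\<inverse>))\<inverse>" and rb: "right_block M k = (lower k (?S\<inverse>))\<inverse>" for k
    by (auto simp: left_block_def right_block_def upper_def lower_def)
  have S: "asm_shape (?S\<inverse>)" "finite ?S" "fst ` (?S\<inverse>) = {..<?n}" "snd ` (?S\<inverse>) = {..<?n}"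
    using asm_matsD[OF M] by (simp_all add: asm_shape_converse rows_converse cols_converse)
  have fin: "finite (snd ` upper k (?S\<inverse>))" "finite (snd ` lower k (?S\<inverse>))" for k
    using S(2) by (auto simp: upper_def lower_def)
  show ?thesis
  proof
    assume "(A, B) \<in> splits M"
    then obtain k where k: "k \<le> ?n" "square_set (left_block M k)" "square_set (right_block M k)"
      "A = compress (left_block M k)" "B = compress (right_block M k)"
      by (auto simp: splits_def)
    let ?U = "upper k (?S\<inverse>)" and ?L = "lower k (?S\<inverse>)"
    have rows: "fst ` ?U = {..<k}" "fst ` ?L = {k..<?n}"
      using k(1) S(3) by (auto simp: rows_upper rows_lower)
    have cU: "card (snd ` ?U) = k" and cL: "card (snd ` ?L) = ?n - k"
      using k(2,3) rows unfolding square_set_def lb rb rows_converse cols_converse by simp_all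
    have "snd ` ?U \<union> snd ` ?L = {..<?n}"
      using S(4) by (simp add: image_Un[symmetric] upper_Un_lower)
    \<comment> \<open>The blocks live in the converse, so \<open>snd\<close> picks rows of
      \<open>M\<close>. The two cardinalities already add up to \<open>n\<close>, which leaves no
      room for a common row.\<close>
    then have "card (snd ` ?U) + card (snd ` ?L) = ?n + card (snd ` ?U \<inter> snd ` ?L)"
      using card_Un_Int[OF fin] by simp
    then have "snd ` ?U \<inter> snd ` ?L = {}" using cU cL k(1) fin by simp
    then have "i' < k" if "(i, j) \<in> ?S\<inverse>" "(i', j) \<in> ?S\<inverse>" "i < k" for i i' j
      using that by (force simp: upper_def lower_def)
    then have sep: "colsep k (?S\<inverse>)" unfolding colsep_def by blast
    have sh: "asm_shape (?U\<inverse>)" "asm_shape (?L\<inverse>)"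
      using S(1) sep by (simp_all add: asm_shape_converse asm_shape_upper asm_shape_lower)
    have "fst A = k" using cU by (simp add: k lb fst_compress rows_converse)
    moreover have "mat_transp A = compress ?U" "mat_transp B = compress ?L"
      using sh by (simp_all add: k lb rb compress_converse asm_shape_converse)
    ultimately show "A \<in> asm_mats \<and> B \<in> asm_mats \<and> cut (fst A) (?S\<inverse>) (mat_transp A) (mat_transp B)"
      using sep sh by (simp add: cut_def k lb rb compress_in_asm_mats)
  next
    let ?k = "fst A"
    let ?U = "upper ?k (?S\<inverse>)" and ?L = "lower ?k (?S\<inverse>)"
    assume "A \<in> asm_mats \<and> B \<in> asm_mats \<and> cut ?k (?S\<inverse>) (mat_transp A) (mat_transp B)"
    then have sep: "colsep ?k (?S\<inverse>)" and AB: "mat_transp A = compress ?U" "mat_transp B = compress ?L"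
      by (auto simp: cut_def)
    have sh: "asm_shape ?U" "asm_shape ?L"
      using S(1) sep by (simp_all add: asm_shape_upper asm_shape_lower)
    have "fst (mat_transp A) = rnk {..<?n} ?k" unfolding AB fst_compress_upper S(3) ..
    then have "?k \<le> ?n" using rnk_lessThan_le[of ?n ?k] by simp
    moreover have "A = compress (left_block M ?k)" "B = compress (right_block M ?k)"
      using sh by (simp_all add: lb rb compress_converse AB[symmetric])
    moreover have "square_set (left_block M ?k)" "square_set (right_block M ?k)"
      using sh by (simp_all add: lb rb square_set_def rows_converse cols_converse asm_shape_square)
    ultimately show "(A, B) \<in> splits M" unfolding splits_def by blast
  qed
qed

text \<open>Duality of product and coproduct at the level of matrices; the coproduct coefficients
  are rewritten as product coefficients of transposes through it.\<close>

lemma splits_iff_shc: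
  assumes "M \<in> asm_mats"
  shows "(A, B) \<in> splits M \<longleftrightarrow> A \<in> asm_mats \<and> B \<in> asm_mats \<and> mat_transp M \<in> shc (mat_transp A) (mat_transp B)"
  using splits_iff[OF assms, of A B] shc_iff[of "mat_transp A" "mat_transp B" "mat_transp M"] assms
  by (auto simp: snd_mat_transp)

lemma fst_shc: "M \<in> shc A B \<Longrightarrow> fst M = fst A + fst B"
  by (auto simp: shc_def)

lemma shc_asm: "A \<in> asm_mats \<Longrightarrow> B \<in> asm_mats \<Longrightarrow> M \<in> shc A B \<Longrightarrow> M \<in> asm_mats"
  by (simp add: shc_iff)

lemma compress_shc_iff:
  assumes "asm_shape T" "A \<in> asm_mats" "B \<in> asm_mats" "fst A = rnk (fst ` T) k"
  shows "compress T \<in> shc A B \<longleftrightarrow> cut k T A B"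
  using assms by (simp add: shc_iff compress_in_asm_mats cut_compress asm_shape_finite)

section \<open>Iterated cuts and crossing cuts\<close>

text \<open>Both sides say that the three bands of rows below \<open>a\<close>, from
  \<open>a\<close> to \<open>c\<close>, and from \<open>c\<close> on have pairwise disjoint
  columns.\<close>

lemma colsep_assoc:
  assumes "a \<le> c"
  shows "colsep c S \<and> colsep a (upper c S) \<longleftrightarrow> colsep a S \<and> colsep c (lower a S)"
proof -
  have "((i < c \<longleftrightarrow> i' < c) \<and> (i < c \<longrightarrow> i' < c \<longrightarrow> (i < a \<longleftrightarrow> i' < a))) \<longleftrightarrow>
      ((i < a \<longleftrightarrow> i' < a) \<and> (a \<le> i \<longrightarrow> a \<le> i' \<longrightarrow> (i < c \<longleftrightarrow> i' < c)))" for i i'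
    using assms by linarith
  then have "(\<forall>i i' j. (i, j) \<in> S \<longrightarrow> (i', j) \<in> S \<longrightarrow>
        (i < c \<longleftrightarrow> i' < c) \<and> (i < c \<longrightarrow> i' < c \<longrightarrow> (i < a \<longleftrightarrow> i' < a))) \<longleftrightarrow>
      (\<forall>i i' j. (i, j) \<in> S \<longrightarrow> (i', j) \<in> S \<longrightarrow>
        (i < a \<longleftrightarrow> i' < a) \<and> (a \<le> i \<longrightarrow> a \<le> i' \<longrightarrow> (i < c \<longleftrightarrow> i' < c)))"
    by presburger
  then show ?thesis unfolding colsep_def upper_def lower_def mem_Collect_eq fst_conv by meson
qed

lemma upper_upper: "a \<le> c \<Longrightarrow> upper a (upper c S) = upper a S"
  by (auto simp: upper_def)

lemma lower_lower: "a \<le> c \<Longrightarrow> lower c (lower a S) = lower c S"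
  by (auto simp: lower_def)

lemma lower_upper: "lower a (upper c S) = upper c (lower a S)"
  by (auto simp: lower_def upper_def)

text \<open>A term \<open>M\<close> of (AB)C falls into three bands of rows. The intermediate factor
  is forced to be the compression of the first two, and compressing the last two exhibits
  \<open>M\<close> as a term of A(BC).\<close>

lemma shc_middle_left:
  assumes A: "A \<in> asm_mats" and B: "B \<in> asm_mats" and C: "C \<in> asm_mats"
    and M': "M' \<in> shc A B" and M: "M \<in> shc M' C"
  shows "M' = compress (upper (fst A + fst B) (snd M))"
    "compress (lower (fst A) (snd M)) \<in> shc B C" "M \<in> shc A (compress (lower (fst A) (snd M)))"
proof -
  let ?a = "fst A" and ?c = "fst A + fst B" and ?S = "snd M"
  let ?T = "upper ?c ?S" and ?T' = "lower ?a ?S"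
  have M'': "M' \<in> asm_mats" "fst M' = ?c" using shc_asm[OF A B M'] fst_shc[OF M'] by auto
  have n: "?c \<le> fst M" using fst_shc[OF M] M'' by simp
  have MA: "M \<in> asm_mats" and c: "cut ?c ?S M' C" using M shc_iff[OF M''(1) C] M'' by auto
  then show MT: "M' = compress ?T" by (simp add: cut_def)
  have sep: "colsep ?c ?S" using c by (simp add: cut_def)
  have shT: "asm_shape ?T" using sep asm_matsD[OF MA] by (simp add: asm_shape_upper)
  have rT: "fst ` ?T = {..<?c}" "fst ` ?T' = {?a..<fst M}"
    using asm_matsD[OF MA] n by (auto simp: rows_upper rows_lower)
  have c': "cut ?a ?T A B"
    using M' compress_shc_iff[OF shT A B, of ?a] rT by (simp add: MT[symmetric] rnk_lessThan)
  then have sep': "colsep ?a ?S" "colsep ?c ?T'"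
    using colsep_assoc[of ?a ?c ?S] sep by (auto simp: cut_def)
  have shT': "asm_shape ?T'" using sep' asm_matsD[OF MA] by (simp add: asm_shape_lower)
  have "cut ?c ?T' B C"
    using c c' sep' by (simp add: cut_def lower_lower lower_upper)
  then show M1: "compress ?T' \<in> shc B C"
    using compress_shc_iff[OF shT' B C, of ?c] rT n by (simp add: rnk_atLeastLessThan)
  show "M \<in> shc A (compress ?T')"
    using c' sep' MA by (simp add: shc_iff A compress_in_asm_mats shT' cut_def upper_upper)
qed

text \<open>The mirror image of \<open>shc_middle_left\<close>: together they match the terms of the
  two bracketings one to one.\<close>

lemma shc_middle_right:
  assumes A: "A \<in> asm_mats" and B: "B \<in> asm_mats" and C: "C \<in> asm_mats"
    and M': "M' \<in> shc B C" and M: "M \<in> shc A M'"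
  shows "M' = compress (lower (fst A) (snd M))"
    "compress (upper (fst A + fst B) (snd M)) \<in> shc A B"
    "M \<in> shc (compress (upper (fst A + fst B) (snd M))) C"
proof -
  let ?a = "fst A" and ?c = "fst A + fst B" and ?S = "snd M"
  let ?T = "upper ?c ?S" and ?T' = "lower ?a ?S"
  have M'': "M' \<in> asm_mats" "fst M' = fst B + fst C" using shc_asm[OF B C M'] fst_shc[OF M'] by auto
  have n: "?c \<le> fst M" using fst_shc[OF M] M'' by simp
  have MA: "M \<in> asm_mats" and c: "cut ?a ?S A M'" using M shc_iff[OF A M''(1)] by auto
  then show MT: "M' = compress ?T'" by (simp add: cut_def)
  have sep: "colsep ?a ?S" using c by (simp add: cut_def)
  have shT: "asm_shape ?T'" using sep asm_matsD[OF MA] by (simp add: asm_shape_lower)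
  have rT: "fst ` ?T = {..<?c}" "fst ` ?T' = {?a..<fst M}"
    using asm_matsD[OF MA] n by (auto simp: rows_upper rows_lower)
  have c': "cut ?c ?T' B C"
    using M' compress_shc_iff[OF shT B C, of ?c] rT n by (simp add: MT[symmetric] rnk_atLeastLessThan)
  then have sep': "colsep ?c ?S" "colsep ?a ?T"
    using colsep_assoc[of ?a ?c ?S] sep by (auto simp: cut_def)
  have shT': "asm_shape ?T" using sep' asm_matsD[OF MA] by (simp add: asm_shape_upper)
  have "cut ?a ?T A B"
    using c c' sep' by (simp add: cut_def upper_upper lower_upper)
  then show "compress ?T \<in> shc A B"
    using compress_shc_iff[OF shT' A B, of ?a] rT n by (simp add: rnk_lessThan)
  have "fst (compress ?T) = ?c" by (simp add: fst_compress rT)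
  then show "M \<in> shc (compress ?T) C"
    using c' sep' MA by (simp add: shc_iff C compress_in_asm_mats shT' cut_def lower_lower)
qed

text \<open>The last column of \<open>M\<close> comes from the first factor (from the second one for \<open>last_lower\<close>). Both are
  false for the empty matrix, although \<open>fst M - 1\<close> is truncated there.\<close>

definition last_upper :: "nat \<Rightarrow> mat \<Rightarrow> bool" where
  "last_upper k M \<longleftrightarrow> fst M - 1 \<in> snd ` upper k (snd M)"

definition last_lower :: "nat \<Rightarrow> mat \<Rightarrow> bool" where
  "last_lower k M \<longleftrightarrow> fst M - 1 \<in> snd ` lower k (snd M)"

text \<open>If the last column of \<open>M\<close> meets \<open>T\<close>, it is still the last one
  after the null columns of \<open>T\<close> have been deleted, so compression does not change the
  side of the cut on which it lies.\<close>

lemma last_col_compress: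
  assumes M: "M \<in> asm_mats" and T: "T \<subseteq> snd M" "asm_shape T" "fst M - 1 \<in> snd ` T"
  shows "last_upper (rnk (fst ` T) k) (compress T) \<longleftrightarrow> fst M - 1 \<in> snd ` upper k T"
    "last_lower (rnk (fst ` T) k) (compress T) \<longleftrightarrow> fst M - 1 \<in> snd ` lower k T"
proof -
  let ?m = "fst M - 1" and ?r = "rnk (snd ` T)"
  have fin: "finite T" using T(2) by (rule asm_shape_finite)
  have "j \<le> ?m" if "j \<in> snd ` T" for j
    using that T(1) asm_mats_lt(2)[OF M] by fastforce
  then have "{y \<in> snd ` T. y < ?m} = snd ` T - {?m}" by fastforce
  then have "?r ?m = card (snd ` T) - 1" using T(3) fin by (simp add: rnk_def)
  then have last: "fst (compress T) - 1 = ?r ?m"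
    using asm_shape_square[OF T(2)] by (simp add: fst_compress)
  have inj: "inj_on ?r (snd ` T)"
    using fin by (intro strict_mono_on_imp_inj_on strict_mono_on_rnk) simp
  have *: "?r ?m \<in> ?r ` snd ` T' \<longleftrightarrow> ?m \<in> snd ` T'" if "T' \<subseteq> T" for T'
    using that by (intro inj_on_image_mem_iff[OF inj T(3)]) auto
  show "last_upper (rnk (fst ` T) k) (compress T) \<longleftrightarrow> ?m \<in> snd ` upper k T"
    unfolding last_upper_def last upper_compress[OF fin] snd_map_prod_image
    by (rule *) (rule upper_subset)
  show "last_lower (rnk (fst ` T) k) (compress T) \<longleftrightarrow> ?m \<in> snd ` lower k T"
    unfolding last_lower_def last lower_compress[OF fin] snd_map_prod_image
    by (rule *) (rule lower_subset)
qed

text \<open>The three equivalences describe the last column of \<open>M\<close> as coming from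
  \<open>A\<close>, from \<open>B\<close> and from \<open>C\<close>, once through the bracketing
  (AB)C and once through A(BC). They become the three dendriform relations.\<close>

lemma shc_middle_last:
  assumes A: "A \<in> asm_mats" and B: "B \<in> asm_mats" and C: "C \<in> asm_mats"
    and M': "M' \<in> shc A B" and M: "M \<in> shc M' C"
    and M''_def: "M'' = compress (lower (fst A) (snd M))"
  shows "last_upper (fst A) M' \<and> last_upper (fst M') M \<longleftrightarrow> last_upper (fst A) M"
    "last_lower (fst A) M' \<and> last_upper (fst M') M \<longleftrightarrow> last_upper (fst B) M'' \<and> last_lower (fst A) M"
    "last_lower (fst M') M \<longleftrightarrow> last_lower (fst B) M'' \<and> last_lower (fst A) M"
proof -
  let ?a = "fst A" and ?c = "fst A + fst B" and ?S = "snd M" and ?m = "fst M - 1"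
  let ?T = "upper ?c ?S" and ?T' = "lower ?a ?S"
  have M1: "M' \<in> asm_mats" "fst M' = ?c" using shc_asm[OF A B M'] fst_shc[OF M'] by auto
  have MA: "M \<in> asm_mats" using shc_asm[OF M1(1) C M] .
  have n: "?c \<le> fst M" using fst_shc[OF M] M1 by simp
  note mid = shc_middle_left[OF A B C M' M]
  have "M'' \<in> asm_mats" using mid(2) shc_asm[OF B C] by (simp add: M''_def)
  then have "cut ?a ?S A M''" using mid(3) by (simp add: shc_iff A M''_def)
  moreover have "cut ?c ?S M' C" using M M1 by (simp add: shc_iff C)
  ultimately have sh: "asm_shape ?T" "asm_shape ?T'"
    using asm_matsD[OF MA] by (auto simp: cut_def asm_shape_upper asm_shape_lower)
  have rT: "fst ` ?T = {..<?c}" "fst ` ?T' = {?a..<fst M}"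
    using asm_matsD[OF MA] n by (auto simp: rows_upper rows_lower)
  have rnk: "rnk (fst ` ?T) ?a = ?a" "rnk (fst ` ?T') ?c = fst B"
    using n by (simp_all add: rT rnk_lessThan rnk_atLeastLessThan)
  have T: "last_upper ?a M' \<longleftrightarrow> ?m \<in> snd ` upper ?a ?S" "last_lower ?a M' \<longleftrightarrow> ?m \<in> snd ` lower ?a ?T"
    if "last_upper ?c M"
    using last_col_compress[OF MA upper_subset sh(1), of ?a] that rnk mid(1)
    by (auto simp: last_upper_def upper_upper)
  have T': "last_upper (fst B) M'' \<longleftrightarrow> ?m \<in> snd ` lower ?a ?T" "last_lower (fst B) M'' \<longleftrightarrow> ?m \<in> snd ` lower ?c ?S"
    if "last_lower ?a M"
    using last_col_compress[OF MA lower_subset sh(2), of ?c] that rnk M''_def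
    by (auto simp: last_lower_def lower_lower lower_upper)
  have i1: "last_upper ?c M" if "?m \<in> snd ` upper ?a ?S"
    using that by (auto simp: last_upper_def upper_def)
  have i2: "last_upper ?c M" "last_lower ?a M" if "?m \<in> snd ` lower ?a ?T"
    using that by (auto simp: last_upper_def last_lower_def upper_def lower_def)
  have i3: "last_lower ?a M" if "?m \<in> snd ` lower ?c ?S"
    using that by (auto simp: last_lower_def lower_def)
  show "last_upper ?a M' \<and> last_upper (fst M') M \<longleftrightarrow> last_upper ?a M"
    using T(1) i1 unfolding M1(2) by (auto simp: last_upper_def)
  show "last_lower ?a M' \<and> last_upper (fst M') M \<longleftrightarrow> last_upper (fst B) M'' \<and> last_lower ?a M"
    using T(2) T'(1) i2 unfolding M1(2) by blast
  show "last_lower (fst M') M \<longleftrightarrow> last_lower (fst B) M'' \<and> last_lower ?a M"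
    using T'(2) i3 unfolding M1(2) by (auto simp: last_lower_def)
qed

text \<open>The compressions of the four blocks cut out by row \<open>a\<close> and column \<open>k\<close>, in the order
  top left, top right, bottom left, bottom right.\<close>

definition quad :: "nat \<Rightarrow> nat \<Rightarrow> mat \<Rightarrow> mat \<times> mat \<times> mat \<times> mat" where
  "quad a k M =
    (mat_transp (compress (upper k ((upper a (snd M))\<inverse>))), mat_transp (compress (lower k ((upper a (snd M))\<inverse>))),
     mat_transp (compress (upper k ((lower a (snd M))\<inverse>))), mat_transp (compress (lower k ((lower a (snd M))\<inverse>))))"

text \<open>The row cut separates columns and the column cut separates rows, so each of the four
  blocks is cut cleanly out of both halves containing it; this gives the first four claims. The
  fifth recovers the columns of the upper half, for injectivity. The others follow the labels: if
  \<open>R\<close> is nonempty, the last column of \<open>M\<close> is in the right half, and if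
  \<open>B\<close> is nonempty, the last row is in the lower half.\<close>

lemma quad_facts:
  assumes A: "A \<in> asm_mats" and B: "B \<in> asm_mats" and L: "L \<in> asm_mats" and R: "R \<in> asm_mats"
    and M: "M \<in> shc A B" and LR: "(L, R) \<in> splits M"
    and q: "quad (fst A) (fst L) M = (A1, A2, B1, B2)"
  shows "(A1, A2) \<in> splits A" "(B1, B2) \<in> splits B" "L \<in> shc A1 B1" "R \<in> shc A2 B2"
    "snd ` upper (fst A) (snd M) = snd ` upper (fst A1) (snd L) \<union> (+) (fst L) ` snd ` upper (fst A2) (snd R)"
    "0 < fst R \<Longrightarrow> last_upper (fst A2) R \<longleftrightarrow> last_upper (fst A) M"
    "0 < fst R \<Longrightarrow> last_lower (fst A2) R \<longleftrightarrow> last_lower (fst A) M"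
    "0 < fst B \<Longrightarrow> last_upper (fst B1) (mat_transp B) \<longleftrightarrow> last_upper (fst L) (mat_transp M)"
    "0 < fst B \<Longrightarrow> last_lower (fst B1) (mat_transp B) \<longleftrightarrow> last_lower (fst L) (mat_transp M)"
proof -
  let ?a = "fst A" and ?k = "fst L" and ?n = "fst M" and ?S = "snd M"
  let ?U = "upper ?a ?S" and ?D = "lower ?a ?S"
  \<comment> \<open>\<open>V\<close> and \<open>W\<close> are the left and right halves of
    \<open>M\<close>, not yet compressed.\<close>
  define V where "V = (upper ?k (?S\<inverse>))\<inverse>"
  define W where "W = (lower ?k (?S\<inverse>))\<inverse>"
  have MA: "M \<in> asm_mats" and c: "colsep ?a ?S" "A = compress ?U" "B = compress ?D"
    using M by (auto simp: shc_iff A B cut_def)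
  have c': "colsep ?k (?S\<inverse>)" "mat_transp L = compress (upper ?k (?S\<inverse>))" "mat_transp R = compress (lower ?k (?S\<inverse>))"
    using LR by (auto simp: splits_iff MA cut_def)
  have n: "?n = ?a + fst B" using fst_shc[OF M] .
  have "mat_transp M \<in> shc (mat_transp L) (mat_transp R)" using LR by (simp add: splits_iff_shc MA)
  then have n': "?n = ?k + fst R" using fst_shc by fastforce
  have S: "asm_shape ?S" "asm_shape (?S\<inverse>)" "fst ` ?S = {..<?n}" "snd ` ?S = {..<?n}"
    using asm_matsD[OF MA] by (auto simp: asm_shape_converse)
  have sh: "asm_shape ?U" "asm_shape ?D" "asm_shape V" "asm_shape W"
    using S c c' by (simp_all add: V_def W_def asm_shape_converse asm_shape_upper asm_shape_lower)
  have sh': "asm_shape (upper ?k (?S\<inverse>))" "asm_shape (lower ?k (?S\<inverse>))"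
    using S c' by (simp_all add: asm_shape_upper asm_shape_lower)
  have LV: "L = compress V" and RW: "R = compress W"
    unfolding V_def W_def compress_converse[OF sh'(1)] compress_converse[OF sh'(2)] c'(2,3)[symmetric]
    by simp_all
  have sub: "V \<subseteq> ?S" "W \<subseteq> ?S" by (auto simp: V_def W_def upper_def lower_def)
  \<comment> \<open>The four blocks do not depend on which of the two cuts is made first; this is
    how \<open>quad\<close>, which cuts rows first, also describes the factors of \<open>L\<close>
    and \<open>R\<close>.\<close>
  have eqs: "(upper ?k (?U\<inverse>))\<inverse> = upper ?a V" "(lower ?k (?U\<inverse>))\<inverse> = upper ?a W"
    "(upper ?k (?D\<inverse>))\<inverse> = lower ?a V" "(lower ?k (?D\<inverse>))\<inverse> = lower ?a W"
    by (auto simp: V_def W_def upper_def lower_def)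
  have sepVW: "colsep ?a V" "colsep ?a W" using c(1) sub colsep_subset by blast+
  have sepUD: "colsep ?k (?U\<inverse>)" "colsep ?k (?D\<inverse>)"
    using c'(1) by (auto intro: colsep_subset[of _ "?S\<inverse>"] simp: upper_def lower_def)
  have shq: "asm_shape (upper ?k (?U\<inverse>))" "asm_shape (lower ?k (?U\<inverse>))"
    "asm_shape (upper ?k (?D\<inverse>))" "asm_shape (lower ?k (?D\<inverse>))"
    using sepUD sh by (simp_all add: asm_shape_upper asm_shape_lower asm_shape_converse)
  have q': "mat_transp A1 = compress (upper ?k (?U\<inverse>))" "mat_transp A2 = compress (lower ?k (?U\<inverse>))"
    "mat_transp B1 = compress (upper ?k (?D\<inverse>))" "mat_transp B2 = compress (lower ?k (?D\<inverse>))"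
    using q by (auto simp: quad_def)
  have q'': "A1 = compress (upper ?a V)" "A2 = compress (upper ?a W)"
    "B1 = compress (lower ?a V)" "B2 = compress (lower ?a W)"
    unfolding eqs[symmetric] compress_converse[OF shq(1)] compress_converse[OF shq(2)]
      compress_converse[OF shq(3)] compress_converse[OF shq(4)] q'[symmetric] by simp_all
  have qa: "A1 \<in> asm_mats" "A2 \<in> asm_mats" "B1 \<in> asm_mats" "B2 \<in> asm_mats"
    using sepVW sh by (simp_all add: q'' compress_in_asm_mats asm_shape_upper asm_shape_lower)
  have finite: "finite ?U" "finite ?D" "finite V" "finite W"
    using sh asm_shape_finite by auto
  have "fst A1 = rnk (fst ` (?U\<inverse>)) ?k" "fst B1 = rnk (fst ` (?D\<inverse>)) ?k"
    using fst_compress_upper[of ?k "?U\<inverse>"] fst_compress_upper[of ?k "?D\<inverse>"] by (simp_all flip: q')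
  note rq = this
  have cA: "cut ?k (?U\<inverse>) (mat_transp A1) (mat_transp A2)" and cB: "cut ?k (?D\<inverse>) (mat_transp B1) (mat_transp B2)"
    using sepUD by (simp_all add: cut_def q')
  have AT: "mat_transp A = compress (?U\<inverse>)" "mat_transp B = compress (?D\<inverse>)"
    using sh c by (simp_all add: compress_converse)
  show "(A1, A2) \<in> splits A" "(B1, B2) \<in> splits B"
    using cA cB cut_compress[of "?U\<inverse>"] cut_compress[of "?D\<inverse>"] finite rq
    by (auto simp: splits_iff A B qa snd_mat_transp[symmetric] AT)
  have rq2: "fst A1 = rnk (fst ` V) ?a" "fst A2 = rnk (fst ` W) ?a"
    using fst_compress_upper by (simp_all add: q'')
  have cV: "cut ?a V A1 B1" "cut ?a W A2 B2" using sepVW q'' by (simp_all add: cut_def)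
  show "L \<in> shc A1 B1" "R \<in> shc A2 B2"
    using cV compress_shc_iff[OF sh(3) qa(1,3) rq2(1)] compress_shc_iff[OF sh(4) qa(2,4) rq2(2)]
    unfolding LV[symmetric] RW[symmetric] by blast+
  have colV: "snd ` V = {..<?k}" and colW: "snd ` W = {?k..<?n}"
    using n' S by (auto simp: V_def W_def cols_converse rows_upper rows_lower rows_converse)
  \<comment> \<open>The columns of \<open>V\<close> are an initial interval, where ranking is the
    identity; those of \<open>W\<close> start at \<open>fst L\<close>, which ranking subtracts. This
    accounts for the shift in the fifth claim.\<close>
  have "snd ` upper (fst A1) (snd L) = rnk {..<?k} ` snd ` upper ?a V"
    unfolding rq2(1) colV[symmetric] by (subst LV) (simp add: upper_compress finite snd_map_prod_image)
  also have "\<dots> = snd ` upper ?a V"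
  proof -
    have "snd ` upper ?a V \<subseteq> {..<?k}" using upper_subset colV by blast
    then have "rnk {..<?k} ` snd ` upper ?a V = id ` snd ` upper ?a V"
      by (intro image_cong refl) (auto simp: rnk_lessThan)
    then show ?thesis by simp
  qed
  finally have e1: "snd ` upper (fst A1) (snd L) = snd ` upper ?a V" .
  have "(+) ?k ` snd ` upper (fst A2) (snd R) = (+) ?k ` rnk {?k..<?n} ` snd ` upper ?a W"
    unfolding rq2(2) colW[symmetric] by (subst RW) (simp add: upper_compress finite snd_map_prod_image)
  also have "\<dots> = snd ` upper ?a W"
  proof -
    have "snd ` upper ?a W \<subseteq> {?k..<?n}" using upper_subset colW by blast
    then have "((+) ?k \<circ> rnk {?k..<?n}) ` snd ` upper ?a W = id ` snd ` upper ?a W"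
      by (intro image_cong refl) (auto simp: rnk_atLeastLessThan)
    then show ?thesis unfolding image_comp[symmetric] by simp
  qed
  finally have e2: "(+) ?k ` snd ` upper (fst A2) (snd R) = snd ` upper ?a W" .
  have "upper ?a ?S = upper ?a V \<union> upper ?a W" by (auto simp: V_def W_def upper_def lower_def)
  then show "snd ` upper ?a ?S = snd ` upper (fst A1) (snd L) \<union> (+) ?k ` snd ` upper (fst A2) (snd R)"
    by (simp add: e1 e2 image_Un)
  {
    assume "0 < fst R"
    then have m: "?n - 1 \<in> {?k..<?n}" using n' by auto
    have "?n - 1 \<in> snd ` upper ?a W \<longleftrightarrow> ?n - 1 \<in> snd ` ?U"
      "?n - 1 \<in> snd ` lower ?a W \<longleftrightarrow> ?n - 1 \<in> snd ` ?D"
      using m by (force simp: W_def upper_def lower_def)+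
    then show "last_upper (fst A2) R \<longleftrightarrow> last_upper ?a M" "last_lower (fst A2) R \<longleftrightarrow> last_lower ?a M"
      using last_col_compress[OF MA sub(2) sh(4), of ?a] m colW
      by (simp_all add: rq2 RW last_upper_def last_lower_def)
  }
  {
    assume "0 < fst B"
    then have m: "?n - 1 \<in> {?a..<?n}" using n by auto
    have "?n - 1 \<in> snd ` upper ?k (?D\<inverse>) \<longleftrightarrow> ?n - 1 \<in> snd ` upper ?k (?S\<inverse>)"
      "?n - 1 \<in> snd ` lower ?k (?D\<inverse>) \<longleftrightarrow> ?n - 1 \<in> snd ` lower ?k (?S\<inverse>)"
      using m by (force simp: upper_def lower_def)+
    moreover have "snd ` (?D\<inverse>) = {?a..<?n}" using S by (auto simp: cols_converse rows_lower)
    moreover have "?D\<inverse> \<subseteq> snd (mat_transp M)" by (auto simp: snd_mat_transp lower_def)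
    ultimately show "last_upper (fst B1) (mat_transp B) \<longleftrightarrow> last_upper ?k (mat_transp M)"
      "last_lower (fst B1) (mat_transp B) \<longleftrightarrow> last_lower ?k (mat_transp M)"
      using last_col_compress[of "mat_transp M" "?D\<inverse>" ?k] m sh MA
      by (simp_all add: rq AT last_upper_def last_lower_def asm_shape_converse snd_mat_transp)
  }
qed

section \<open>Reassembling a matrix from four blocks\<close>

text \<open>The columns of \<open>B\<close> are the complement of those of \<open>A\<close>, and a
  block is known once its rows, its columns and its compression are.\<close>

lemma shc_cols_unique:
  assumes A: "A \<in> asm_mats" and B: "B \<in> asm_mats" and M: "M \<in> shc A B" and N: "N \<in> shc A B"
    and eq: "snd ` upper (fst A) (snd M) = snd ` upper (fst A) (snd N)"
  shows "M = N"
proof -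
  let ?a = "fst A"
  have n: "fst M = ?a + fst B" "fst N = ?a + fst B" using fst_shc M N by auto
  have MA: "M \<in> asm_mats" "cut ?a (snd M) A B" and NA: "N \<in> asm_mats" "cut ?a (snd N) A B"
    using M N by (auto simp: shc_iff A B)
  have fin: "finite (upper ?a (snd M))" "finite (lower ?a (snd M))"
    using asm_matsD[OF MA(1)] upper_subset lower_subset finite_subset by metis+
  have lo: "snd ` lower ?a (snd K) = {..<?a + fst B} - snd ` upper ?a (snd K)"
    if "K \<in> asm_mats" "cut ?a (snd K) A B" "fst K = ?a + fst B" for K
  proof -
    have "snd ` upper ?a (snd K) \<union> snd ` lower ?a (snd K) = {..<?a + fst B}"
      using asm_matsD(4)[OF that(1)] that(3) by (simp add: image_Un[symmetric] upper_Un_lower)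
    moreover have "snd ` upper ?a (snd K) \<inter> snd ` lower ?a (snd K) = {}"
      using that(2) colsep_disjoint by (auto simp: cut_def)
    ultimately show ?thesis by blast
  qed
  have "upper ?a (snd M) = upper ?a (snd N)"
    by (rule compress_inj[OF fin(1)])
      (use MA NA n eq asm_matsD(3)[OF MA(1)] asm_matsD(3)[OF NA(1)] in \<open>simp_all add: rows_upper cut_def\<close>)
  moreover have "lower ?a (snd M) = lower ?a (snd N)"
    by (rule compress_inj[OF fin(2)])
      (use MA NA n eq lo[OF MA n(1)] lo[OF NA n(2)] asm_matsD(3)[OF MA(1)] asm_matsD(3)[OF NA(1)]
        in \<open>simp_all add: rows_lower cut_def\<close>)
  ultimately have "snd M = snd N" by (metis upper_Un_lower)
  then show ?thesis using n by (simp add: prod_eq_iff)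
qed

text \<open>Two relabellings side by side: \<open>u\<close> is used for the first \<open>p\<close>
  positions, with values below \<open>m\<close> in the applications, and \<open>v\<close> for the
  rest, shifted by \<open>m\<close>. It makes the row or column map of a whole matrix from those of
  its two halves.\<close>

definition glue :: "nat \<Rightarrow> nat \<Rightarrow> (nat \<Rightarrow> nat) \<Rightarrow> (nat \<Rightarrow> nat) \<Rightarrow> nat \<Rightarrow> nat" where
  "glue p m u v j = (if j < p then u j else m + v (j - p))"

lemma strict_mono_on_glue:
  assumes "strict_mono_on {..<p} u" "strict_mono_on {..<q} v" "u ` {..<p} \<subseteq> {..<m}"
  shows "strict_mono_on {..<p + q} (glue p m u v)"
proof (rule strict_mono_onI)
  fix r s assume "r \<in> {..<p + q}" "s \<in> {..<p + q}" "r < s"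
  moreover have "u r < m" if "r < p" using that assms(3) by auto
  ultimately show "glue p m u v r < glue p m u v s"
    using strict_mono_onD[OF assms(1), of r s] strict_mono_onD[OF assms(2), of "r - p" "s - p"]
    by (auto simp: glue_def trans_less_add1 not_less)
qed

lemma lessThan_add: "{..<m + n} = {..<m} \<union> (+) m ` {..<n :: nat}"
proof -
  have "(+) m ` {..<n} = {m..<m + n}" by (simp add: lessThan_atLeast0 add.commute)
  then show ?thesis by auto
qed

lemma glue_image: "glue p m u v ` {..<p + q} = u ` {..<p} \<union> (+) m ` v ` {..<q}"
proof -
  have "glue p m u v ` {..<p + q} = glue p m u v ` {..<p} \<union> glue p m u v ` (+) p ` {..<q}"
    by (simp only: lessThan_add image_Un)
  also have "glue p m u v ` {..<p} = u ` {..<p}" by (auto simp: glue_def)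
  also have "glue p m u v ` (+) p ` {..<q} = (+) m ` v ` {..<q}"
    unfolding image_image by (rule image_cong) (auto simp: glue_def)
  finally show ?thesis .
qed

lemma glue_partition:
  assumes "u ` {..<p} \<union> v ` {..<q} = {..<m}" "u ` {..<p} \<inter> v ` {..<q} = {}"
    "u' ` {..<p'} \<union> v' ` {..<q'} = {..<m'}" "u' ` {..<p'} \<inter> v' ` {..<q'} = {}"
  shows "glue p m u u' ` {..<p + p'} \<union> glue q m v v' ` {..<q + q'} = {..<m + m'}"
    "glue p m u u' ` {..<p + p'} \<inter> glue q m v v' ` {..<q + q'} = {}"
proof -
  have "glue p m u u' ` {..<p + p'} \<union> glue q m v v' ` {..<q + q'}
      = (u ` {..<p} \<union> v ` {..<q}) \<union> (+) m ` (u' ` {..<p'} \<union> v' ` {..<q'})"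
    unfolding glue_image by blast
  also have "\<dots> = {..<m} \<union> (+) m ` {..<m'}" by (simp only: assms)
  also have "\<dots> = {..<m + m'}"
    by (rule lessThan_add[symmetric])
  finally show "glue p m u u' ` {..<p + p'} \<union> glue q m v v' ` {..<q + q'} = {..<m + m'}" .
  have shift: "(+) m ` X \<inter> (+) m ` Y = {}" if "X \<inter> Y = {}" for X Y using that by auto
  have dis: "{..<m} \<inter> (+) m ` X = {}" for X by auto
  have *: "(P \<union> X) \<inter> (Q \<union> Y) = {}"
    if "P \<subseteq> C" "Q \<subseteq> C" "P \<inter> Q = {}" "X \<inter> Y = {}" "C \<inter> X = {}" "C \<inter> Y = {}" for P Q X Y C :: "nat set"
    using that by blast
  show "glue p m u u' ` {..<p + p'} \<inter> glue q m v v' ` {..<q + q'} = {}"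
    unfolding glue_image
    by (rule *[OF _ _ assms(2) shift[OF assms(4)] dis dis]) (use assms(1) in blast)+
qed

lemma shcI:
  assumes "strict_mono_on {..<fst A} f" "strict_mono_on {..<fst B} g"
    "f ` {..<fst A} \<union> g ` {..<fst B} = {..<fst A + fst B}" "f ` {..<fst A} \<inter> g ` {..<fst B} = {}"
    "fst M = fst A + fst B" "snd M = map_prod id f ` snd A \<union> map_prod ((+) (fst A)) g ` snd B"
  shows "M \<in> shc A B"
proof -
  have "M = (fst A + fst B, (\<lambda>(i, j). (i, f j)) ` snd A \<union> (\<lambda>(i, j). (fst A + i, g j)) ` snd B)"
    using assms(5,6) by (cases M) (simp add: map_prod_def)
  then show ?thesis using assms(1-4) unfolding shc_def by blast
qed

lemma shcE:
  assumes "M \<in> shc A B"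
  obtains f g where "strict_mono_on {..<fst A} f" "strict_mono_on {..<fst B} g"
    "f ` {..<fst A} \<union> g ` {..<fst B} = {..<fst A + fst B}" "f ` {..<fst A} \<inter> g ` {..<fst B} = {}"
    "fst M = fst A + fst B" "snd M = map_prod id f ` snd A \<union> map_prod ((+) (fst A)) g ` snd B"
  using assms unfolding shc_def by (auto simp: map_prod_def)

lemma mat_transp_shcE:
  assumes "mat_transp M \<in> shc (mat_transp A) (mat_transp B)"
  obtains y z where "strict_mono_on {..<fst A} y" "strict_mono_on {..<fst B} z"
    "y ` {..<fst A} \<union> z ` {..<fst B} = {..<fst A + fst B}" "y ` {..<fst A} \<inter> z ` {..<fst B} = {}"
    "fst M = fst A + fst B" "snd M = map_prod y id ` snd A \<union> map_prod z ((+) (fst A)) ` snd B"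
proof -
  obtain y z where yz: "strict_mono_on {..<fst A} y" "strict_mono_on {..<fst B} z"
    "y ` {..<fst A} \<union> z ` {..<fst B} = {..<fst A + fst B}" "y ` {..<fst A} \<inter> z ` {..<fst B} = {}"
    "fst M = fst A + fst B"
    "snd (mat_transp M) = map_prod id y ` snd (mat_transp A) \<union> map_prod ((+) (fst A)) z ` snd (mat_transp B)"
    using shcE[OF assms, unfolded fst_mat_transp] by blast
  have "snd M = (snd (mat_transp M))\<inverse>" by (simp add: snd_mat_transp)
  also have "\<dots> = map_prod y id ` snd A \<union> map_prod z ((+) (fst A)) ` snd B"
    unfolding yz(6) by (simp add: converse_Un converse_map_prod snd_mat_transp)
  finally show thesis using that[OF yz(1-5)] by blast
qed

lemma asm_mats_bounds: "M \<in> asm_mats \<Longrightarrow> (i, j) \<in> snd M \<Longrightarrow> i < fst M \<and> j < fst M"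
  using asm_mats_lt by blast

lemma map_prod_image_cong:
  assumes "A \<in> asm_mats" "\<And>i. i < fst A \<Longrightarrow> \<phi> i = \<phi>' i" "\<And>i. i < fst A \<Longrightarrow> \<psi> i = \<psi>' i"
  shows "map_prod \<phi> \<psi> ` snd A = map_prod \<phi>' \<psi>' ` snd A"
proof (rule image_cong)
  fix p assume "p \<in> snd A"
  then show "map_prod \<phi> \<psi> p = map_prod \<phi>' \<psi>' p"
    using assms(2,3) asm_mats_lt[OF assms(1), of "fst p" "snd p"] by (cases p) auto
qed simp

lemma map_prod_comp_image: "map_prod f g ` map_prod f' g' ` T = map_prod (f \<circ> f') (g \<circ> g') ` T"
  by (simp add: image_comp map_prod_compose)

lemma compress_map_prod_asm:
  assumes "A \<in> asm_mats" "strict_mono_on {..<fst A} \<phi>" "strict_mono_on {..<fst A} \<psi>"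
  shows "compress (map_prod \<phi> \<psi> ` snd A) = A"
  using assms by (simp add: compress_map_prod asm_matsD compress_asm_mats)

text \<open>Each block knows its position in both directions: the splittings of \<open>A\<close> and
  \<open>B\<close> provide the row maps, the shuffles \<open>L\<close> and \<open>R\<close> the
  column maps. Gluing the column maps shows that the result is a shuffle of \<open>A\<close> and
  \<open>B\<close>, gluing the row maps that it splits into \<open>L\<close> and
  \<open>R\<close>.\<close>

lemma quad_exists:
  assumes A: "A \<in> asm_mats" and B: "B \<in> asm_mats"
    and A12: "(A1, A2) \<in> splits A" and B12: "(B1, B2) \<in> splits B"
    and L: "L \<in> shc A1 B1" and R: "R \<in> shc A2 B2"
  obtains M where "M \<in> shc A B" "(L, R) \<in> splits M" "quad (fst A) (fst L) M = (A1, A2, B1, B2)"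
proof -
  let ?a = "fst A" and ?k = "fst L" and ?a1 = "fst A1" and ?a2 = "fst A2" and ?b1 = "fst B1" and ?b2 = "fst B2"
  have q: "A1 \<in> asm_mats" "A2 \<in> asm_mats" "B1 \<in> asm_mats" "B2 \<in> asm_mats"
    and tA: "mat_transp A \<in> shc (mat_transp A1) (mat_transp A2)" and tB: "mat_transp B \<in> shc (mat_transp B1) (mat_transp B2)"
    using A12 B12 by (auto simp: splits_iff_shc A B)
  have LA: "L \<in> asm_mats" and RA: "R \<in> asm_mats" using shc_asm[OF q(1,3) L] shc_asm[OF q(2,4) R] by auto
  obtain y z where yz: "strict_mono_on {..<?a1} y" "strict_mono_on {..<?a2} z"
    "y ` {..<?a1} \<union> z ` {..<?a2} = {..<?a1 + ?a2}" "y ` {..<?a1} \<inter> z ` {..<?a2} = {}"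
    "?a = ?a1 + ?a2" "snd A = map_prod y id ` snd A1 \<union> map_prod z ((+) ?a1) ` snd A2"
    using tA by (rule mat_transp_shcE)
  obtain y' z' where yz': "strict_mono_on {..<?b1} y'" "strict_mono_on {..<?b2} z'"
    "y' ` {..<?b1} \<union> z' ` {..<?b2} = {..<?b1 + ?b2}" "y' ` {..<?b1} \<inter> z' ` {..<?b2} = {}"
    "fst B = ?b1 + ?b2" "snd B = map_prod y' id ` snd B1 \<union> map_prod z' ((+) ?b1) ` snd B2"
    using tB by (rule mat_transp_shcE)
  obtain f g where fg: "strict_mono_on {..<?a1} f" "strict_mono_on {..<?b1} g"
    "f ` {..<?a1} \<union> g ` {..<?b1} = {..<?a1 + ?b1}" "f ` {..<?a1} \<inter> g ` {..<?b1} = {}"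
    "?k = ?a1 + ?b1" "snd L = map_prod id f ` snd A1 \<union> map_prod ((+) ?a1) g ` snd B1"
    using L by (rule shcE)
  obtain f' g' where fg': "strict_mono_on {..<?a2} f'" "strict_mono_on {..<?b2} g'"
    "f' ` {..<?a2} \<union> g' ` {..<?b2} = {..<?a2 + ?b2}" "f' ` {..<?a2} \<inter> g' ` {..<?b2} = {}"
    "fst R = ?a2 + ?b2" "snd R = map_prod id f' ` snd A2 \<union> map_prod ((+) ?a2) g' ` snd B2"
    using R by (rule shcE)
  have ran: "y ` {..<?a1} \<subseteq> {..<?a}" "z ` {..<?a2} \<subseteq> {..<?a}" "f ` {..<?a1} \<subseteq> {..<?k}" "g ` {..<?b1} \<subseteq> {..<?k}"
    using yz(3,5) fg(3,5) by auto
  \<comment> \<open>Top left, top right, bottom left and bottom right block. Rows of the lower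
    blocks are shifted by the size of \<open>A\<close>, columns of the right blocks by the size of
    \<open>L\<close>.\<close>
  define S1 where "S1 = map_prod y f ` snd A1"
  define S2 where "S2 = map_prod z (\<lambda>j. ?k + f' j) ` snd A2"
  define S3 where "S3 = map_prod (\<lambda>i. ?a + y' i) g ` snd B1"
  define S4 where "S4 = map_prod (\<lambda>i. ?a + z' i) (\<lambda>j. ?k + g' j) ` snd B2"
  define M where "M = (?a + fst B, S1 \<union> S2 \<union> S3 \<union> S4)"
  have "M \<in> shc A B"
  proof (rule shcI)
    let ?f = "glue ?a1 ?k f f'" and ?g = "glue ?b1 ?k g g'"
    show "strict_mono_on {..<?a} ?f" "strict_mono_on {..<fst B} ?g"
      unfolding yz(5) yz'(5) using fg fg' ran by (auto intro!: strict_mono_on_glue)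
    have "?a + fst B = ?k + fst R" using yz(5) yz'(5) fg(5) fg'(5) by simp
    then show "?f ` {..<?a} \<union> ?g ` {..<fst B} = {..<?a + fst B}" "?f ` {..<?a} \<inter> ?g ` {..<fst B} = {}"
      unfolding yz(5) yz'(5)
      using glue_partition[of f ?a1 g ?b1 ?k f' ?a2 g' ?b2 "fst R"] fg fg' by simp_all
    have "map_prod id ?f ` snd A = S1 \<union> S2"
      unfolding yz(6) image_Un map_prod_comp_image S1_def S2_def
      by (intro arg_cong2[where f = "(\<union>)"] map_prod_image_cong q) (auto simp: glue_def)
    moreover have "map_prod ((+) ?a) ?g ` snd B = S3 \<union> S4"
      unfolding yz'(6) image_Un map_prod_comp_image S3_def S4_def
      by (intro arg_cong2[where f = "(\<union>)"] map_prod_image_cong q) (auto simp: glue_def)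
    ultimately show "snd M = map_prod id ?f ` snd A \<union> map_prod ((+) ?a) ?g ` snd B"
      by (simp add: M_def Un_assoc)
  qed (simp add: M_def)
  moreover have "mat_transp M \<in> shc (mat_transp L) (mat_transp R)"
  proof (rule shcI)
    let ?f = "glue ?a1 ?a y y'" and ?g = "glue ?a2 ?a z z'"
    show "strict_mono_on {..<fst (mat_transp L)} ?f" "strict_mono_on {..<fst (mat_transp R)} ?g"
      using yz yz' fg(5) fg'(5) ran by (auto intro!: strict_mono_on_glue)
    have n: "?a + fst B = ?k + fst R" using yz(5) yz'(5) fg(5) fg'(5) by simp
    then show "?f ` {..<fst (mat_transp L)} \<union> ?g ` {..<fst (mat_transp R)} = {..<fst (mat_transp L) + fst (mat_transp R)}"
      "?f ` {..<fst (mat_transp L)} \<inter> ?g ` {..<fst (mat_transp R)} = {}"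
      using glue_partition[of y ?a1 z ?a2 ?a y' ?b1 z' ?b2 "fst B"] yz yz' fg(5) fg'(5) by simp_all
    have "map_prod id ?f ` snd (mat_transp L) = S1\<inverse> \<union> S3\<inverse>"
      unfolding fg(6) snd_mat_transp converse_Un converse_map_prod image_Un map_prod_comp_image S1_def S3_def
      unfolding snd_mat_transp[symmetric]
      by (intro arg_cong2[where f = "(\<union>)"] map_prod_image_cong) (auto simp: glue_def q)
    moreover have "map_prod ((+) (fst (mat_transp L))) ?g ` snd (mat_transp R) = S2\<inverse> \<union> S4\<inverse>"
      unfolding fg'(6) snd_mat_transp converse_Un converse_map_prod image_Un map_prod_comp_image S2_def S4_def
      unfolding snd_mat_transp[symmetric]
      by (intro arg_cong2[where f = "(\<union>)"] map_prod_image_cong) (auto simp: glue_def q)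
    ultimately show "snd (mat_transp M) = map_prod id ?f ` snd (mat_transp L) \<union> map_prod ((+) (fst (mat_transp L))) ?g ` snd (mat_transp R)"
      by (auto simp: M_def snd_mat_transp)
    show "fst (mat_transp M) = fst (mat_transp L) + fst (mat_transp R)" using n by (simp add: M_def)
  qed
  moreover have "M \<in> asm_mats" using calculation(1) shc_asm A B by blast
  ultimately have sp: "M \<in> shc A B" "(L, R) \<in> splits M" by (simp_all add: splits_iff_shc LA RA)
  have s1: "fst p < ?a \<and> snd p < ?k" if "p \<in> S1" for p
    using that ran(1,3) by (auto simp: S1_def dest!: asm_mats_bounds[OF q(1)])
  have s2: "fst p < ?a \<and> ?k \<le> snd p" if "p \<in> S2" for p
    using that ran(2) by (auto simp: S2_def dest!: asm_mats_bounds[OF q(2)])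
  have s3: "?a \<le> fst p \<and> snd p < ?k" if "p \<in> S3" for p
    using that ran(4) by (auto simp: S3_def dest!: asm_mats_bounds[OF q(3)])
  have s4: "?a \<le> fst p \<and> ?k \<le> snd p" if "p \<in> S4" for p
    using that by (auto simp: S4_def)
  have "upper ?a (snd M) = S1 \<union> S2" "lower ?a (snd M) = S3 \<union> S4"
    using s1 s2 s3 s4 by (fastforce simp: M_def upper_def lower_def)+
  moreover have "upper ?k ((S1 \<union> S2)\<inverse>) = S1\<inverse>" "lower ?k ((S1 \<union> S2)\<inverse>) = S2\<inverse>"
    "upper ?k ((S3 \<union> S4)\<inverse>) = S3\<inverse>" "lower ?k ((S3 \<union> S4)\<inverse>) = S4\<inverse>"
    using s1 s2 s3 s4 by (fastforce simp: upper_def lower_def)+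
  moreover have "compress (S1\<inverse>) = mat_transp A1" "compress (S2\<inverse>) = mat_transp A2"
    "compress (S3\<inverse>) = mat_transp B1" "compress (S4\<inverse>) = mat_transp B2"
    using q yz yz' fg fg' unfolding S1_def S2_def S3_def S4_def converse_map_prod snd_mat_transp[symmetric]
    by (auto intro!: compress_map_prod_asm simp: strict_mono_on_def)
  ultimately have "quad ?a ?k M = (A1, A2, B1, B2)" by (simp add: quad_def)
  then show thesis using that sp by blast
qed

text \<open>The terms of the coproduct of a product are matched with those of the product of the
  coproducts. Injectivity holds because the four blocks determine the columns given to
  \<open>A\<close>, surjectivity is \<open>quad_exists\<close>.\<close>

lemma bij_betw_quad:
  assumes A: "A \<in> asm_mats" and B: "B \<in> asm_mats" and L: "L \<in> asm_mats" and R: "R \<in> asm_mats"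
  shows "bij_betw (quad (fst A) (fst L)) {M \<in> shc A B. (L, R) \<in> splits M}
    {(A1, A2, B1, B2). (A1, A2) \<in> splits A \<and> (B1, B2) \<in> splits B \<and> L \<in> shc A1 B1 \<and> R \<in> shc A2 B2}"
    (is "bij_betw ?q ?X ?Y")
proof (rule bij_betwI')
  fix M N assume M: "M \<in> ?X" and N: "N \<in> ?X"
  show "?q M = ?q N \<longleftrightarrow> M = N"
  proof
    assume eq: "?q M = ?q N"
    obtain A1 A2 B1 B2 where q: "?q M = (A1, A2, B1, B2)" by (cases "?q M")
    have "snd ` upper (fst A) (snd M) = snd ` upper (fst A) (snd N)"
      using quad_facts(5)[OF A B L R _ _ q] quad_facts(5)[OF A B L R _ _ q[unfolded eq]] M N by auto
    then show "M = N" using shc_cols_unique[OF A B] M N by blast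
  qed simp
next
  fix M assume M: "M \<in> ?X"
  obtain A1 A2 B1 B2 where q: "?q M = (A1, A2, B1, B2)" by (cases "?q M")
  then show "?q M \<in> ?Y" using quad_facts(1-4)[OF A B L R _ _ q] M by auto
next
  fix q assume q: "q \<in> ?Y"
  obtain A1 A2 B1 B2 where q_eq: "q = (A1, A2, B1, B2)" by (cases q)
  have "(A1, A2) \<in> splits A" "(B1, B2) \<in> splits B" "L \<in> shc A1 B1" "R \<in> shc A2 B2"
    using q by (simp_all add: q_eq)
  then obtain M where "M \<in> shc A B" "(L, R) \<in> splits M" "?q M = q"
    unfolding q_eq by (rule quad_exists[OF A B])
  then show "\<exists>M\<in>?X. q = ?q M" by blast
qed

section \<open>Structure coefficients\<close>

lemma e0_asm [simp]: "e0 \<in> asm_mats"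
proof -
  have "asm_shape {}" by (rule asm_shapeI) (auto simp: alt_rows_def)
  then show ?thesis by (simp add: asm_mats_iff e0_def)
qed

lemma asm_mats_size_0_iff: "M \<in> asm_mats \<Longrightarrow> fst M = 0 \<longleftrightarrow> M = e0"
  using asm_matsD(3)[of M] by (auto simp: e0_def prod_eq_iff)

lemma mat_transp_e0 [simp]: "mat_transp e0 = e0"
  by (simp add: mat_transp_def e0_def)

lemma mat_transp_eq_e0_iff [simp]: "mat_transp M = e0 \<longleftrightarrow> M = e0"
  by (metis mat_transp_e0 mat_transp_mat_transp)

lemma fst_e0 [simp]: "fst e0 = 0" and snd_e0 [simp]: "snd e0 = {}"
  by (simp_all add: e0_def)

lemma compress_empty: "compress {} = e0"
  by (simp add: compress_def e0_def)

lemma upper_0: "upper 0 S = {}" and lower_0: "lower 0 S = S"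
  by (auto simp: upper_def lower_def)

lemma upper_size: "M \<in> asm_mats \<Longrightarrow> upper (fst M) (snd M) = snd M"
  and lower_size: "M \<in> asm_mats \<Longrightarrow> lower (fst M) (snd M) = {}"
  using asm_mats_lt[of M] by (auto simp: upper_def lower_def) fastforce

lemma shc_e0_left: "B \<in> asm_mats \<Longrightarrow> M \<in> shc e0 B \<longleftrightarrow> M = B"
  by (auto simp: shc_iff cut_def upper_0 lower_0 compress_empty compress_asm_mats colsep_def)

lemma shc_e0_right:
  assumes "A \<in> asm_mats"
  shows "M \<in> shc A e0 \<longleftrightarrow> M = A"
proof
  assume M: "M \<in> shc A e0"
  then have "fst M = fst A" using fst_shc by fastforce
  moreover have "M \<in> asm_mats" "cut (fst A) (snd M) A e0" using M by (auto simp: shc_iff assms)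
  ultimately show "M = A" using upper_size[of M] by (simp add: cut_def compress_asm_mats)
next
  assume "M = A"
  moreover have "colsep (fst A) (snd A)"
    using asm_mats_lt[OF assms] by (auto simp: colsep_def)
  ultimately show "M \<in> shc A e0"
    using assms by (simp add: shc_iff cut_def upper_size lower_size compress_asm_mats compress_empty)
qed

lemma e0_in_shc_iff:
  assumes "A \<in> asm_mats" "B \<in> asm_mats"
  shows "e0 \<in> shc A B \<longleftrightarrow> A = e0 \<and> B = e0"
proof
  assume "e0 \<in> shc A B"
  then have "fst A = 0" "fst B = 0" using fst_shc by fastforce+
  then show "A = e0 \<and> B = e0" using assms asm_mats_size_0_iff by blast
qed (simp add: shc_e0_left)

text \<open>The half products \<open>\<prec>\<close> and \<open>\<succ>\<close>.\<close>

definition ltc :: "mat \<Rightarrow> mat \<Rightarrow> mat \<Rightarrow> 'k::comm_ring_1" where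
  "ltc A B M = (if M \<in> shc A B \<and> last_upper (fst A) M then 1 else 0)"

definition gtc :: "mat \<Rightarrow> mat \<Rightarrow> mat \<Rightarrow> 'k::comm_ring_1" where
  "gtc A B M = (if M \<in> shc A B \<and> last_lower (fst A) M then 1 else 0)"

text \<open>The coefficients of the coproduct dual to \<open>m\<close> under transposition; \<open>rdualc\<close> is its reduced version.\<close>

definition dualc :: "(mat \<Rightarrow> mat \<Rightarrow> mat \<Rightarrow> 'k::comm_ring_1) \<Rightarrow> mat \<Rightarrow> mat \<Rightarrow> mat \<Rightarrow> 'k" where
  "dualc m M A B = (if A \<in> asm_mats \<and> B \<in> asm_mats then m (mat_transp A) (mat_transp B) (mat_transp M) else 0)"

definition rdualc :: "(mat \<Rightarrow> mat \<Rightarrow> mat \<Rightarrow> 'k::comm_ring_1) \<Rightarrow> mat \<Rightarrow> mat \<Rightarrow> mat \<Rightarrow> 'k" where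
  "rdualc m M A B = (if A = e0 \<or> B = e0 then 0 else dualc m M A B)"

text \<open>\<open>iL\<close> and \<open>iR\<close> are the two unit terms that separate the full
  from the reduced coproduct. Writing them as coefficients lets the summands with a unit in the
  compatibility relations be treated like those with a genuine coproduct.\<close>

definition iL :: "mat \<Rightarrow> mat \<Rightarrow> mat \<Rightarrow> 'k::comm_ring_1" where
  "iL M A B = (if A = e0 \<and> B = M then 1 else 0)"

definition iR :: "mat \<Rightarrow> mat \<Rightarrow> mat \<Rightarrow> 'k::comm_ring_1" where
  "iR M A B = (if A = M \<and> B = e0 then 1 else 0)"

lemma copc_eq_dualc: "M \<in> asm_mats \<Longrightarrow> copc M A B = dualc multc M A B"
  by (auto simp: copc_def dualc_def multc_def splits_iff_shc)

lemma copc_decomp: "copc M A B = rcopc M A B + iR M A B + iL M A B"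
  by (simp add: rcopc_def iR_def iL_def)

lemma last_e0 [simp]: "\<not> last_upper k e0" "\<not> last_lower k e0"
  by (auto simp: last_upper_def last_lower_def upper_def lower_def)

lemma last_upper_0 [simp]: "\<not> last_upper 0 M"
  by (simp add: last_upper_def upper_0)

lemma last_lower_size [simp]: "M \<in> asm_mats \<Longrightarrow> \<not> last_lower (fst M) M"
  by (simp add: last_lower_def lower_size)

lemma last_col:
  assumes "M \<in> asm_mats" "M \<noteq> e0"
  shows "fst M - 1 \<in> snd ` snd M"
  using assms asm_mats_size_0_iff[of M] by (simp add: asm_matsD)

lemma last_upper_size [simp]: "M \<in> asm_mats \<Longrightarrow> last_upper (fst M) M \<longleftrightarrow> M \<noteq> e0"
  using last_col[of M] by (auto simp: last_upper_def upper_size)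

lemma last_lower_0 [simp]: "M \<in> asm_mats \<Longrightarrow> last_lower 0 M \<longleftrightarrow> M \<noteq> e0"
  using last_col[of M] by (auto simp: last_lower_def lower_0)

lemma last_lower_iff:
  assumes "A \<in> asm_mats" "B \<in> asm_mats" "M \<in> shc A B" "M \<noteq> e0"
  shows "last_lower (fst A) M \<longleftrightarrow> \<not> last_upper (fst A) M"
proof -
  have "M \<in> asm_mats" "colsep (fst A) (snd M)"
    using assms by (auto simp: shc_iff cut_def)
  then show ?thesis
    using last_col[of M] assms(4) colsep_disjoint[of "fst A" "snd M"] upper_Un_lower[of "fst A" "snd M"]
    unfolding last_upper_def last_lower_def by (metis IntI UnE empty_iff image_Un)
qed

text \<open>At \<open>e0\<close> the half products vanish, since the empty matrix has no last
  column, while the product of two empty matrices is \<open>e0\<close>.\<close>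

lemma ltc_plus_gtc:
  assumes "A \<in> asm_mats" "B \<in> asm_mats" "M \<noteq> e0"
  shows "ltc A B M + gtc A B M = multc A B M"
  using last_lower_iff[OF assms(1,2) _ assms(3)] by (simp add: ltc_def gtc_def multc_def)

lemma multc_e0:
  "B \<in> asm_mats \<Longrightarrow> multc e0 B M = (if M = B then 1 else 0)"
  "A \<in> asm_mats \<Longrightarrow> multc A e0 M = (if M = A then 1 else 0)"
  "A \<in> asm_mats \<Longrightarrow> B \<in> asm_mats \<Longrightarrow> multc A B e0 = (if A = e0 \<and> B = e0 then 1 else 0)"
  by (simp_all add: multc_def shc_e0_left shc_e0_right e0_in_shc_iff)

lemma ltc_e0:
  "ltc e0 B M = 0"
  "A \<in> asm_mats \<Longrightarrow> ltc A e0 M = (if M = A \<and> A \<noteq> e0 then 1 else 0)"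
  "ltc A B e0 = 0"
  by (auto simp: ltc_def shc_e0_left shc_e0_right)

lemma gtc_e0:
  "B \<in> asm_mats \<Longrightarrow> gtc e0 B M = (if M = B \<and> B \<noteq> e0 then 1 else 0)"
  "A \<in> asm_mats \<Longrightarrow> gtc A e0 M = 0"
  "gtc A B e0 = 0"
  by (auto simp: gtc_def shc_e0_left shc_e0_right)

text \<open>A nonempty \<open>M\<close> has exactly two splittings with an empty side, so
  subtracting them is the same as ignoring all pairs containing \<open>e0\<close>. For
  \<open>M = e0\<close> the two coincide and would be subtracted twice, giving the coefficient
  -1.\<close>

lemma rcopc_eq_rdualc:
  assumes "M \<in> asm_mats" "M \<noteq> e0"
  shows "rcopc M A B = rdualc multc M A B"
proof -
  have "multc (mat_transp A) (mat_transp B) (mat_transp M) = (if A = e0 then iL M A B else iR M A B)"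
    if "A \<in> asm_mats" "B \<in> asm_mats" "A = e0 \<or> B = e0"
    using that by (auto simp: multc_e0 iL_def iR_def)
  then show ?thesis
    using assms by (auto simp: rcopc_def copc_eq_dualc dualc_def rdualc_def iL_def iR_def)
qed

definition graded :: "(mat \<Rightarrow> mat \<Rightarrow> mat \<Rightarrow> 'k::comm_ring_1) \<Rightarrow> bool" where
  "graded m \<longleftrightarrow> (\<forall>A\<in>asm_mats. \<forall>B\<in>asm_mats. \<forall>M. m A B M \<noteq> 0 \<longrightarrow> M \<in> asm_mats \<and> fst M = fst A + fst B)"

definition cograded :: "(mat \<Rightarrow> mat \<Rightarrow> mat \<Rightarrow> 'k::comm_ring_1) \<Rightarrow> bool" where
  "cograded d \<longleftrightarrow> (\<forall>M\<in>asm_mats. \<forall>A B. d M A B \<noteq> 0 \<longrightarrow> A \<in> asm_mats \<and> B \<in> asm_mats \<and> fst A + fst B = fst M)"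

lemma gradedI:
  "(\<And>A B M. A \<in> asm_mats \<Longrightarrow> B \<in> asm_mats \<Longrightarrow> m A B M \<noteq> 0 \<Longrightarrow> M \<in> shc A B) \<Longrightarrow> graded m"
  unfolding graded_def using shc_asm fst_shc by blast

lemma gradedD:
  "graded m \<Longrightarrow> A \<in> asm_mats \<Longrightarrow> B \<in> asm_mats \<Longrightarrow> m A B M \<noteq> 0 \<Longrightarrow> M \<in> asm_mats \<and> fst M = fst A + fst B"
  unfolding graded_def by blast

lemma cogradedD:
  "cograded d \<Longrightarrow> M \<in> asm_mats \<Longrightarrow> d M A B \<noteq> 0 \<Longrightarrow> A \<in> asm_mats \<and> B \<in> asm_mats \<and> fst A + fst B = fst M"
  unfolding cograded_def by blast

lemma graded_coeffs: "graded multc" "graded ltc" "graded gtc"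
  by (rule gradedI, simp add: multc_def ltc_def gtc_def split: if_splits)+

lemma cograded_dualc: "graded m \<Longrightarrow> cograded (dualc m)"
  unfolding cograded_def
proof (intro ballI allI impI)
  fix M A B assume m: "graded m" "M \<in> asm_mats" "dualc m M A B \<noteq> 0"
  then have AB: "A \<in> asm_mats" "B \<in> asm_mats" "m (mat_transp A) (mat_transp B) (mat_transp M) \<noteq> 0"
    by (auto simp: dualc_def split: if_splits)
  then show "A \<in> asm_mats \<and> B \<in> asm_mats \<and> fst A + fst B = fst M"
    using gradedD[OF m(1) _ _ AB(3)] by simp
qed

lemma cograded_rdualc:
  assumes "graded m"
  shows "cograded (rdualc m)"
  unfolding cograded_def
proof (intro ballI allI impI)
  fix M A B assume "M \<in> asm_mats" "rdualc m M A B \<noteq> 0"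
  then show "A \<in> asm_mats \<and> B \<in> asm_mats \<and> fst A + fst B = fst M"
    using cogradedD[OF cograded_dualc[OF assms], of M A B] by (simp add: rdualc_def split: if_splits)
qed

lemma cograded_coeffs:
  "cograded (copc :: _ \<Rightarrow> _ \<Rightarrow> _ \<Rightarrow> 'c::comm_ring_1)" "cograded (iL :: _ \<Rightarrow> _ \<Rightarrow> _ \<Rightarrow> 'c)"
  "cograded (iR :: _ \<Rightarrow> _ \<Rightarrow> _ \<Rightarrow> 'c)" "cograded (rcopc :: _ \<Rightarrow> _ \<Rightarrow> _ \<Rightarrow> 'c)"
proof -
  show *: "cograded (copc :: _ \<Rightarrow> _ \<Rightarrow> _ \<Rightarrow> 'c)"
    using cograded_dualc[OF graded_coeffs(1)] by (simp add: cograded_def copc_eq_dualc)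
  show L: "cograded (iL :: _ \<Rightarrow> _ \<Rightarrow> _ \<Rightarrow> 'c)" and R: "cograded (iR :: _ \<Rightarrow> _ \<Rightarrow> _ \<Rightarrow> 'c)" 
    unfolding cograded_def iL_def iR_def by (intro ballI allI impI, simp split: if_splits)+
  show "cograded (rcopc :: _ \<Rightarrow> _ \<Rightarrow> _ \<Rightarrow> 'c)" unfolding cograded_def
  proof (intro ballI allI impI)
    fix M A B assume M: "M \<in> asm_mats" "rcopc M A B \<noteq> (0 :: 'c)"
    then have "copc M A B \<noteq> (0 :: 'c) \<or> iL M A B \<noteq> (0 :: 'c) \<or> iR M A B \<noteq> (0 :: 'c)"
      using copc_decomp[of M A B, where 'a = 'c] by auto
    then show "A \<in> asm_mats \<and> B \<in> asm_mats \<and> fst A + fst B = fst M"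
      using M(1) cogradedD[OF *, of M A B] cogradedD[OF L, of M A B] cogradedD[OF R, of M A B] by blast
  qed
qed

text \<open>A finite window on the basis. Sums over supports are moved to such a window, common to
  all vectors involved, before they are interchanged.\<close>

definition asm_upto :: "nat \<Rightarrow> mat set" where
  "asm_upto N = {M \<in> asm_mats. fst M \<le> N}"

lemma finite_asm_upto [simp]: "finite (asm_upto N)"
proof (rule finite_subset)
  show "asm_upto N \<subseteq> {..N} \<times> Pow ({..<N} \<times> {..<N})"
    using asm_mats_bounds by (fastforce simp: asm_upto_def)
qed simp

section \<open>Relations between structure coefficients\<close>

lemma sum_unique_indicator:
  assumes "finite Z" "\<And>x y. x \<in> Z \<Longrightarrow> y \<in> Z \<Longrightarrow> P x \<Longrightarrow> P y \<Longrightarrow> x = y"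
  shows "(\<Sum>x\<in>Z. if P x then 1 else 0) = (if \<exists>x\<in>Z. P x then 1 else (0 :: 'k::comm_ring_1))"
proof (cases "\<exists>x\<in>Z. P x")
  case True
  then obtain x where x: "x \<in> Z" "P x" by blast
  then have "(\<Sum>y\<in>Z. if P y then 1 else 0) = (\<Sum>y\<in>Z. if y = x then 1 else (0 :: 'k))"
    using assms(2) by (intro sum.cong) auto
  then show ?thesis using True x assms(1) by simp
qed auto

text \<open>Each sum has at most one nonzero term, as the intermediate factor is forced by
  \<open>M\<close>. The predicates \<open>p\<close>, \<open>q\<close>, \<open>r\<close>,
  \<open>s\<close> stand for conditions on the last column, so associativity and all three
  dendriform relations are instances.\<close>

lemma assoc_sum:
  assumes A: "A \<in> asm_mats" and B: "B \<in> asm_mats" and C: "C \<in> asm_mats" and N: "fst A + fst B + fst C \<le> N"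
    and H: "\<And>M'. M' \<in> shc A B \<Longrightarrow> M \<in> shc M' C \<Longrightarrow>
      p M' \<and> q M' \<longleftrightarrow> r (compress (lower (fst A) (snd M))) \<and> s (compress (lower (fst A) (snd M)))"
  shows "(\<Sum>M'\<in>asm_upto N. (if M' \<in> shc A B \<and> p M' then 1 else 0) * (if M \<in> shc M' C \<and> q M' then 1 else 0))
    = (\<Sum>M'\<in>asm_upto N. (if M' \<in> shc B C \<and> r M' then 1 else 0) * (if M \<in> shc A M' \<and> s M' then 1 else (0::'k::comm_ring_1)))"
    (is "?l = ?r")
proof -
  let ?P = "\<lambda>M'. M' \<in> shc A B \<and> p M' \<and> M \<in> shc M' C \<and> q M'"
  let ?Q = "\<lambda>M'. M' \<in> shc B C \<and> r M' \<and> M \<in> shc A M' \<and> s M'"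
  let ?U = "compress (upper (fst A + fst B) (snd M))" and ?D = "compress (lower (fst A) (snd M))"
  have P: "M' = ?U \<and> ?Q ?D" if "?P M'" for M'
    using shc_middle_left[OF A B C, of M' M] H[of M'] that by blast
  have Q: "M' = ?D \<and> ?P ?U" if "?Q M'" for M'
    using shc_middle_right[OF A B C, of M' M] H[of ?U] that by blast
  have "?l = (\<Sum>M'\<in>asm_upto N. if ?P M' then 1 else 0)" by (intro sum.cong) auto
  also have "\<dots> = (if \<exists>M'\<in>asm_upto N. ?P M' then 1 else 0)"
    using P by (intro sum_unique_indicator) (simp, metis)
  also have "(\<exists>M'\<in>asm_upto N. ?P M') \<longleftrightarrow> (\<exists>M'. ?P M')"
    using A B N shc_asm[OF A B] fst_shc[of _ A B] by (fastforce simp: asm_upto_def)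
  also have "\<dots> \<longleftrightarrow> (\<exists>M'. ?Q M')" using P Q by blast
  also have "\<dots> \<longleftrightarrow> (\<exists>M'\<in>asm_upto N. ?Q M')"
    using B C N shc_asm[OF B C] fst_shc[of _ B C] by (fastforce simp: asm_upto_def)
  also have "(if \<exists>M'\<in>asm_upto N. ?Q M' then 1 else 0) = (\<Sum>M'\<in>asm_upto N. if ?Q M' then 1 else (0::'k))"
    using Q by (intro sum_unique_indicator[symmetric]) (simp, metis)
  also have "\<dots> = ?r" by (intro sum.cong) auto
  finally show ?thesis .
qed

lemma dendriform_sums:
  assumes A: "A \<in> asm_mats" and B: "B \<in> asm_mats" and C: "C \<in> asm_mats" and N: "fst A + fst B + fst C \<le> N"
  shows "(\<Sum>M'\<in>asm_upto N. multc A B M' * multc M' C M) = (\<Sum>M'\<in>asm_upto N. multc B C M' * (multc A M' M :: 'k::comm_ring_1))"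
    "(\<Sum>M'\<in>asm_upto N. ltc A B M' * ltc M' C M) = (\<Sum>M'\<in>asm_upto N. multc B C M' * (ltc A M' M :: 'k))"
    "(\<Sum>M'\<in>asm_upto N. gtc A B M' * ltc M' C M) = (\<Sum>M'\<in>asm_upto N. ltc B C M' * (gtc A M' M :: 'k))"
    "(\<Sum>M'\<in>asm_upto N. multc A B M' * gtc M' C M) = (\<Sum>M'\<in>asm_upto N. gtc B C M' * (gtc A M' M :: 'k))"
  using assoc_sum[OF assms, of M "\<lambda>_. True" "\<lambda>_. True" "\<lambda>_. True" "\<lambda>_. True"]
    assoc_sum[OF assms, of M "last_upper (fst A)" "\<lambda>M'. last_upper (fst M') M" "\<lambda>_. True" "\<lambda>_. last_upper (fst A) M"]
    assoc_sum[OF assms, of M "last_lower (fst A)" "\<lambda>M'. last_upper (fst M') M" "last_upper (fst B)" "\<lambda>_. last_lower (fst A) M"]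
    assoc_sum[OF assms, of M "\<lambda>_. True" "\<lambda>M'. last_lower (fst M') M" "last_lower (fst B)" "\<lambda>_. last_lower (fst A) M"]
    shc_middle_last[OF A B C _ _ refl, of _ M]
  unfolding multc_def ltc_def gtc_def by simp_all

text \<open>The value does not depend on \<open>N\<close> once \<open>N\<close> bounds the sizes of \<open>A\<close> and \<open>B\<close>.\<close>

definition tb :: "nat \<Rightarrow> (mat \<Rightarrow> mat \<Rightarrow> mat \<Rightarrow> 'k::comm_ring_1) \<Rightarrow> (mat \<Rightarrow> mat \<Rightarrow> mat \<Rightarrow> 'k) \<Rightarrow>
    (mat \<Rightarrow> mat \<Rightarrow> mat \<Rightarrow> 'k) \<Rightarrow> (mat \<Rightarrow> mat \<Rightarrow> mat \<Rightarrow> 'k) \<Rightarrow> mat \<Rightarrow> mat \<Rightarrow> mat \<Rightarrow> mat \<Rightarrow> 'k" where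
  "tb N m1 m2 d1 d2 A B L R = (\<Sum>(A1, A2, B1, B2)\<in>asm_upto N \<times> asm_upto N \<times> asm_upto N \<times> asm_upto N.
     d1 A A1 A2 * d2 B B1 B2 * m1 A1 B1 L * m2 A2 B2 R)"

lemma quad_sum_cong:
  assumes "\<And>A1 A2 B1 B2. A1 \<in> Z \<Longrightarrow> A2 \<in> Z \<Longrightarrow> B1 \<in> Z \<Longrightarrow> B2 \<in> Z \<Longrightarrow> f A1 A2 B1 B2 = g A1 A2 B1 B2"
  shows "(\<Sum>(A1, A2, B1, B2)\<in>Z \<times> Z \<times> Z \<times> Z. f A1 A2 B1 B2) = (\<Sum>(A1, A2, B1, B2)\<in>Z \<times> Z \<times> Z \<times> Z. g A1 A2 B1 B2)"
  by (rule sum.cong) (simp_all add: split_def mem_Times_iff assms)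

lemma quad_sum_delta:
  assumes "finite Z" "c \<in> Z \<times> Z \<times> Z \<times> Z"
  shows "(\<Sum>(A1, A2, B1, B2)\<in>Z \<times> Z \<times> Z \<times> Z. if (A1, A2, B1, B2) = c then x else 0) = (x :: 'k::comm_ring_1)"
proof -
  have "(\<Sum>(A1, A2, B1, B2)\<in>Z \<times> Z \<times> Z \<times> Z. if (A1, A2, B1, B2) = c then x else 0)
      = (\<Sum>q\<in>Z \<times> Z \<times> Z \<times> Z. if q = c then x else 0)"
    by (rule sum.cong) (simp_all add: split_def)
  then show ?thesis using assms by simp
qed

lemma tb_zero:
  assumes "\<And>A1 A2 B1 B2. A1 \<in> asm_mats \<Longrightarrow> A2 \<in> asm_mats \<Longrightarrow> B1 \<in> asm_mats \<Longrightarrow> B2 \<in> asm_mats \<Longrightarrow>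
    d1 A A1 A2 * d2 B B1 B2 * m1 A1 B1 L * m2 A2 B2 R = 0"
  shows "tb N m1 m2 d1 d2 A B L R = 0"
  unfolding tb_def by (rule sum.neutral) (simp add: split_def mem_Times_iff assms asm_upto_def)

text \<open>The sum is transported along \<open>bij_betw_quad\<close>. Hypothesis \<open>H\<close>
  expresses that a label on the product only concerns the right blocks \<open>A2\<close> and
  \<open>B2\<close>, and a label on the coproduct only the splitting of \<open>B\<close>; the
  remaining factors stay unlabelled.\<close>

lemma compat_sum:
  fixes m :: "mat \<Rightarrow> mat \<Rightarrow> mat \<Rightarrow> 'k::comm_ring_1"
  assumes A: "A \<in> asm_mats" and B: "B \<in> asm_mats" and L: "L \<in> asm_mats" and R: "R \<in> asm_mats"
    and N: "fst A + fst B \<le> N" "fst A \<le> N'" "fst B \<le> N'"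
    and H: "\<And>M A1 A2 B1 B2. M \<in> shc A B \<Longrightarrow> (L, R) \<in> splits M \<Longrightarrow>
        quad (fst A) (fst L) M = (A1, A2, B1, B2) \<Longrightarrow> m A B M * c M L R = c B B1 B2 * m A2 B2 R"
    and m0: "\<And>A B M. M \<notin> shc A B \<Longrightarrow> m A B M = 0"
    and c0: "\<And>A B M. M \<in> asm_mats \<Longrightarrow> (A, B) \<notin> splits M \<Longrightarrow> c M A B = 0"
  shows "(\<Sum>M\<in>asm_upto N. m A B M * c M L R) = tb N' multc m copc c A B L R"
proof -
  let ?X = "{M \<in> shc A B. (L, R) \<in> splits M}"
  let ?Y = "{(A1, A2, B1, B2). (A1, A2) \<in> splits A \<and> (B1, B2) \<in> splits B \<and> L \<in> shc A1 B1 \<and> R \<in> shc A2 B2}"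
  let ?h = "\<lambda>(A1, A2, B1, B2). c B B1 B2 * m A2 B2 R"
  let ?Z = "asm_upto N'"
  have X: "?X \<subseteq> asm_upto N" using N(1) shc_asm[OF A B] fst_shc by (fastforce simp: asm_upto_def)
  have split_size: "A1 \<in> asm_mats \<and> A2 \<in> asm_mats \<and> fst A1 \<le> fst K \<and> fst A2 \<le> fst K"
    if "(A1, A2) \<in> splits K" "K \<in> asm_mats" for A1 A2 K
    using that fst_shc[of "mat_transp K" "mat_transp A1" "mat_transp A2"] by (simp add: splits_iff_shc)
  have Y: "?Y \<subseteq> ?Z \<times> ?Z \<times> ?Z \<times> ?Z"
    using N(2,3) split_size[OF _ A] split_size[OF _ B] by (fastforce simp: asm_upto_def)
  have "(\<Sum>M\<in>asm_upto N. m A B M * c M L R) = (\<Sum>M\<in>?X. m A B M * c M L R)"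
  proof (rule sum.mono_neutral_right)
    show "\<forall>M\<in>asm_upto N - ?X. m A B M * c M L R = 0"
    proof
      fix M assume "M \<in> asm_upto N - ?X"
      then show "m A B M * c M L R = 0" using m0[of M A B] c0[of M L R] by (auto simp: asm_upto_def)
    qed
  qed (use X in auto)
  also have "\<dots> = (\<Sum>M\<in>?X. ?h (quad (fst A) (fst L) M))"
  proof (rule sum.cong)
    fix M assume "M \<in> ?X"
    then show "m A B M * c M L R = ?h (quad (fst A) (fst L) M)"
      using H[of M] by (cases "quad (fst A) (fst L) M") auto
  qed simp
  also have "\<dots> = (\<Sum>q\<in>?Y. ?h q)"
    by (rule sum.reindex_bij_betw[OF bij_betw_quad[OF A B L R]])
  also have "\<dots> = (\<Sum>(A1, A2, B1, B2)\<in>?Y. copc A A1 A2 * c B B1 B2 * multc A1 B1 L * m A2 B2 R)"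
    by (rule sum.cong) (auto simp: copc_def multc_def)
  also have "\<dots> = tb N' multc m copc c A B L R"
    unfolding tb_def
  proof (rule sum.mono_neutral_left)
    show "\<forall>q\<in>?Z \<times> ?Z \<times> ?Z \<times> ?Z - ?Y.
        (case q of (A1, A2, B1, B2) \<Rightarrow> copc A A1 A2 * c B B1 B2 * multc A1 B1 L * m A2 B2 R) = 0"
    proof
      fix q assume q: "q \<in> ?Z \<times> ?Z \<times> ?Z \<times> ?Z - ?Y"
      obtain A1 A2 B1 B2 where "q = (A1, A2, B1, B2)" by (cases q)
      then show "(case q of (A1, A2, B1, B2) \<Rightarrow> copc A A1 A2 * c B B1 B2 * multc A1 B1 L * m A2 B2 R) = 0"
        using q m0[of R A2 B2] c0[OF B, of B1 B2] by (auto simp: copc_def multc_def)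
    qed
  qed (use Y in auto)
  finally show ?thesis .
qed

lemma compat_mult_cop:
  assumes A: "A \<in> asm_mats" and B: "B \<in> asm_mats" and N: "fst A + fst B \<le> N" "fst A \<le> N'" "fst B \<le> N'"
  shows "(\<Sum>M\<in>asm_upto N. multc A B M * copc M L R) = (tb N' multc multc copc copc A B L R :: 'k::comm_ring_1)"
proof (cases "L \<in> asm_mats \<and> R \<in> asm_mats")
  case True
  show ?thesis
  proof (rule compat_sum[OF A B _ _ N])
    fix M A1 A2 B1 B2
    assume M: "M \<in> shc A B" "(L, R) \<in> splits M" and q: "quad (fst A) (fst L) M = (A1, A2, B1, B2)"
    then show "multc A B M * copc M L R = copc B B1 B2 * multc A2 B2 R"
      using quad_facts(2,4)[OF A B _ _ M q] True by (simp add: multc_def copc_def)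
  qed (use True in \<open>simp_all add: multc_def copc_def\<close>)
next
  case False
  then have "multc A B M * copc M L R = (0 :: 'k)" if "M \<in> asm_upto N" for M
    using that by (auto simp: copc_eq_dualc dualc_def asm_upto_def)
  then have "(\<Sum>M\<in>asm_upto N. multc A B M * copc M L R) = (0 :: 'k)" by (rule sum.neutral[OF ballI])
  moreover have "tb N' multc multc copc copc A B L R = (0 :: 'k)"
  proof (rule tb_zero)
    show "copc A A1 A2 * copc B B1 B2 * multc A1 B1 L * multc A2 B2 R = (0 :: 'k)"
    if "A1 \<in> asm_mats" "A2 \<in> asm_mats" "B1 \<in> asm_mats" "B2 \<in> asm_mats" for A1 A2 B1 B2
    using that False shc_asm[of A1 B1 L] shc_asm[of A2 B2 R] by (auto simp: multc_def)
  qed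
  ultimately show ?thesis by simp
qed


lemma dualc_label:
  assumes "M \<in> asm_mats"
  shows "dualc ltc M A B = (if (A, B) \<in> splits M \<and> last_upper (fst A) (mat_transp M) then 1 else 0)"
    "dualc gtc M A B = (if (A, B) \<in> splits M \<and> last_lower (fst A) (mat_transp M) then 1 else 0)"
  using assms by (auto simp: dualc_def ltc_def gtc_def splits_iff_shc)

text \<open>\<open>B \<noteq> e0\<close> places the last row of \<open>M\<close> among the rows of
  \<open>B\<close>, and \<open>R \<noteq> e0\<close> places its last column in the right part. Hence
  the half coproduct is read off on \<open>B\<close> and the half product on the right
  blocks.\<close>

lemma compat_half:
  fixes m d :: "mat \<Rightarrow> mat \<Rightarrow> mat \<Rightarrow> 'k::comm_ring_1"
  assumes A: "A \<in> asm_mats" and B: "B \<in> asm_mats" and L: "L \<in> asm_mats" and R: "R \<in> asm_mats"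
    and N: "fst A + fst B \<le> N" "fst A \<le> N'" "fst B \<le> N'" and ne: "B \<noteq> e0" "R \<noteq> e0"
    and m: "m \<in> {ltc, gtc}" and d: "d \<in> {ltc, gtc}"
  shows "(\<Sum>M\<in>asm_upto N. m A B M * dualc d M L R) = tb N' multc m copc (dualc d) A B L R"
proof (rule compat_sum[OF A B L R N])
  fix M A1 A2 B1 B2
  assume M: "M \<in> shc A B" and LR: "(L, R) \<in> splits M" and q: "quad (fst A) (fst L) M = (A1, A2, B1, B2)"
  note f = quad_facts[OF A B L R M LR q]
  have pos: "0 < fst R" "0 < fst B" using ne A B R asm_mats_size_0_iff by blast+
  have "m A B M = m A2 B2 R" using m f(4) f(6,7)[OF pos(1)] M by (auto simp: ltc_def gtc_def)
  moreover have "dualc d M L R = dualc d B B1 B2"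
    using d f(2) f(8,9)[OF pos(2)] LR shc_asm[OF A B M] B by (auto simp: dualc_label)
  ultimately show "m A B M * dualc d M L R = dualc d B B1 B2 * m A2 B2 R" by simp
qed (use m d in \<open>auto simp: ltc_def gtc_def dualc_label\<close>)

text \<open>Origin of the isolated summands \<open>tens a b\<close> and \<open>tens b a\<close> in
  the compatibility relations: they are the products of two unit terms of the coproducts.\<close>

lemma tb_units:
  assumes "A \<in> asm_mats" "B \<in> asm_mats" "fst A \<le> N" "fst B \<le> N"
  shows "tb N multc multc iR iL A B L R = (if L = A \<and> R = B then 1 else 0)"
    "tb N multc multc iL iR A B L R = (if L = B \<and> R = A then 1 else 0)"
proof -
  let ?Z = "asm_upto N \<times> asm_upto N \<times> asm_upto N \<times> asm_upto N"
  have Z: "A \<in> asm_upto N" "B \<in> asm_upto N" "e0 \<in> asm_upto N"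
    using assms by (simp_all add: asm_upto_def)
  have "tb N multc multc iR iL A B L R = (\<Sum>(A1, A2, B1, B2)\<in>?Z.
      if (A1, A2, B1, B2) = (A, e0, e0, B) then (if L = A \<and> R = B then 1 else 0) else 0)"
    unfolding tb_def
  proof (rule quad_sum_cong)
    show "iR A A1 A2 * iL B B1 B2 * multc A1 B1 L * multc A2 B2 R =
      (if (A1, A2, B1, B2) = (A, e0, e0, B) then (if L = A \<and> R = B then 1 else 0) else 0)" for A1 A2 B1 B2
      using assms by (cases "(A1, A2, B1, B2) = (A, e0, e0, B)") (simp add: iR_def iL_def multc_e0, auto simp: iR_def iL_def)
  qed
  then show "tb N multc multc iR iL A B L R = (if L = A \<and> R = B then 1 else 0)"
    using Z by (subst (asm) quad_sum_delta) simp_all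
  have "tb N multc multc iL iR A B L R = (\<Sum>(A1, A2, B1, B2)\<in>?Z.
      if (A1, A2, B1, B2) = (e0, A, B, e0) then (if L = B \<and> R = A then 1 else 0) else 0)"
    unfolding tb_def
  proof (rule quad_sum_cong)
    show "iL A A1 A2 * iR B B1 B2 * multc A1 B1 L * multc A2 B2 R =
      (if (A1, A2, B1, B2) = (e0, A, B, e0) then (if L = B \<and> R = A then 1 else 0) else 0)" for A1 A2 B1 B2
      using assms by (cases "(A1, A2, B1, B2) = (e0, A, B, e0)") (simp add: iR_def iL_def multc_e0, auto simp: iR_def iL_def)
  qed
  then show "tb N multc multc iL iR A B L R = (if L = B \<and> R = A then 1 else 0)"
    using Z by (subst (asm) quad_sum_delta) simp_all
qed

lemma rdualc_e0 [simp]: "rdualc m M e0 B = 0" "rdualc m M A e0 = 0"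
  by (simp_all add: rdualc_def)

text \<open>Each unreduced half coproduct retains one unit term, with \<open>M\<close> on the side
  where its last row is required to be.\<close>

lemma dualc_decomp:
  assumes "M \<in> asm_mats" "M \<noteq> e0"
  shows "dualc gtc M A B = rdualc gtc M A B + iL M A B" "dualc ltc M A B = rdualc ltc M A B + iR M A B"
  using assms by (auto simp: rdualc_def dualc_def iL_def iR_def gtc_e0 ltc_e0)

lemma graded_zero:
  assumes "A \<in> asm_mats" "B \<in> asm_mats" "M \<notin> asm_mats"
  shows "multc A B M = 0" "ltc A B M = 0" "gtc A B M = 0"
  using shc_asm[OF assms(1,2), of M] assms(3) by (auto simp: multc_def ltc_def gtc_def)

lemma tb_zero_outside:
  assumes bad: "L \<notin> asm_mats \<or> R \<notin> asm_mats \<or> L = e0 \<or> R = e0"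
    and m: "m \<in> {multc, ltc, gtc}"
    and d1: "\<And>A2 B2. d1 A e0 A2 * d2 B e0 B2 = 0" and d2: "\<And>A1 B1. d1 A A1 e0 * d2 B B1 e0 = 0"
  shows "tb N multc m d1 d2 A B L R = 0"
proof (rule tb_zero)
  fix A1 A2 B1 B2 assume q: "A1 \<in> asm_mats" "A2 \<in> asm_mats" "B1 \<in> asm_mats" "B2 \<in> asm_mats"
  consider "L \<notin> asm_mats" | "R \<notin> asm_mats" | "L = e0" | "R = e0" using bad by blast
  then show "d1 A A1 A2 * d2 B B1 B2 * multc A1 B1 L * m A2 B2 R = 0"
  proof cases
    case 1 then show ?thesis using q by (simp add: graded_zero)
  next
    case 2 then show ?thesis using q m by (auto simp: graded_zero)
  next
    case 3 then show ?thesis using q d1[of A2 B2] by (auto simp: multc_e0)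
  next
    case 4 then show ?thesis using q d2[of A1 B1] m by (auto simp: multc_e0 ltc_e0 gtc_e0)
  qed
qed

lemma rcopc_e0:
  assumes "M \<in> asm_mats" "M \<noteq> e0"
  shows "rcopc M e0 B = 0" "rcopc M A e0 = 0"
  using assms by (simp_all add: rcopc_eq_rdualc)

lemma sum_rdualc_zero_outside:
  "L \<notin> asm_mats \<or> R \<notin> asm_mats \<or> L = e0 \<or> R = e0 \<Longrightarrow> (\<Sum>M\<in>Z. m A B M * rdualc d M L R) = 0"
  by (rule sum.neutral) (auto simp: rdualc_def dualc_def)

text \<open>All four are expansions of \<open>compat_half\<close>: the coproduct of \<open>A\<close>
  is its reduced part plus two unit terms, the half coproduct of \<open>B\<close> its reduced part
  plus one. Of the six products some vanish, because they would make \<open>L\<close> or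
  \<open>R\<close> empty or because the half product in question is zero on that empty factor. Where
  one factor on the right is empty and the half product survives, it equals the full product, hence
  \<open>multc\<close> in those summands.\<close>

lemma bidendriform_sums:
  assumes A: "A \<in> asm_mats" "A \<noteq> e0" and B: "B \<in> asm_mats" "B \<noteq> e0"
    and N: "fst A + fst B \<le> N" "fst A \<le> N'" "fst B \<le> N'"
  shows "(\<Sum>M\<in>asm_upto N. gtc A B M * rdualc gtc M L R) =
      tb N' multc gtc rcopc (rdualc gtc) A B L R + tb N' multc gtc rcopc iL A B L R
      + tb N' multc gtc iL (rdualc gtc) A B L R + tb N' multc multc iR (rdualc gtc) A B L R
      + (if L = A \<and> R = B then 1 else (0::'k::comm_ring_1))" (is ?th1)
    and "(\<Sum>M\<in>asm_upto N. ltc A B M * rdualc gtc M L R) =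
      tb N' multc ltc rcopc (rdualc gtc) A B L R + tb N' multc ltc rcopc iL A B L R
      + (tb N' multc ltc iL (rdualc gtc) A B L R :: 'k)" (is ?th2)
    and "(\<Sum>M\<in>asm_upto N. gtc A B M * rdualc ltc M L R) =
      tb N' multc gtc rcopc (rdualc ltc) A B L R + tb N' multc multc iR (rdualc ltc) A B L R
      + (tb N' multc gtc iL (rdualc ltc) A B L R :: 'k)" (is ?th3)
    and "(\<Sum>M\<in>asm_upto N. ltc A B M * rdualc ltc M L R) =
      tb N' multc ltc rcopc (rdualc ltc) A B L R + tb N' multc multc rcopc iR A B L R
      + tb N' multc ltc iL (rdualc ltc) A B L R + (if L = B \<and> R = A then 1 else (0::'k))" (is ?th4)
proof -
  consider "L \<notin> asm_mats \<or> R \<notin> asm_mats \<or> L = e0 \<or> R = e0"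
    | "L \<in> asm_mats" "R \<in> asm_mats" "L \<noteq> e0" "R \<noteq> e0" by blast
  then have "?th1 \<and> ?th2 \<and> ?th3 \<and> ?th4"
  proof cases
    case 1
    then have "\<not> (L = A \<and> R = B)" "\<not> (L = B \<and> R = A)" using A B by auto
    with 1 show ?thesis using A B
      by (simp add: sum_rdualc_zero_outside tb_zero_outside rcopc_e0 iL_def iR_def)
  next
    case 2
    note half = compat_half[OF A(1) B(1) 2(1,2) N B(2) 2(4)]
    have red: "(\<Sum>M\<in>asm_upto N. m A B M * rdualc d M L R) = (\<Sum>M\<in>asm_upto N. m A B M * dualc d M L R)"
      for m d :: "mat \<Rightarrow> mat \<Rightarrow> mat \<Rightarrow> 'k"
      using 2 by (simp add: rdualc_def)
    \<comment> \<open>The expansion for one quadruple of blocks, with \<open>x\<close> for the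
      reduced coproduct of \<open>A\<close> and \<open>y\<close> for the reduced half coproduct of
      \<open>B\<close>. All that matters about \<open>x\<close> and \<open>y\<close> is that they
      vanish when one of their blocks is empty.\<close>
    have pt: "((x + iR A A1 A2 + iL A A1 A2) * (y + iL B B1 B2) * multc A1 B1 L * gtc A2 B2 R =
          x * y * multc A1 B1 L * gtc A2 B2 R + x * iL B B1 B2 * multc A1 B1 L * gtc A2 B2 R
          + iL A A1 A2 * y * multc A1 B1 L * gtc A2 B2 R + iR A A1 A2 * y * multc A1 B1 L * multc A2 B2 R
          + iR A A1 A2 * iL B B1 B2 * multc A1 B1 L * multc A2 B2 R) \<and>
        ((x + iR A A1 A2 + iL A A1 A2) * (y + iL B B1 B2) * multc A1 B1 L * ltc A2 B2 R =
          x * y * multc A1 B1 L * ltc A2 B2 R + x * iL B B1 B2 * multc A1 B1 L * ltc A2 B2 R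
          + iL A A1 A2 * y * multc A1 B1 L * ltc A2 B2 R) \<and>
        ((x + iR A A1 A2 + iL A A1 A2) * (y + iR B B1 B2) * multc A1 B1 L * gtc A2 B2 R =
          x * y * multc A1 B1 L * gtc A2 B2 R + iR A A1 A2 * y * multc A1 B1 L * multc A2 B2 R
          + iL A A1 A2 * y * multc A1 B1 L * gtc A2 B2 R) \<and>
        ((x + iR A A1 A2 + iL A A1 A2) * (y + iR B B1 B2) * multc A1 B1 L * ltc A2 B2 R =
          x * y * multc A1 B1 L * ltc A2 B2 R + x * iR B B1 B2 * multc A1 B1 L * multc A2 B2 R
          + iL A A1 A2 * y * multc A1 B1 L * ltc A2 B2 R
          + iL A A1 A2 * iR B B1 B2 * multc A1 B1 L * multc A2 B2 R)"
      if "A1 \<in> asm_upto N'" "A2 \<in> asm_upto N'" "B1 \<in> asm_upto N'" "B2 \<in> asm_upto N'"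
        "A1 = e0 \<or> A2 = e0 \<Longrightarrow> x = 0" "B1 = e0 \<or> B2 = e0 \<Longrightarrow> y = 0"
      for A1 A2 B1 B2 and x y :: 'k
      using that A B 2
      by (cases "A2 = e0"; cases "B2 = e0"; cases "A1 = e0"; cases "B1 = e0")
        (simp_all add: algebra_simps iL_def iR_def multc_e0 gtc_e0 ltc_e0 asm_upto_def)
    let ?Z = "asm_upto N' \<times> asm_upto N' \<times> asm_upto N' \<times> asm_upto N'"
    have x0: "A1 = e0 \<or> A2 = e0 \<Longrightarrow> rcopc A A1 A2 = (0 :: 'k)" for A1 A2
      using A by (auto simp: rcopc_e0)
    have y0: "B1 = e0 \<or> B2 = e0 \<Longrightarrow> rdualc d B B1 B2 = (0 :: 'k)" for B1 B2 d by auto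
    have iRL: "(if L = A \<and> R = B then 1 else 0) = (tb N' multc multc iR iL A B L R :: 'k)"
      "(if L = B \<and> R = A then 1 else 0) = (tb N' multc multc iL iR A B L R :: 'k)"
      by (rule tb_units[OF A(1) B(1) N(2,3), symmetric])+
    have sums: "(\<Sum>(A1, A2, B1, B2)\<in>?Z. f A1 A2 B1 B2) + (\<Sum>(A1, A2, B1, B2)\<in>?Z. g A1 A2 B1 B2)
        = (\<Sum>(A1, A2, B1, B2)\<in>?Z. f A1 A2 B1 B2 + g A1 A2 B1 B2)"
      for f g :: "mat \<Rightarrow> mat \<Rightarrow> mat \<Rightarrow> mat \<Rightarrow> 'k"
      by (simp add: split_def sum.distrib)
    have "?th1"
      unfolding red iRL half[of gtc gtc, simplified]
      unfolding tb_def copc_decomp dualc_decomp[OF B] sums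
      by (rule quad_sum_cong, rule pt[THEN conjunct1]) (assumption | rule x0 | rule y0)+
    moreover have "?th2"
      unfolding red half[of ltc gtc, simplified]
      unfolding tb_def copc_decomp dualc_decomp[OF B] sums
      by (rule quad_sum_cong, rule pt[THEN conjunct2, THEN conjunct1]) (assumption | rule x0 | rule y0)+
    moreover have "?th3"
      unfolding red half[of gtc ltc, simplified]
      unfolding tb_def copc_decomp dualc_decomp[OF B] sums
      by (rule quad_sum_cong, rule pt[THEN conjunct2, THEN conjunct2, THEN conjunct1]) (assumption | rule x0 | rule y0)+
    moreover have "?th4"
      unfolding red iRL half[of ltc ltc, simplified]
      unfolding tb_def copc_decomp dualc_decomp[OF B] sums
      by (rule quad_sum_cong, rule pt[THEN conjunct2, THEN conjunct2, THEN conjunct2]) (assumption | rule x0 | rule y0)+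
    ultimately show ?thesis by blast
  qed
  then show ?th1 ?th2 ?th3 ?th4 by blast+
qed

section \<open>Multilinear extension\<close>

lemma asm_upto_mono: "m \<le> n \<Longrightarrow> asm_upto m \<subseteq> asm_upto n"
  by (auto simp: asm_upto_def)

lemma asm_uptoD: "M \<in> asm_upto n \<Longrightarrow> M \<in> asm_mats" "M \<in> asm_upto n \<Longrightarrow> fst M \<le> n"
  by (auto simp: asm_upto_def)

lemma fspace_bound:
  assumes "v \<in> fspace asm_mats"
  obtains n where "supp v \<subseteq> asm_upto n"
proof
  have "finite (fst ` supp v)" "supp v \<subseteq> asm_mats" using assms by (simp_all add: fspace_def)
  then show "supp v \<subseteq> asm_upto (Max (fst ` supp v))"
    unfolding asm_upto_def by (intro subsetI CollectI conjI Max_ge imageI) blast+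
qed

lemma fspace_bound3:
  assumes "u \<in> fspace asm_mats" "v \<in> fspace asm_mats" "w \<in> fspace asm_mats"
  obtains n where "supp u \<subseteq> asm_upto n" "supp v \<subseteq> asm_upto n" "supp w \<subseteq> asm_upto n"
proof -
  obtain p q r where "supp u \<subseteq> asm_upto p" "supp v \<subseteq> asm_upto q" "supp w \<subseteq> asm_upto r"
    using assms fspace_bound by metis
  moreover have "asm_upto p \<subseteq> asm_upto (p + q + r)" "asm_upto q \<subseteq> asm_upto (p + q + r)"
    "asm_upto r \<subseteq> asm_upto (p + q + r)" by (simp_all add: asm_upto_mono)
  ultimately show thesis using that[of "p + q + r"] by blast
qed

lemma fspaceI: "supp v \<subseteq> asm_upto n \<Longrightarrow> v \<in> fspace asm_mats"
  using finite_subset[OF _ finite_asm_upto] asm_uptoD(1) unfolding fspace_def by blast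

lemma sum_supp:
  assumes "finite P" "supp v \<subseteq> P" "\<And>x. v x = 0 \<Longrightarrow> f x = 0"
  shows "(\<Sum>x\<in>supp v. f x) = (\<Sum>x\<in>P. f x)"
  using assms by (intro sum.mono_neutral_left) (auto simp: supp_def)

lemma bil_on:
  assumes "finite P" "finite Q" "supp v \<subseteq> P" "supp w \<subseteq> Q"
  shows "bil c v w M = (\<Sum>A\<in>P. \<Sum>B\<in>Q. v A * w B * c A B M)"
  using assms by (simp add: bil_def sum_supp[of P v] sum_supp[of Q w])

lemma cobil_on:
  assumes "finite P" "supp v \<subseteq> P"
  shows "cobil d v (A, B) = (\<Sum>M\<in>P. v M * d M A B)"
  using assms by (simp add: cobil_def sum_supp[of P v])

lemma coL_on:
  assumes "finite P" "supp X \<subseteq> P \<times> P"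
  shows "coL d X (A, B, C) = (\<Sum>M\<in>P. X (M, C) * d M A B)"
  unfolding coL_def split_conv
proof (rule sum.mono_neutral_left)
  show "\<forall>M\<in>P - fst ` supp X. X (M, C) * d M A B = 0"
  proof
    fix M assume "M \<in> P - fst ` supp X"
    then have "(M, C) \<notin> supp X" by force
    then show "X (M, C) * d M A B = 0" by (simp add: supp_def)
  qed
qed (use assms in auto)

lemma coR_on:
  assumes "finite P" "supp X \<subseteq> P \<times> P"
  shows "coR d X (A, B, C) = (\<Sum>M\<in>P. X (A, M) * d M B C)"
  unfolding coR_def split_conv
proof (rule sum.mono_neutral_left)
  show "\<forall>M\<in>P - snd ` supp X. X (A, M) * d M B C = 0"
  proof
    fix M assume "M \<in> P - snd ` supp X"
    then have "(A, M) \<notin> supp X" by force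
    then show "X (A, M) * d M B C = 0" by (simp add: supp_def)
  qed
qed (use assms in auto)

lemma tbil_on:
  assumes "finite P" "supp X \<subseteq> P \<times> P" "supp Y \<subseteq> P \<times> P"
  shows "tbil c1 c2 X Y (A, B) = (\<Sum>A1\<in>P. \<Sum>A2\<in>P. \<Sum>B1\<in>P. \<Sum>B2\<in>P.
    X (A1, A2) * Y (B1, B2) * c1 A1 B1 A * c2 A2 B2 B)"
  using assms
  by (simp add: tbil_def sum_supp[of "P \<times> P" X] sum_supp[of "P \<times> P" Y] sum.cartesian_product' split_def)

lemma supp_bil:
  assumes "graded m" "supp v \<subseteq> asm_upto p" "supp w \<subseteq> asm_upto q"
  shows "supp (bil m v w) \<subseteq> asm_upto (p + q)"
proof
  fix M assume "M \<in> supp (bil m v w)"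
  then have "(\<Sum>A\<in>supp v. \<Sum>B\<in>supp w. v A * w B * m A B M) \<noteq> 0" by (simp add: supp_def bil_def)
  then obtain A where A: "A \<in> supp v" "(\<Sum>B\<in>supp w. v A * w B * m A B M) \<noteq> 0"
    by (rule sum.not_neutral_contains_not_neutral)
  then obtain B where B: "B \<in> supp w" "v A * w B * m A B M \<noteq> 0"
    by (elim sum.not_neutral_contains_not_neutral)
  then have "m A B M \<noteq> 0" by auto
  moreover have "A \<in> asm_upto p" "B \<in> asm_upto q" using A B assms by auto
  ultimately show "M \<in> asm_upto (p + q)"
    using gradedD[OF assms(1), of A B M] by (simp add: asm_upto_def)
qed

lemma supp_cobil:
  assumes "cograded d" "supp v \<subseteq> asm_upto n"
  shows "supp (cobil d v) \<subseteq> asm_upto n \<times> asm_upto n"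
proof
  fix p assume p: "p \<in> supp (cobil d v)"
  obtain A B where AB: "p = (A, B)" by (cases p)
  have "(\<Sum>M\<in>supp v. v M * d M A B) \<noteq> 0" using p by (simp add: supp_def cobil_def AB)
  then obtain M where "M \<in> supp v" "v M * d M A B \<noteq> 0"
    by (rule sum.not_neutral_contains_not_neutral)
  then have M: "M \<in> asm_upto n" "d M A B \<noteq> 0" using assms by auto
  then show "p \<in> asm_upto n \<times> asm_upto n"
    using cogradedD[OF assms(1), of M A B] by (simp add: asm_upto_def AB)
qed

lemma sum_swap3: "(\<Sum>x\<in>X. \<Sum>a\<in>A. \<Sum>b\<in>B. f x a b) = (\<Sum>a\<in>A. \<Sum>b\<in>B. \<Sum>x\<in>X. f x a b)"
proof -
  have "(\<Sum>x\<in>X. \<Sum>a\<in>A. \<Sum>b\<in>B. f x a b) = (\<Sum>a\<in>A. \<Sum>x\<in>X. \<Sum>b\<in>B. f x a b)" by (rule sum.swap)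
  also have "\<dots> = (\<Sum>a\<in>A. \<Sum>b\<in>B. \<Sum>x\<in>X. f x a b)" by (intro sum.cong refl sum.swap)
  finally show ?thesis .
qed

text \<open>Reduces a relation between two bracketings to basis elements. The window
  \<open>3 * n\<close> is large enough for a product of three matrices of size at most
  \<open>n\<close>.\<close>

lemma bil_bil:
  assumes g: "graded d" "graded d'" and s: "supp u \<subseteq> asm_upto n" "supp v \<subseteq> asm_upto n" "supp w \<subseteq> asm_upto n"
    and H: "\<And>A B C M. A \<in> asm_upto n \<Longrightarrow> B \<in> asm_upto n \<Longrightarrow> C \<in> asm_upto n \<Longrightarrow> u A \<noteq> 0 \<Longrightarrow> v B \<noteq> 0 \<Longrightarrow> w C \<noteq> 0 \<Longrightarrow>
      (\<Sum>M'\<in>asm_upto (3 * n). d A B M' * c M' C M) = (\<Sum>M'\<in>asm_upto (3 * n). d' B C M' * c' A M' M)"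
  shows "bil c (bil d u v) w = bil c' u (bil d' v w)"
proof
  fix M
  let ?P = "asm_upto n" and ?Z = "asm_upto (3 * n)"
  have sub: "asm_upto (n + n) \<subseteq> ?Z" by (rule asm_upto_mono) simp
  have s1: "supp (bil d u v) \<subseteq> ?Z" and s2: "supp (bil d' v w) \<subseteq> ?Z"
    using supp_bil[OF g(1) s(1,2)] supp_bil[OF g(2) s(2,3)] sub by auto
  have "bil c (bil d u v) w M = (\<Sum>M'\<in>?Z. \<Sum>C\<in>?P. (\<Sum>A\<in>?P. \<Sum>B\<in>?P. u A * v B * d A B M') * w C * c M' C M)"
    using s s1 by (simp add: bil_on[of ?Z ?P] bil_on[of ?P ?P])
  also have "\<dots> = (\<Sum>M'\<in>?Z. \<Sum>C\<in>?P. \<Sum>A\<in>?P. \<Sum>B\<in>?P. u A * v B * w C * (d A B M' * c M' C M))"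
    by (simp add: sum_distrib_left sum_distrib_right mult_ac)
  also have "\<dots> = (\<Sum>C\<in>?P. \<Sum>A\<in>?P. \<Sum>B\<in>?P. \<Sum>M'\<in>?Z. u A * v B * w C * (d A B M' * c M' C M))"
    by (subst sum.swap) (intro sum.cong refl sum_swap3)
  also have "\<dots> = (\<Sum>A\<in>?P. \<Sum>B\<in>?P. \<Sum>C\<in>?P. \<Sum>M'\<in>?Z. u A * v B * w C * (d A B M' * c M' C M))"
    by (rule sum_swap3)
  also have "\<dots> = (\<Sum>A\<in>?P. \<Sum>B\<in>?P. \<Sum>C\<in>?P. u A * v B * w C * (\<Sum>M'\<in>?Z. d A B M' * c M' C M))"
    by (simp add: sum_distrib_left)
  also have "\<dots> = (\<Sum>A\<in>?P. \<Sum>B\<in>?P. \<Sum>C\<in>?P. u A * v B * w C * (\<Sum>M'\<in>?Z. d' B C M' * c' A M' M))"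
  proof (intro sum.cong refl)
    show "u A * v B * w C * (\<Sum>M'\<in>?Z. d A B M' * c M' C M) = u A * v B * w C * (\<Sum>M'\<in>?Z. d' B C M' * c' A M' M)"
      if "A \<in> ?P" "B \<in> ?P" "C \<in> ?P" for A B C
      using H[OF that, of M] by (cases "u A = 0 \<or> v B = 0 \<or> w C = 0") auto
  qed
  also have "\<dots> = (\<Sum>A\<in>?P. \<Sum>B\<in>?P. \<Sum>C\<in>?P. \<Sum>M'\<in>?Z. u A * v B * w C * (d' B C M' * c' A M' M))"
    by (simp add: sum_distrib_left)
  also have "\<dots> = (\<Sum>A\<in>?P. \<Sum>M'\<in>?Z. \<Sum>B\<in>?P. \<Sum>C\<in>?P. u A * v B * w C * (d' B C M' * c' A M' M))"
    by (intro sum.cong refl sum_swap3[symmetric])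
  also have "\<dots> = (\<Sum>A\<in>?P. \<Sum>M'\<in>?Z. u A * (\<Sum>B\<in>?P. \<Sum>C\<in>?P. v B * w C * d' B C M') * c' A M' M)"
    by (simp add: sum_distrib_left sum_distrib_right mult_ac)
  also have "\<dots> = bil c' u (bil d' v w) M"
    using s s2 by (simp add: bil_on[of ?P ?Z] bil_on[of ?P ?P])
  finally show "bil c (bil d u v) w M = bil c' u (bil d' v w) M" .
qed

lemma cobil_bil:
  assumes "graded m" "supp a \<subseteq> asm_upto n" "supp b \<subseteq> asm_upto n"
  shows "cobil d (bil m a b) (L, R) =
    (\<Sum>A\<in>asm_upto n. \<Sum>B\<in>asm_upto n. a A * b B * (\<Sum>M\<in>asm_upto (n + n). m A B M * d M L R))"
proof -
  let ?P = "asm_upto n" and ?Z = "asm_upto (n + n)"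
  have "cobil d (bil m a b) (L, R) = (\<Sum>M\<in>?Z. (\<Sum>A\<in>?P. \<Sum>B\<in>?P. a A * b B * m A B M) * d M L R)"
    using assms supp_bil[OF assms] by (simp add: cobil_on[of ?Z] bil_on[of ?P ?P])
  also have "\<dots> = (\<Sum>M\<in>?Z. \<Sum>A\<in>?P. \<Sum>B\<in>?P. a A * b B * (m A B M * d M L R))"
    by (simp add: sum_distrib_left sum_distrib_right mult_ac)
  also have "\<dots> = (\<Sum>A\<in>?P. \<Sum>B\<in>?P. \<Sum>M\<in>?Z. a A * b B * (m A B M * d M L R))"
    by (rule sum_swap3)
  finally show ?thesis by (simp add: sum_distrib_left)
qed

text \<open>Together with \<open>cobil_bil\<close> this gives both sides of a compatibility relation
  the same shape, a double sum weighted by \<open>a A * b B\<close>, so that it can be checked for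
  each pair of basis elements.\<close>

lemma tbil_cobil:
  assumes "cograded d1" "cograded d2" "supp a \<subseteq> asm_upto n" "supp b \<subseteq> asm_upto n"
  shows "tbil m1 m2 (cobil d1 a) (cobil d2 b) (L, R) =
    (\<Sum>A\<in>asm_upto n. \<Sum>B\<in>asm_upto n. a A * b B * tb n m1 m2 d1 d2 A B L R)"
proof -
  let ?P = "asm_upto n"
  let ?Q = "?P \<times> ?P \<times> ?P \<times> ?P"
  let ?t = "\<lambda>A B (A1, A2, B1, B2). d1 A A1 A2 * d2 B B1 B2 * m1 A1 B1 L * m2 A2 B2 R"
  have "tbil m1 m2 (cobil d1 a) (cobil d2 b) (L, R) = (\<Sum>(A1, A2, B1, B2)\<in>?Q.
      (\<Sum>A\<in>?P. a A * d1 A A1 A2) * (\<Sum>B\<in>?P. b B * d2 B B1 B2) * m1 A1 B1 L * m2 A2 B2 R)"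
    using assms supp_cobil[OF assms(1,3)] supp_cobil[OF assms(2,4)]
    by (simp add: tbil_on[of ?P] cobil_on[of ?P] sum.cartesian_product' split_def)
  also have "\<dots> = (\<Sum>q\<in>?Q. \<Sum>B\<in>?P. \<Sum>A\<in>?P. a A * b B * ?t A B q)"
    by (simp add: sum_distrib_left sum_distrib_right mult_ac split_def)
  also have "\<dots> = (\<Sum>q\<in>?Q. \<Sum>A\<in>?P. \<Sum>B\<in>?P. a A * b B * ?t A B q)"
    by (intro sum.cong refl sum.swap)
  also have "\<dots> = (\<Sum>A\<in>?P. \<Sum>B\<in>?P. \<Sum>q\<in>?Q. a A * b B * ?t A B q)"
    by (rule sum_swap3)
  finally show ?thesis by (simp add: tb_def sum_distrib_left)
qed

lemma coL_cobil:
  assumes "cograded d2" "supp x \<subseteq> asm_upto n"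
  shows "coL d1 (cobil d2 x) (A, B, C) = (\<Sum>M\<in>asm_upto n. x M * (\<Sum>M'\<in>asm_upto n. d2 M M' C * d1 M' A B))"
proof -
  let ?P = "asm_upto n"
  have "coL d1 (cobil d2 x) (A, B, C) = (\<Sum>M'\<in>?P. (\<Sum>M\<in>?P. x M * d2 M M' C) * d1 M' A B)"
    using assms supp_cobil[OF assms] by (simp add: coL_on[of ?P] cobil_on[of ?P])
  also have "\<dots> = (\<Sum>M'\<in>?P. \<Sum>M\<in>?P. x M * (d2 M M' C * d1 M' A B))"
    by (simp add: sum_distrib_left mult_ac)
  also have "\<dots> = (\<Sum>M\<in>?P. \<Sum>M'\<in>?P. x M * (d2 M M' C * d1 M' A B))" by (rule sum.swap)
  finally show ?thesis by (simp add: sum_distrib_left)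
qed

lemma coR_cobil:
  assumes "cograded d2" "supp x \<subseteq> asm_upto n"
  shows "coR d1 (cobil d2 x) (A, B, C) = (\<Sum>M\<in>asm_upto n. x M * (\<Sum>M'\<in>asm_upto n. d2 M A M' * d1 M' B C))"
proof -
  let ?P = "asm_upto n"
  have "coR d1 (cobil d2 x) (A, B, C) = (\<Sum>M'\<in>?P. (\<Sum>M\<in>?P. x M * d2 M A M') * d1 M' B C)"
    using assms supp_cobil[OF assms] by (simp add: coR_on[of ?P] cobil_on[of ?P])
  also have "\<dots> = (\<Sum>M'\<in>?P. \<Sum>M\<in>?P. x M * (d2 M A M' * d1 M' B C))"
    by (simp add: sum_distrib_left mult_ac)
  also have "\<dots> = (\<Sum>M\<in>?P. \<Sum>M'\<in>?P. x M * (d2 M A M' * d1 M' B C))" by (rule sum.swap)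
  finally show ?thesis by (simp add: sum_distrib_left)
qed

lemma mat_transp_asm_upto: "mat_transp M \<in> asm_upto n \<longleftrightarrow> M \<in> asm_upto n"
  by (simp add: asm_upto_def)

text \<open>Transposing all matrices turns a relation of associativity type into one of
  coassociativity type. The same proof thus serves the coproduct and the half coproducts, unreduced
  and reduced.\<close>

lemma dualc_sums:
  fixes m1 m2 m3 m4 :: "mat \<Rightarrow> mat \<Rightarrow> mat \<Rightarrow> 'k::comm_ring_1"
  assumes g: "graded m1" "graded m2" "graded m3" "graded m4"
    and H: "\<And>A B C M N. A \<in> asm_mats \<Longrightarrow> B \<in> asm_mats \<Longrightarrow> C \<in> asm_mats \<Longrightarrow> fst A + fst B + fst C \<le> N \<Longrightarrow>
      (\<Sum>M'\<in>asm_upto N. m1 A B M' * m2 M' C M) = (\<Sum>M'\<in>asm_upto N. m3 B C M' * m4 A M' M)"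
    and M: "M \<in> asm_upto n"
  shows "(\<Sum>M'\<in>asm_upto n. dualc m2 M M' C * dualc m1 M' A B) = (\<Sum>M'\<in>asm_upto n. dualc m4 M A M' * dualc m3 M' B C)"
    "(\<Sum>M'\<in>asm_upto n. rdualc m2 M M' C * rdualc m1 M' A B) = (\<Sum>M'\<in>asm_upto n. rdualc m4 M A M' * rdualc m3 M' B C)"
proof -
  show *: "(\<Sum>M'\<in>asm_upto n. dualc m2 M M' C * dualc m1 M' A B) = (\<Sum>M'\<in>asm_upto n. dualc m4 M A M' * dualc m3 M' B C)"
    (is "?l = ?r")
  proof (cases "A \<in> asm_mats \<and> B \<in> asm_mats \<and> C \<in> asm_mats \<and> fst A + fst B + fst C \<le> n")
    case True
    have "?l = (\<Sum>M'\<in>asm_upto n. m1 (mat_transp A) (mat_transp B) M' * m2 M' (mat_transp C) (mat_transp M))"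
      by (rule sum.reindex_bij_witness[of _ mat_transp mat_transp])
        (use True in \<open>auto simp: mat_transp_asm_upto dualc_def dest: asm_uptoD\<close>)
    also have "\<dots> = (\<Sum>M'\<in>asm_upto n. m3 (mat_transp B) (mat_transp C) M' * m4 (mat_transp A) M' (mat_transp M))"
      using True by (intro H) auto
    also have "\<dots> = ?r"
      by (rule sum.reindex_bij_witness[of _ mat_transp mat_transp])
        (use True in \<open>auto simp: mat_transp_asm_upto dualc_def dest: asm_uptoD\<close>)
    finally show ?thesis .
  next
    \<comment> \<open>If one of the three matrices is not an ASM, or their sizes exceed the window,
      grading makes every summand zero on both sides.\<close>
    case False
    have MA: "M \<in> asm_mats" "fst M \<le> n" using M by (simp_all add: asm_upto_def)
    have "dualc m2 M M' C * dualc m1 M' A B = 0" if "M' \<in> asm_upto n" for M'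
      using cogradedD[OF cograded_dualc[OF g(2)] MA(1), of M' C]
        cogradedD[OF cograded_dualc[OF g(1)] asm_uptoD(1)[OF that], of A B] False MA(2) by fastforce
    moreover have "dualc m4 M A M' * dualc m3 M' B C = 0" if "M' \<in> asm_upto n" for M'
      using cogradedD[OF cograded_dualc[OF g(4)] MA(1), of A M']
        cogradedD[OF cograded_dualc[OF g(3)] asm_uptoD(1)[OF that], of B C] False MA(2) by fastforce
    ultimately show ?thesis by simp
  qed
  show "(\<Sum>M'\<in>asm_upto n. rdualc m2 M M' C * rdualc m1 M' A B) = (\<Sum>M'\<in>asm_upto n. rdualc m4 M A M' * rdualc m3 M' B C)"
  proof (cases "A = e0 \<or> B = e0 \<or> C = e0")
    case True
    then show ?thesis by (auto simp: rdualc_def)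
  next
    case False
    \<comment> \<open>The empty matrix only splits into empty ones. So if \<open>A\<close>,
      \<open>B\<close>, \<open>C\<close> are nonempty, an intermediate factor \<open>e0\<close>
      contributes nothing, and reduction changes no summand.\<close>
    have z: "dualc m e0 X Y = 0" if "X \<noteq> e0 \<or> Y \<noteq> e0" "graded m" for X Y and m :: "mat \<Rightarrow> mat \<Rightarrow> mat \<Rightarrow> 'k"
      using that cogradedD[OF cograded_dualc[OF that(2)] e0_asm, of X Y] asm_mats_size_0_iff by fastforce
    have "rdualc m2 M M' C * rdualc m1 M' A B = dualc m2 M M' C * dualc m1 M' A B"
      "rdualc m4 M A M' * rdualc m3 M' B C = dualc m4 M A M' * dualc m3 M' B C" for M'
      using False z[of A B m1] z[of B C m3] g by (cases "M' = e0"; simp add: rdualc_def)+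
    then show ?thesis using * by simp
  qed
qed

section \<open>Hopf algebra axioms and self-duality\<close>

lemma fspace_bound2:
  assumes "v \<in> fspace asm_mats" "w \<in> fspace asm_mats"
  obtains n where "supp v \<subseteq> asm_upto n" "supp w \<subseteq> asm_upto n"
  by (rule fspace_bound3[OF assms assms(2)]) (rule that)

lemma shc_subset:
  assumes "A \<in> asm_mats" "B \<in> asm_mats"
  shows "shc A B \<subseteq> asm_upto (fst A + fst B)"
proof
  fix M assume "M \<in> shc A B"
  then show "M \<in> asm_upto (fst A + fst B)"
    using shc_asm[OF assms, of M] fst_shc[of M A B] by (simp add: asm_upto_def)
qed

lemma shc_finite: "A \<in> asm_mats \<Longrightarrow> B \<in> asm_mats \<Longrightarrow> finite (shc A B)"
  by (rule finite_subset[OF shc_subset]) simp_all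

lemma splits_subset:
  assumes "M \<in> asm_mats"
  shows "splits M \<subseteq> asm_upto (fst M) \<times> asm_upto (fst M)"
proof
  fix p assume p: "p \<in> splits M"
  obtain A B where AB: "p = (A, B)" by (cases p)
  then have "copc M A B \<noteq> (0 :: int)" using p by (simp add: copc_def)
  from cogradedD[OF cograded_coeffs(1) assms this]
  show "p \<in> asm_upto (fst M) \<times> asm_upto (fst M)" by (simp add: asm_upto_def AB)
qed

lemma splits_finite: "M \<in> asm_mats \<Longrightarrow> finite (splits M)"
  by (rule finite_subset[OF splits_subset]) simp_all

lemma card_snd_compress:
  assumes "finite T"
  shows "card (snd (compress T)) = card T"
proof -
  have "inj_on (rnk (fst ` T)) (fst ` T)" "inj_on (rnk (snd ` T)) (snd ` T)"
    using assms by (auto intro!: strict_mono_on_imp_inj_on strict_mono_on_rnk)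
  then have "inj_on (map_prod (rnk (fst ` T)) (rnk (snd ` T))) (fst ` T \<times> snd ` T)"
    by (rule map_prod_inj_on)
  then have "inj_on (map_prod (rnk (fst ` T)) (rnk (snd ` T))) T"
    by (rule inj_on_subset) (rule subset_fst_snd)
  then show ?thesis by (simp add: compress_eq card_image)
qed

text \<open>The two blocks of the cut partition the nonzero positions, and compression keeps their
  number.\<close>

lemma card_snd_shc:
  assumes "A \<in> asm_mats" "B \<in> asm_mats" "M \<in> shc A B"
  shows "card (snd M) = card (snd A) + card (snd B)"
proof -
  have M: "M \<in> asm_mats" "A = compress (upper (fst A) (snd M))" "B = compress (lower (fst A) (snd M))"
    using assms by (auto simp: shc_iff cut_def)
  have fin: "finite (upper (fst A) (snd M))" "finite (lower (fst A) (snd M))"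
    using asm_matsD(2)[OF M(1)] by (auto simp: upper_def lower_def)
  have "card (snd A) = card (upper (fst A) (snd M))"
    using card_snd_compress[OF fin(1)] M(2) by simp
  moreover have "card (snd B) = card (lower (fst A) (snd M))"
    using card_snd_compress[OF fin(2)] M(3) by simp
  moreover have "upper (fst A) (snd M) \<inter> lower (fst A) (snd M) = {}"
    by (auto simp: upper_def lower_def)
  ultimately show ?thesis
    using card_Un_disjoint[OF fin] by (simp add: upper_Un_lower)
qed

lemma card_snd_mat_transp [simp]: "card (snd (mat_transp M)) = card (snd M)"
  by (simp add: snd_mat_transp card_inverse)

lemma size_splits:
  assumes "M \<in> asm_mats" "(A, B) \<in> splits M"
  shows "fst A + fst B = fst M" "card (snd A) + card (snd B) = card (snd M)"
  using assms fst_shc[of "mat_transp M" "mat_transp A" "mat_transp B"] card_snd_shc[of "mat_transp A" "mat_transp B" "mat_transp M"]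
  by (simp_all add: splits_iff_shc)

lemma bigraded_connected_asm: "bigraded_connected asm_mats"
  unfolding bigraded_connected_def
proof (intro conjI ballI allI)
  fix A B M assume "A \<in> asm_mats" "B \<in> asm_mats" "M \<in> shc A B"
  then show "fst M = fst A + fst B" "card (snd M) = card (snd A) + card (snd B)"
    using fst_shc card_snd_shc by blast+
next
  fix M p assume "M \<in> asm_mats" "p \<in> splits M"
  then show "case p of (A, B) \<Rightarrow> fst A + fst B = fst M \<and> card (snd A) + card (snd B) = card (snd M)"
    using size_splits[of M] by (cases p) blast
next
  fix n k
  have "{M \<in> asm_mats. fst M = n \<and> card (snd M) = k} \<subseteq> asm_upto n" by (auto simp: asm_upto_def)
  then show "finite {M \<in> asm_mats. fst M = n \<and> card (snd M) = k}"
    by (rule finite_subset) simp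
next
  show "{M \<in> asm_mats. fst M = 0} = {e0}"
    using asm_mats_size_0_iff by (metis (mono_tags, lifting) Collect_cong e0_asm fst_e0 singleton_conv)
qed

lemma supp_basis [simp]: "supp (basis M :: mat \<Rightarrow> 'k::comm_ring_1) = {M}"
  by (auto simp: supp_def basis_def)

lemma basis_self [simp]: "basis M M = (1 :: 'k::comm_ring_1)"
  by (simp add: basis_def)

lemma basis_fspace: "M \<in> asm_mats \<Longrightarrow> (basis M :: mat \<Rightarrow> 'k::comm_ring_1) \<in> fspace asm_mats"
  by (simp add: fspace_def)

text \<open>The pairing of \<open>A\<close> and \<open>B\<close> is 1 if they are transposes of each
  other and 0 otherwise. In both compatibility conditions every sum then has at most one nonzero
  term, and the two sides ask the same membership question by \<open>splits_iff_shc\<close>. A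
  coefficient \<open>v A\<close> is detected by pairing with the transpose of \<open>A\<close>,
  which gives nondegeneracy.\<close>

lemma self_dual_asm: "self_dual (fspace asm_mats :: ('k::comm_ring_1) vec set) asm_mats"
  unfolding self_dual_def
proof (intro exI[of _ "\<lambda>A B. if A = mat_transp B then 1 else 0"] conjI ballI impI)
  let ?P = "\<lambda>A B. if A = mat_transp B then 1 else (0 :: 'k)"
  fix A B assume "A \<in> asm_mats" "B \<in> asm_mats"
  show "fst A = fst B" "card (snd A) = card (snd B)" if "?P A B \<noteq> 0"
    using that by (auto split: if_splits)
next
  let ?P = "\<lambda>A B. if A = mat_transp B then 1 else (0 :: 'k)"
  fix v :: "'k vec" assume v: "v \<in> fspace asm_mats" "v \<noteq> (\<lambda>_. 0)"
  then obtain A where A: "v A \<noteq> 0" by blast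
  then have AA: "A \<in> supp v" "A \<in> asm_mats" using v by (auto simp: fspace_def supp_def)
  have "pairing ?P v (basis (mat_transp A)) = (\<Sum>B\<in>supp v. if B = A then v B else 0)"
    unfolding pairing_def supp_basis by (intro sum.cong) (simp_all add: basis_def)
  also have "\<dots> = v A" using v(1) AA by (simp add: fspace_def)
  finally show "\<exists>w\<in>fspace asm_mats. pairing ?P v w \<noteq> 0"
    using A AA by (intro bexI[of _ "basis (mat_transp A)"]) (simp_all add: basis_fspace)
next
  let ?P = "\<lambda>A B. if A = mat_transp B then 1 else (0 :: 'k)"
  fix A B C assume ABC: "A \<in> asm_mats" "B \<in> asm_mats" "C \<in> asm_mats"
  have "(\<Sum>(C1, C2)\<in>splits C. ?P A C1 * ?P B C2) = (\<Sum>p\<in>splits C. if p = (mat_transp A, mat_transp B) then 1 else 0)"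
    by (rule sum.cong) (auto simp: split_def)
  also have "\<dots> = (if mat_transp C \<in> shc A B then 1 else 0)"
    using ABC splits_finite[OF ABC(3)] by (simp add: splits_iff_shc)
  finally show "(\<Sum>M\<in>shc A B. ?P M C) = (\<Sum>(C1, C2)\<in>splits C. ?P A C1 * ?P B C2)"
    using shc_finite[OF ABC(1,2)] by simp
next
  let ?P = "\<lambda>A B. if A = mat_transp B then 1 else (0 :: 'k)"
  fix A B C assume ABC: "A \<in> asm_mats" "B \<in> asm_mats" "C \<in> asm_mats"
  have "(\<Sum>(A1, A2)\<in>splits A. ?P A1 B * ?P A2 C) = (\<Sum>p\<in>splits A. if p = (mat_transp B, mat_transp C) then 1 else 0)"
    by (rule sum.cong) (auto simp: split_def)
  also have "\<dots> = (if mat_transp A \<in> shc B C then 1 else 0)"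
    using ABC splits_finite[OF ABC(1)] by (simp add: splits_iff_shc)
  also have "\<dots> = (\<Sum>M\<in>shc B C. if M = mat_transp A then 1 else 0)"
    using shc_finite[OF ABC(2,3)] by simp
  also have "\<dots> = (\<Sum>M\<in>shc B C. ?P A M)"
    by (rule sum.cong) auto
  finally show "(\<Sum>M\<in>shc B C. ?P A M) = (\<Sum>(A1, A2)\<in>splits A. ?P A1 B * ?P A2 C)" ..
next
  fix C show "(if e0 = mat_transp C then 1 else 0) = (if C = e0 then 1 else (0 :: 'k))"
    "(if C = mat_transp e0 then 1 else 0) = (if C = e0 then 1 else (0 :: 'k))"
    using mat_transp_eq_e0_iff[of C] by (auto simp: eq_commute[of e0])
qed

lemma bil_fspace:
  assumes "v \<in> fspace asm_mats" "w \<in> fspace asm_mats" "graded m"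
  shows "bil m v w \<in> fspace asm_mats"
proof -
  obtain n where "supp v \<subseteq> asm_upto n" "supp w \<subseteq> asm_upto n"
    using fspace_bound2[OF assms(1,2)] .
  then show ?thesis by (intro fspaceI[OF supp_bil[OF assms(3)]])
qed

lemma mult_assoc:
  assumes "u \<in> fspace asm_mats" "v \<in> fspace asm_mats" "w \<in> fspace asm_mats"
  shows "mult (mult u v) w = mult u (mult v w)"
proof -
  obtain n where n: "supp u \<subseteq> asm_upto n" "supp v \<subseteq> asm_upto n" "supp w \<subseteq> asm_upto n"
    using fspace_bound3[OF assms] .
  show ?thesis unfolding mult_def
  proof (rule bil_bil[OF graded_coeffs(1) graded_coeffs(1) n])
    fix A B C M assume "A \<in> asm_upto n" "B \<in> asm_upto n" "C \<in> asm_upto n"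
    then show "(\<Sum>M'\<in>asm_upto (3 * n). multc A B M' * multc M' C M)
        = (\<Sum>M'\<in>asm_upto (3 * n). multc B C M' * (multc A M' M :: 'a))"
      by (intro dendriform_sums) (auto simp: asm_upto_def)
  qed
qed

lemma mult_unit:
  assumes "v \<in> fspace asm_mats"
  shows "mult (basis e0) v = v" "mult v (basis e0) = v"
proof -
  have fin: "finite (supp v)" and sub: "supp v \<subseteq> asm_mats" using assms by (auto simp: fspace_def)
  show "mult (basis e0) v = v"
  proof
    fix M
    have "mult (basis e0) v M = (\<Sum>B\<in>supp v. v B * multc e0 B M)"
      by (simp add: mult_def bil_def)
    also have "\<dots> = (\<Sum>B\<in>supp v. if M = B then v B else 0)"
      by (intro sum.cong refl) (simp add: multc_e0 subsetD[OF sub])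
    also have "\<dots> = v M" using fin by (simp add: supp_def)
    finally show "mult (basis e0) v M = v M" .
  qed
  show "mult v (basis e0) = v"
  proof
    fix M
    have "mult v (basis e0) M = (\<Sum>B\<in>supp v. v B * multc B e0 M)"
      by (simp add: mult_def bil_def)
    also have "\<dots> = (\<Sum>B\<in>supp v. if M = B then v B else 0)"
      by (intro sum.cong refl) (simp add: multc_e0 subsetD[OF sub])
    also have "\<dots> = v M" using fin by (simp add: supp_def)
    finally show "mult v (basis e0) M = v M" .
  qed
qed

lemma copc_e0:
  assumes "M \<in> asm_mats"
  shows "copc M e0 B = (if M = B then 1 else 0)" "copc M A e0 = (if M = A then 1 else 0)"
    "copc e0 A B = (if A = e0 \<and> B = e0 then 1 else 0)"
  using assms by (auto simp: copc_eq_dualc dualc_def multc_e0)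

lemma cop_counit:
  assumes "v \<in> fspace asm_mats"
  shows "(\<lambda>B. cop v (e0, B)) = v" "(\<lambda>A. cop v (A, e0)) = v"
proof -
  have fin: "finite (supp v)" and sub: "supp v \<subseteq> asm_mats" using assms by (auto simp: fspace_def)
  have "cop v (e0, B) = (\<Sum>M\<in>supp v. if B = M then v M else 0)" for B
    unfolding cop_def cobil_def split_conv by (intro sum.cong refl) (auto simp: copc_e0 subsetD[OF sub])
  then show "(\<lambda>B. cop v (e0, B)) = v" using fin by (simp add: fun_eq_iff supp_def)
  have "cop v (B, e0) = (\<Sum>M\<in>supp v. if B = M then v M else 0)" for B
    unfolding cop_def cobil_def split_conv by (intro sum.cong refl) (auto simp: copc_e0 subsetD[OF sub])
  then show "(\<lambda>A. cop v (A, e0)) = v" using fin by (simp add: fun_eq_iff supp_def)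
qed

lemma coL_cobil_eq_coR_cobil:
  assumes x: "x \<in> fspace asm_mats" and g: "cograded d2" "cograded d4"
    and H: "\<And>n M A B C. M \<in> asm_upto n \<Longrightarrow> x M \<noteq> 0 \<Longrightarrow>
      (\<Sum>M'\<in>asm_upto n. d2 M M' C * d1 M' A B) = (\<Sum>M'\<in>asm_upto n. d4 M A M' * d3 M' B C)"
  shows "coL d1 (cobil d2 x) = coR d3 (cobil d4 x)"
proof
  fix p :: "mat \<times> mat \<times> mat"
  obtain A B C where p: "p = (A, B, C)" by (cases p)
  obtain n where n: "supp x \<subseteq> asm_upto n" using fspace_bound[OF x] .
  have "(\<Sum>M\<in>asm_upto n. x M * (\<Sum>M'\<in>asm_upto n. d2 M M' C * d1 M' A B))
      = (\<Sum>M\<in>asm_upto n. x M * (\<Sum>M'\<in>asm_upto n. d4 M A M' * d3 M' B C))"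
  proof (rule sum.cong)
    fix M assume M: "M \<in> asm_upto n"
    show "x M * (\<Sum>M'\<in>asm_upto n. d2 M M' C * d1 M' A B) = x M * (\<Sum>M'\<in>asm_upto n. d4 M A M' * d3 M' B C)"
      using H[OF M, of C A B] by (cases "x M = 0") simp_all
  qed simp
  then show "coL d1 (cobil d2 x) p = coR d3 (cobil d4 x) p"
    by (simp add: p coL_cobil[OF g(1) n] coR_cobil[OF g(2) n])
qed

lemma copc_coassoc_sum:
  assumes M: "M \<in> asm_upto n"
  shows "(\<Sum>M'\<in>asm_upto n. copc M M' C * copc M' A B) = (\<Sum>M'\<in>asm_upto n. copc M A M' * (copc M' B C :: 'k::comm_ring_1))"
proof -
  have "(\<Sum>M'\<in>asm_upto n. dualc multc M M' C * dualc multc M' A B)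
      = (\<Sum>M'\<in>asm_upto n. dualc multc M A M' * (dualc multc M' B C :: 'k))"
    by (rule dualc_sums(1)[OF graded_coeffs(1) graded_coeffs(1) graded_coeffs(1) graded_coeffs(1) dendriform_sums(1) M])
  then show ?thesis
    using asm_uptoD(1)[OF M] by (simp add: copc_eq_dualc asm_uptoD cong: sum.cong)
qed

lemma cop_coassoc:
  assumes "v \<in> fspace asm_mats"
  shows "coL copc (cop v) = coR copc (cop v)"
  unfolding cop_def
  by (rule coL_cobil_eq_coR_cobil[OF assms cograded_coeffs(1) cograded_coeffs(1)]) (rule copc_coassoc_sum)

lemma cop_mult:
  assumes "v \<in> fspace asm_mats" "w \<in> fspace asm_mats"
  shows "cop (mult v w) = tbil multc multc (cop v) (cop w)"
proof
  fix p :: "mat \<times> mat"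
  obtain L R where p: "p = (L, R)" by (cases p)
  obtain n where n: "supp v \<subseteq> asm_upto n" "supp w \<subseteq> asm_upto n"
    using fspace_bound2[OF assms(1,2)] .
  show "cop (mult v w) p = tbil multc multc (cop v) (cop w) p"
    unfolding p cop_def mult_def cobil_bil[OF graded_coeffs(1) n]
      tbil_cobil[OF cograded_coeffs(1) cograded_coeffs(1) n]
    by (intro sum.cong refl arg_cong2[where f = "(*)"] compat_mult_cop) (auto simp: asm_upto_def)
qed

lemma mult_counit:
  assumes "v \<in> fspace asm_mats" "w \<in> fspace asm_mats"
  shows "mult v w e0 = v e0 * w e0"
proof -
  have fin: "finite (supp v)" "finite (supp w)" and sub: "supp v \<subseteq> asm_mats" "supp w \<subseteq> asm_mats"
    using assms by (auto simp: fspace_def)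
  have "mult v w e0 = (\<Sum>A\<in>supp v. \<Sum>B\<in>supp w. if A = e0 then if B = e0 then v A * w B else 0 else 0)"
    unfolding mult_def bil_def
    by (intro sum.cong refl) (simp add: multc_e0 subsetD[OF sub(1)] subsetD[OF sub(2)])
  also have "\<dots> = (\<Sum>A\<in>supp v. if A = e0 then (\<Sum>B\<in>supp w. if B = e0 then v A * w B else 0) else 0)"
    by (intro sum.cong refl) simp
  also have "\<dots> = v e0 * w e0" using fin by (simp add: supp_def)
  finally show ?thesis .
qed

lemma cop_unit: "cop (basis e0 :: 'k::comm_ring_1 vec) = tens (basis e0) (basis e0)"
proof
  fix p :: "mat \<times> mat"
  have "cop (basis e0 :: 'k vec) p = copc e0 (fst p) (snd p)" by (simp add: cop_def cobil_def split_def)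
  also have "\<dots> = tens (basis e0) (basis e0) p" by (simp add: copc_e0(3)[OF e0_asm] tens_def basis_def split_def)
  finally show "cop (basis e0 :: 'k vec) p = tens (basis e0) (basis e0) p" .
qed

text \<open>Presents tensors with a unit as values of \<open>cobil\<close>, so that
  \<open>tbil_cobil\<close> applies to every summand of the compatibility relations.\<close>

lemma tens_eq_cobil:
  assumes "b \<in> fspace asm_mats"
  shows "tens (basis e0) b = cobil iL b" "tens b (basis e0) = cobil iR b"
proof -
  have fin: "finite (supp b)" using assms by (auto simp: fspace_def)
  have "cobil iL b (A, B) = (if A = e0 then (\<Sum>M\<in>supp b. if B = M then b M else 0) else 0)" for A B
    by (auto simp: cobil_def iL_def intro!: sum.cong)
  then have "cobil iL b (A, B) = tens (basis e0) b (A, B)" for A B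
    using fin by (simp add: tens_def basis_def supp_def)
  then show "tens (basis e0) b = cobil iL b" by (simp add: fun_eq_iff)
  have "cobil iR b (A, B) = (if B = e0 then (\<Sum>M\<in>supp b. if A = M then b M else 0) else 0)" for A B
    by (auto simp: cobil_def iR_def intro!: sum.cong)
  then have "cobil iR b (A, B) = tens b (basis e0) (A, B)" for A B
    using fin by (simp add: tens_def basis_def supp_def)
  then show "tens b (basis e0) = cobil iR b" by (simp add: fun_eq_iff)
qed

lemma tens_on:
  fixes a b :: "'k::comm_ring_1 vec"
  assumes "finite P" "supp a \<subseteq> P" "supp b \<subseteq> P"
  shows "tens a b (L, R) = (\<Sum>A\<in>P. \<Sum>B\<in>P. a A * b B * (if L = A \<and> R = B then 1 else 0))"
    "tens b a (L, R) = (\<Sum>A\<in>P. \<Sum>B\<in>P. a A * b B * (if L = B \<and> R = A then 1 else 0))"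
proof -
  have z: "a x = 0" "b x = 0" if "x \<notin> P" for x using that assms by (auto simp: supp_def)
  have "(\<Sum>A\<in>P. \<Sum>B\<in>P. a A * b B * (if L = A \<and> R = B then 1 else 0))
      = (\<Sum>A\<in>P. if L = A then (\<Sum>B\<in>P. if R = B then a A * b B else 0) else 0)"
    by (rule sum.cong) (auto intro!: sum.cong)
  then show "tens a b (L, R) = (\<Sum>A\<in>P. \<Sum>B\<in>P. a A * b B * (if L = A \<and> R = B then 1 else 0))"
    using assms(1) z by (simp add: tens_def)
  have "(\<Sum>A\<in>P. \<Sum>B\<in>P. a A * b B * (if L = B \<and> R = A then 1 else 0))
      = (\<Sum>A\<in>P. if R = A then (\<Sum>B\<in>P. if L = B then a A * b B else 0) else 0)"
    by (rule sum.cong) (auto intro!: sum.cong)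
  then show "tens b a (L, R) = (\<Sum>A\<in>P. \<Sum>B\<in>P. a A * b B * (if L = B \<and> R = A then 1 else 0))"
    using assms(1) z by (simp add: tens_def mult.commute)
qed

section \<open>Bidendriform structure and antipode\<close>

lemma rdualc_ltc_plus_gtc:
  assumes "M \<noteq> e0"
  shows "rdualc ltc M A B + rdualc gtc M A B = rdualc multc M A B"
  using assms by (simp add: rdualc_def dualc_def ltc_plus_gtc)

lemma dendriform_asm:
  assumes "x \<in> fspace asm_mats" "y \<in> fspace asm_mats" "z \<in> fspace asm_mats"
  shows "bil ltc (bil ltc x y) z = bil ltc x (mult y z)"
    "bil ltc (bil gtc x y) z = bil gtc x (bil ltc y z)"
    "bil gtc (mult x y) z = bil gtc x (bil gtc y z)"
proof -
  obtain n where n: "supp x \<subseteq> asm_upto n" "supp y \<subseteq> asm_upto n" "supp z \<subseteq> asm_upto n"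
    using fspace_bound3[OF assms] .
  show "bil ltc (bil ltc x y) z = bil ltc x (mult y z)"
    unfolding mult_def
    by (rule bil_bil[OF graded_coeffs(2) graded_coeffs(1) n], rule dendriform_sums) (auto simp: asm_upto_def)
  show "bil ltc (bil gtc x y) z = bil gtc x (bil ltc y z)"
    by (rule bil_bil[OF graded_coeffs(3) graded_coeffs(2) n], rule dendriform_sums) (auto simp: asm_upto_def)
  show "bil gtc (mult x y) z = bil gtc x (bil gtc y z)"
    unfolding mult_def
    by (rule bil_bil[OF graded_coeffs(1) graded_coeffs(3) n], rule dendriform_sums) (auto simp: asm_upto_def)
qed

text \<open>The two forms of the reduced coproduct can differ only at \<open>e0\<close>, where the
  first factor is zero.\<close>

lemma rdualc_rcopc:
  assumes "M' \<in> asm_mats"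
  shows "rdualc m M A M' * rcopc M' B C = rdualc m M A M' * rdualc multc M' B C"
    "rdualc m M M' C * rcopc M' A B = rdualc m M M' C * rdualc multc M' A B"
  using assms by (cases "M' = e0"; simp add: rcopc_eq_rdualc)+

text \<open>The transposes of the three dendriform relations, in the same order.\<close>

lemma codendriform_asm:
  assumes x: "x \<in> fspace asm_mats"
  shows "coL (rdualc ltc) (cobil (rdualc ltc) x) = coR rcopc (cobil (rdualc ltc) x)"
    "coL (rdualc gtc) (cobil (rdualc ltc) x) = coR (rdualc ltc) (cobil (rdualc gtc) x)"
    "coL rcopc (cobil (rdualc gtc) x) = coR (rdualc gtc) (cobil (rdualc gtc) x)"
proof -
  note g = graded_coeffs
  note cg = cograded_rdualc[OF graded_coeffs(2)] cograded_rdualc[OF graded_coeffs(3)]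
  show "coL (rdualc ltc) (cobil (rdualc ltc) x) = coR rcopc (cobil (rdualc ltc) x)"
  proof (rule coL_cobil_eq_coR_cobil[OF x cg(1) cg(1)])
    fix n M A B C assume "M \<in> asm_upto n"
    from dualc_sums(2)[OF g(2) g(2) g(1) g(2) dendriform_sums(2) this, of C A B]
    show "(\<Sum>M'\<in>asm_upto n. rdualc ltc M M' C * rdualc ltc M' A B) = (\<Sum>M'\<in>asm_upto n. rdualc ltc M A M' * rcopc M' B C :: 'a)"
      by (simp add: rdualc_rcopc asm_uptoD cong: sum.cong)
  qed
  show "coL (rdualc gtc) (cobil (rdualc ltc) x) = coR (rdualc ltc) (cobil (rdualc gtc) x)"
    by (rule coL_cobil_eq_coR_cobil[OF x cg], rule dualc_sums(2)[OF g(3) g(2) g(2) g(3) dendriform_sums(3)])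
  show "coL rcopc (cobil (rdualc gtc) x) = coR (rdualc gtc) (cobil (rdualc gtc) x)"
  proof (rule coL_cobil_eq_coR_cobil[OF x cg(2) cg(2)])
    fix n M A B C assume "M \<in> asm_upto n"
    from dualc_sums(2)[OF g(1) g(3) g(3) g(3) dendriform_sums(4) this, of C A B]
    show "(\<Sum>M'\<in>asm_upto n. rdualc gtc M M' C * rcopc M' A B) = (\<Sum>M'\<in>asm_upto n. rdualc gtc M A M' * rdualc gtc M' B C :: 'a)"
      by (simp add: rdualc_rcopc asm_uptoD cong: sum.cong)
  qed
qed

lemma bidendriform_compat:
  fixes a b :: "'k::comm_ring_1 vec"
  assumes a: "a \<in> fspace asm_mats" "a e0 = 0" and b: "b \<in> fspace asm_mats" "b e0 = 0"
  shows "cobil (rdualc gtc) (bil gtc a b) = (\<lambda>p.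
              tbil multc gtc (redcop a) (cobil (rdualc gtc) b) p
            + tbil multc gtc (redcop a) (tens (basis e0) b) p
            + tbil multc gtc (tens (basis e0) a) (cobil (rdualc gtc) b) p
            + tbil multc multc (tens a (basis e0)) (cobil (rdualc gtc) b) p
            + tens a b p)" (is ?th1)
    and "cobil (rdualc gtc) (bil ltc a b) = (\<lambda>p.
              tbil multc ltc (redcop a) (cobil (rdualc gtc) b) p
            + tbil multc ltc (redcop a) (tens (basis e0) b) p
            + tbil multc ltc (tens (basis e0) a) (cobil (rdualc gtc) b) p)" (is ?th2)
    and "cobil (rdualc ltc) (bil gtc a b) = (\<lambda>p.
              tbil multc gtc (redcop a) (cobil (rdualc ltc) b) p
            + tbil multc multc (tens a (basis e0)) (cobil (rdualc ltc) b) p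
            + tbil multc gtc (tens (basis e0) a) (cobil (rdualc ltc) b) p)" (is ?th3)
    and "cobil (rdualc ltc) (bil ltc a b) = (\<lambda>p.
              tbil multc ltc (redcop a) (cobil (rdualc ltc) b) p
            + tbil multc multc (redcop a) (tens b (basis e0)) p
            + tbil multc ltc (tens (basis e0) a) (cobil (rdualc ltc) b) p
            + tens b a p)" (is ?th4)
proof -
  obtain n where n: "supp a \<subseteq> asm_upto n" "supp b \<subseteq> asm_upto n" using fspace_bound2[OF a(1) b(1)] .
  let ?P = "asm_upto n"
  note g = graded_coeffs
  note cg = cograded_rdualc[OF g(2)] cograded_rdualc[OF g(3)] cograded_coeffs(2-4)
  \<comment> \<open>Both vectors vanish at \<open>e0\<close>, so the coefficient identities are only
    needed for nonempty \<open>A\<close> and \<open>B\<close>, as \<open>bidendriform_sums\<close>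
    supplies them.\<close>
  have cong: "(\<Sum>A\<in>?P. \<Sum>B\<in>?P. a A * b B * F A B) = (\<Sum>A\<in>?P. \<Sum>B\<in>?P. a A * b B * G A B)"
    if "\<And>A B. A \<in> asm_mats \<Longrightarrow> A \<noteq> e0 \<Longrightarrow> B \<in> asm_mats \<Longrightarrow> B \<noteq> e0 \<Longrightarrow> fst A + fst B \<le> n + n \<Longrightarrow>
      fst A \<le> n \<Longrightarrow> fst B \<le> n \<Longrightarrow> F A B = G A B" for F G :: "mat \<Rightarrow> mat \<Rightarrow> 'k"
  proof (intro sum.cong refl)
    fix A B assume "A \<in> ?P" "B \<in> ?P"
    then show "a A * b B * F A B = a A * b B * G A B"
      using that[of A B] a(2) b(2) by (cases "A = e0 \<or> B = e0") (auto simp: asm_upto_def)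
  qed
  have sums: "(\<Sum>A\<in>?P. \<Sum>B\<in>?P. a A * b B * F A B) + (\<Sum>A\<in>?P. \<Sum>B\<in>?P. a A * b B * G A B)
      = (\<Sum>A\<in>?P. \<Sum>B\<in>?P. a A * b B * (F A B + G A B))" for F G :: "mat \<Rightarrow> mat \<Rightarrow> 'k"
    by (simp add: sum.distrib distrib_left)
  note expand = redcop_def tens_eq_cobil[OF a(1)] tens_eq_cobil[OF b(1)] cobil_bil[OF g(2) n] cobil_bil[OF g(3) n]
    tbil_cobil[OF cg(5) cg(2) n] tbil_cobil[OF cg(5) cg(1) n] tbil_cobil[OF cg(5) cg(3) n] tbil_cobil[OF cg(5) cg(4) n]
    tbil_cobil[OF cg(3) cg(2) n] tbil_cobil[OF cg(3) cg(1) n] tbil_cobil[OF cg(4) cg(2) n] tbil_cobil[OF cg(4) cg(1) n]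
    tens_on[OF finite_asm_upto n] sums
  show ?th1
    by (rule ext, rule prod.induct, unfold expand) (rule cong, rule bidendriform_sums)
  show ?th2
    by (rule ext, rule prod.induct, unfold expand) (rule cong, rule bidendriform_sums)
  show ?th3
    by (rule ext, rule prod.induct, unfold expand) (rule cong, rule bidendriform_sums)
  show ?th4
    by (rule ext, rule prod.induct, unfold expand) (rule cong, rule bidendriform_sums)
qed


text \<open>The half coproducts are the transposed half products with the unit terms removed: the
  label that tells where the last column comes from becomes one for the last row.\<close>

lemma bidendriform_asm:
  "bidendriform (fspace asm_mats :: 'k::comm_ring_1 vec set) asm_mats ltc gtc (rdualc ltc) (rdualc gtc)"
  unfolding bidendriform_def Let_def
proof (intro conjI ballI allI)
  fix A B assume AB: "A \<in> asm_mats - {e0}" "B \<in> asm_mats - {e0}"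
  have *: "{M. m A B M \<noteq> 0} \<subseteq> shc A B - {e0}" if "m = ltc \<or> m = gtc" for m :: "mat \<Rightarrow> mat \<Rightarrow> mat \<Rightarrow> 'k"
  proof
    fix M assume "M \<in> {M. m A B M \<noteq> 0}"
    then show "M \<in> shc A B - {e0}"
      using that by (auto simp: ltc_def gtc_def split: if_splits)
  qed
  have fin: "finite (shc A B - {e0})" using AB shc_finite by simp
  have sub: "shc A B - {e0} \<subseteq> asm_mats - {e0}" using AB shc_asm by blast
  show "finite {M. ltc A B M \<noteq> (0::'k)}" "finite {M. gtc A B M \<noteq> (0::'k)}"
    using finite_subset[OF * fin] by simp_all
  show "{M. ltc A B M \<noteq> (0::'k)} \<subseteq> asm_mats - {e0}" "{M. gtc A B M \<noteq> (0::'k)} \<subseteq> asm_mats - {e0}"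
    using *[of ltc] *[of gtc] sub by blast+
  show "ltc A B M + gtc A B M = (multc A B M :: 'k)" for M
    using AB by (cases "M = e0") (simp_all add: ltc_e0 gtc_e0 multc_e0 ltc_plus_gtc)
next
  fix M assume M: "M \<in> asm_mats - {e0}"
  have *: "{(A, B). rdualc m M A B \<noteq> 0} \<subseteq> (asm_upto (fst M) - {e0}) \<times> (asm_upto (fst M) - {e0})"
    if "graded m" for m :: "mat \<Rightarrow> mat \<Rightarrow> mat \<Rightarrow> 'k"
  proof
    fix p assume p: "p \<in> {(A, B). rdualc m M A B \<noteq> 0}"
    obtain A B where AB: "p = (A, B)" by (cases p)
    have "rdualc m M A B \<noteq> 0" using p AB by simp
    then show "p \<in> (asm_upto (fst M) - {e0}) \<times> (asm_upto (fst M) - {e0})"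
      using cogradedD[OF cograded_rdualc[OF that], of M A B] M
      by (auto simp: AB asm_upto_def rdualc_def split: if_splits)
  qed
  have fin: "finite ((asm_upto (fst M) - {e0}) \<times> (asm_upto (fst M) - {e0}))" by simp
  show "finite {(A, B). rdualc ltc M A B \<noteq> (0::'k)}" "finite {(A, B). rdualc gtc M A B \<noteq> (0::'k)}"
    by (rule finite_subset[OF *[OF graded_coeffs(2)] fin], rule finite_subset[OF *[OF graded_coeffs(3)] fin])
  have sub: "(asm_upto (fst M) - {e0}) \<times> (asm_upto (fst M) - {e0}) \<subseteq> (asm_mats - {e0}) \<times> (asm_mats - {e0})"
    unfolding asm_upto_def by blast
  show "{(A, B). rdualc ltc M A B \<noteq> (0::'k)} \<subseteq> (asm_mats - {e0}) \<times> (asm_mats - {e0})"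
    "{(A, B). rdualc gtc M A B \<noteq> (0::'k)} \<subseteq> (asm_mats - {e0}) \<times> (asm_mats - {e0})"
    by (rule subset_trans[OF *[OF graded_coeffs(2)] sub], rule subset_trans[OF *[OF graded_coeffs(3)] sub])
  show "rdualc ltc M A B + rdualc gtc M A B = (rcopc M A B :: 'k)" for A B
    using M by (simp add: rdualc_ltc_plus_gtc rcopc_eq_rdualc)
qed (blast intro: dendriform_asm codendriform_asm bidendriform_compat)+

section \<open>Convolution and the antipode\<close>

definition conv :: "(mat \<Rightarrow> 'k vec) \<Rightarrow> (mat \<Rightarrow> 'k vec) \<Rightarrow> mat \<Rightarrow> ('k::comm_ring_1) vec" where
  "conv f g A = (\<lambda>M. \<Sum>A1\<in>asm_upto (fst A). \<Sum>A2\<in>asm_upto (fst A). copc A A1 A2 * mult (f A1) (g A2) M)"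

text \<open>A map that does not raise the size. Such maps are closed under convolution, and all sums
  occurring at \<open>A\<close> stay in the window given by the size of \<open>A\<close> or twice
  that size.\<close>

definition sized :: "(mat \<Rightarrow> ('k::comm_ring_1) vec) \<Rightarrow> bool" where
  "sized f \<longleftrightarrow> (\<forall>A\<in>asm_mats. supp (f A) \<subseteq> asm_upto (fst A))"

lemma sized_fspace: "sized f \<Longrightarrow> A \<in> asm_mats \<Longrightarrow> f A \<in> fspace asm_mats"
  unfolding sized_def using fspaceI by blast

lemma copc_zero:
  "A \<in> asm_mats \<Longrightarrow> A1 \<notin> asm_upto (fst A) \<or> A2 \<notin> asm_upto (fst A) \<Longrightarrow> copc A A1 A2 = (0 :: 'a::comm_ring_1)"
proof (rule ccontr)
  assume A: "A \<in> asm_mats" "A1 \<notin> asm_upto (fst A) \<or> A2 \<notin> asm_upto (fst A)" "copc A A1 A2 \<noteq> (0::'a)"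
  from cogradedD[OF cograded_coeffs(1) A(1,3)] A(2) show False by (auto simp: asm_upto_def)
qed

lemma conv_on:
  assumes "A \<in> asm_upto n"
  shows "conv f g A M = (\<Sum>A1\<in>asm_upto n. \<Sum>A2\<in>asm_upto n. copc A A1 A2 * mult (f A1) (g A2) M)"
proof -
  have A: "A \<in> asm_mats" and sub: "asm_upto (fst A) \<subseteq> asm_upto n"
    using assms by (auto simp: asm_upto_def)
  have "conv f g A M = (\<Sum>A1\<in>asm_upto (fst A). \<Sum>A2\<in>asm_upto n. copc A A1 A2 * mult (f A1) (g A2) M)"
    unfolding conv_def using sub
    by (intro sum.cong refl sum.mono_neutral_left) (simp_all add: copc_zero[OF A])
  also have "\<dots> = (\<Sum>A1\<in>asm_upto n. \<Sum>A2\<in>asm_upto n. copc A A1 A2 * mult (f A1) (g A2) M)"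
    using sub by (intro sum.mono_neutral_left) (simp_all add: copc_zero[OF A])
  finally show ?thesis .
qed

lemma bil_sum_left:
  assumes "finite P" "finite Q" "supp w \<subseteq> Q" "\<And>i. i \<in> I \<Longrightarrow> supp (v i) \<subseteq> P"
  shows "bil c (\<lambda>M. \<Sum>i\<in>I. r i * v i M) w M = (\<Sum>i\<in>I. r i * bil c (v i) w M)"
proof -
  have "supp (\<lambda>M. \<Sum>i\<in>I. r i * v i M) \<subseteq> P"
  proof
    fix M assume "M \<in> supp (\<lambda>M. \<Sum>i\<in>I. r i * v i M)"
    then have "(\<Sum>i\<in>I. r i * v i M) \<noteq> 0" by (simp add: supp_def)
    then obtain i where "i \<in> I" "r i * v i M \<noteq> 0" by (rule sum.not_neutral_contains_not_neutral)
    then have "i \<in> I" "M \<in> supp (v i)" by (auto simp: supp_def)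
    then show "M \<in> P" using assms(4) by blast
  qed
  then have "bil c (\<lambda>M. \<Sum>i\<in>I. r i * v i M) w M = (\<Sum>A\<in>P. \<Sum>B\<in>Q. (\<Sum>i\<in>I. r i * v i A) * w B * c A B M)"
    using assms by (simp add: bil_on[of P Q])
  also have "\<dots> = (\<Sum>A\<in>P. \<Sum>B\<in>Q. \<Sum>i\<in>I. r i * (v i A * w B * c A B M))"
    by (simp add: sum_distrib_left sum_distrib_right mult_ac)
  also have "\<dots> = (\<Sum>i\<in>I. \<Sum>A\<in>P. \<Sum>B\<in>Q. r i * (v i A * w B * c A B M))"
    by (rule sum_swap3[symmetric])
  also have "\<dots> = (\<Sum>i\<in>I. r i * bil c (v i) w M)"
    using assms by (intro sum.cong refl) (simp add: bil_on[of P Q] sum_distrib_left)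
  finally show ?thesis .
qed

lemma bil_flip: "bil c v w = bil (\<lambda>A B. c B A) w v"
  unfolding bil_def by (rule ext, subst sum.swap) (simp add: mult_ac)

lemma bil_sum_right:
  assumes "finite P" "finite Q" "supp w \<subseteq> Q" "\<And>i. i \<in> I \<Longrightarrow> supp (v i) \<subseteq> P"
  shows "bil c w (\<lambda>M. \<Sum>i\<in>I. r i * v i M) M = (\<Sum>i\<in>I. r i * bil c w (v i) M)"
  using bil_sum_left[OF assms, where c = "\<lambda>A B. c B A" and r = r and M = M] by (simp add: bil_flip[of c w])

lemma conv_pairs: "conv f g A = (\<lambda>M. \<Sum>p\<in>asm_upto (fst A) \<times> asm_upto (fst A). copc A (fst p) (snd p) * mult (f (fst p)) (g (snd p)) M)"
  unfolding conv_def by (simp add: sum.cartesian_product' split_def)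

lemma supp_mult_sized:
  assumes "sized f" "sized g" "A \<in> asm_upto n" "B \<in> asm_upto n"
  shows "supp (mult (f A) (g B)) \<subseteq> asm_upto (n + n)"
proof -
  have "supp (f A) \<subseteq> asm_upto n" "supp (g B) \<subseteq> asm_upto n"
    using assms asm_upto_mono[of "fst A" n] asm_upto_mono[of "fst B" n]
    unfolding sized_def asm_upto_def[of n] by blast+
  then show ?thesis unfolding mult_def by (rule supp_bil[OF graded_coeffs(1)])
qed

lemma sized_conv:
  assumes f: "sized f" and g: "sized g"
  shows "sized (conv f g)"
  unfolding sized_def
proof (intro ballI subsetI)
  fix A M assume A: "A \<in> asm_mats" and "M \<in> supp (conv f g A)"
  then have "(\<Sum>p\<in>asm_upto (fst A) \<times> asm_upto (fst A). copc A (fst p) (snd p) * mult (f (fst p)) (g (snd p)) M) \<noteq> 0"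
    by (simp add: supp_def conv_pairs)
  then obtain p where p: "copc A (fst p) (snd p) * mult (f (fst p)) (g (snd p)) M \<noteq> 0"
    by (rule sum.not_neutral_contains_not_neutral)
  then have c: "copc A (fst p) (snd p) \<noteq> (0::'a)" and m: "mult (f (fst p)) (g (snd p)) M \<noteq> 0" by auto
  from cogradedD[OF cograded_coeffs(1) A c]
  have s: "fst p \<in> asm_mats" "snd p \<in> asm_mats" "fst (fst p) + fst (snd p) = fst A" by auto
  have "supp (mult (f (fst p)) (g (snd p))) \<subseteq> asm_upto (fst (fst p) + fst (snd p))"
    unfolding mult_def using f g s by (intro supp_bil[OF graded_coeffs(1)]) (auto simp: sized_def)
  then show "M \<in> asm_upto (fst A)" using m s by (auto simp: supp_def)
qed

text \<open>Both sides are sums of the same threefold products \<open>T A1 A2 A3\<close>, weighted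
  by an iterated coproduct of \<open>A\<close>; associativity brings the products into this form,
  coassociativity equates the weights.\<close>

lemma conv_assoc:
  assumes f: "sized f" and g: "sized g" and h: "sized h" and A: "A \<in> asm_mats"
  shows "conv (conv f g) h A = conv f (conv g h) A"
proof
  fix M
  define n where "n = fst A"
  let ?Z = "asm_upto n"
  have AZ: "A \<in> ?Z" using A by (simp add: asm_upto_def n_def)
  define T where "T A1 A2 A3 = mult (f A1) (mult (g A2) (h A3)) M" for A1 A2 A3
  have supp: "supp (k X) \<subseteq> ?Z" if "sized k" "X \<in> ?Z" for k :: "mat \<Rightarrow> 'a vec" and X
    using that asm_upto_mono[of "fst X" n] unfolding sized_def asm_upto_def[of n] by blast
  have l: "mult (conv f g X) (h A3) M = (\<Sum>A1\<in>?Z. \<Sum>A2\<in>?Z. copc X A1 A2 * T A1 A2 A3)"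
    if X: "X \<in> ?Z" "A3 \<in> ?Z" for X A3
  proof -
    have eq: "conv f g X = (\<lambda>M. \<Sum>p\<in>?Z \<times> ?Z. copc X (fst p) (snd p) * mult (f (fst p)) (g (snd p)) M)"
      by (rule ext) (simp add: conv_on[OF X(1)] sum.cartesian_product' split_def)
    have "mult (conv f g X) (h A3) M
        = (\<Sum>p\<in>?Z \<times> ?Z. copc X (fst p) (snd p) * mult (mult (f (fst p)) (g (snd p))) (h A3) M)"
      unfolding eq mult_def
      by (rule bil_sum_left[OF finite_asm_upto finite_asm_upto supp[OF h X(2)]],
          rule supp_mult_sized[OF f g, of _ n, unfolded mult_def]) (simp_all add: mem_Times_iff)
    also have "\<dots> = (\<Sum>p\<in>?Z \<times> ?Z. copc X (fst p) (snd p) * T (fst p) (snd p) A3)"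
      using X by (intro sum.cong refl) (simp add: T_def mem_Times_iff mult_assoc sized_fspace f g h asm_uptoD(1)[of _ n])
    finally show ?thesis by (simp add: sum.cartesian_product' split_def)
  qed
  have r: "mult (f A1) (conv g h X) M = (\<Sum>A2\<in>?Z. \<Sum>A3\<in>?Z. copc X A2 A3 * T A1 A2 A3)"
    if X: "X \<in> ?Z" "A1 \<in> ?Z" for X A1
  proof -
    have eq: "conv g h X = (\<lambda>M. \<Sum>p\<in>?Z \<times> ?Z. copc X (fst p) (snd p) * mult (g (fst p)) (h (snd p)) M)"
      by (rule ext) (simp add: conv_on[OF X(1)] sum.cartesian_product' split_def)
    have "mult (f A1) (conv g h X) M
        = (\<Sum>p\<in>?Z \<times> ?Z. copc X (fst p) (snd p) * mult (f A1) (mult (g (fst p)) (h (snd p))) M)"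
      unfolding eq mult_def
      by (rule bil_sum_right[OF finite_asm_upto finite_asm_upto supp[OF f X(2)]],
          rule supp_mult_sized[OF g h, of _ n, unfolded mult_def]) (simp_all add: mem_Times_iff)
    then show ?thesis by (simp add: sum.cartesian_product' split_def T_def)
  qed
  have "conv (conv f g) h A M = (\<Sum>X\<in>?Z. \<Sum>A3\<in>?Z. copc A X A3 * (\<Sum>A1\<in>?Z. \<Sum>A2\<in>?Z. copc X A1 A2 * T A1 A2 A3))"
    unfolding conv_on[OF AZ] by (intro sum.cong refl) (simp add: l)
  also have "\<dots> = (\<Sum>X\<in>?Z. \<Sum>A3\<in>?Z. \<Sum>A1\<in>?Z. \<Sum>A2\<in>?Z. copc A X A3 * copc X A1 A2 * T A1 A2 A3)"
    by (simp add: sum_distrib_left mult.assoc)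
  also have "\<dots> = (\<Sum>A3\<in>?Z. \<Sum>A1\<in>?Z. \<Sum>A2\<in>?Z. \<Sum>X\<in>?Z. copc A X A3 * copc X A1 A2 * T A1 A2 A3)"
    by (subst sum.swap) (intro sum.cong refl sum_swap3)
  also have "\<dots> = (\<Sum>A1\<in>?Z. \<Sum>A2\<in>?Z. \<Sum>A3\<in>?Z. (\<Sum>X\<in>?Z. copc A X A3 * copc X A1 A2) * T A1 A2 A3)"
    by (subst sum_swap3) (simp add: sum_distrib_right)
  also have "\<dots> = (\<Sum>A1\<in>?Z. \<Sum>A2\<in>?Z. \<Sum>A3\<in>?Z. (\<Sum>X\<in>?Z. copc A A1 X * copc X A2 A3) * T A1 A2 A3)"
    by (intro sum.cong refl arg_cong2[where f = "(*)"] copc_coassoc_sum AZ)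
  also have "\<dots> = (\<Sum>A1\<in>?Z. \<Sum>A2\<in>?Z. \<Sum>A3\<in>?Z. \<Sum>X\<in>?Z. copc A A1 X * copc X A2 A3 * T A1 A2 A3)"
    by (simp add: sum_distrib_right)
  also have "\<dots> = (\<Sum>A1\<in>?Z. \<Sum>X\<in>?Z. \<Sum>A2\<in>?Z. \<Sum>A3\<in>?Z. copc A A1 X * copc X A2 A3 * T A1 A2 A3)"
    by (intro sum.cong refl sum_swap3[symmetric])
  also have "\<dots> = (\<Sum>A1\<in>?Z. \<Sum>X\<in>?Z. copc A A1 X * (\<Sum>A2\<in>?Z. \<Sum>A3\<in>?Z. copc X A2 A3 * T A1 A2 A3))"
    by (simp add: sum_distrib_left mult.assoc)
  also have "\<dots> = conv f (conv g h) A M"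
    unfolding conv_on[OF AZ] by (intro sum.cong refl) (simp add: r)
  finally show "conv (conv f g) h A M = conv f (conv g h) A M" .
qed


text \<open>The counit followed by the unit, which is neutral for convolution. The map
  \<open>conv_aug\<close> is the identity minus it, that is, the projection onto the augmentation
  ideal.\<close>

definition conv_unit :: "mat \<Rightarrow> ('k::comm_ring_1) vec" where
  "conv_unit A = (if A = e0 then basis e0 else (\<lambda>_. 0))"

definition conv_aug :: "mat \<Rightarrow> ('k::comm_ring_1) vec" where
  "conv_aug A = (if A = e0 then (\<lambda>_. 0) else basis A)"

lemma supp_zero [simp]: "supp (\<lambda>_. 0) = {}"
  by (simp add: supp_def)

lemma bil_zero [simp]: "bil c (\<lambda>_. 0) v = (\<lambda>_. 0)" "bil c v (\<lambda>_. 0) = (\<lambda>_. 0)"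
  by (simp_all add: bil_def fun_eq_iff)

lemma sized_units: "sized conv_unit" "sized conv_aug" "sized basis"
  by (auto simp: sized_def conv_unit_def conv_aug_def asm_upto_def)

lemma conv_unit_neutral:
  assumes "sized f" "A \<in> asm_mats"
  shows "conv conv_unit f A = f A" "conv f conv_unit A = f A"
proof -
  let ?Z = "asm_upto (fst A)"
  have Z: "A \<in> ?Z" "e0 \<in> ?Z" using assms by (simp_all add: asm_upto_def)
  have u: "mult (basis e0) (f A) = f A" "mult (f A) (basis e0) = f A"
    using mult_unit[OF sized_fspace[OF assms]] by auto
  show "conv conv_unit f A = f A"
  proof
    fix M
    have "conv conv_unit f A M = (\<Sum>A1\<in>?Z. \<Sum>A2\<in>?Z. if A2 = A then if A1 = e0 then f A M else 0 else 0)"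
      unfolding conv_def
      by (intro sum.cong refl) (use assms(2) u in \<open>auto simp: conv_unit_def mult_def copc_e0\<close>)
    then show "conv conv_unit f A M = f A M" using Z by simp
  qed
  show "conv f conv_unit A = f A"
  proof
    fix M
    have "conv f conv_unit A M = (\<Sum>A1\<in>?Z. \<Sum>A2\<in>?Z. if A2 = e0 then if A1 = A then f A M else 0 else 0)"
      unfolding conv_def
      by (intro sum.cong refl) (use assms(2) u in \<open>auto simp: conv_unit_def mult_def copc_e0\<close>)
    then show "conv f conv_unit A M = f A M" using Z by simp
  qed
qed

lemma conv_cong:
  "(\<And>B. B \<in> asm_mats \<Longrightarrow> f B = f' B) \<Longrightarrow> (\<And>B. B \<in> asm_mats \<Longrightarrow> g B = g' B) \<Longrightarrow> conv f g A = conv f' g' A"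
  unfolding conv_def by (intro ext sum.cong refl) (simp add: asm_upto_def)

primrec aug_pow :: "nat \<Rightarrow> mat \<Rightarrow> ('k::comm_ring_1) vec" where
  "aug_pow 0 = conv_unit"
| "aug_pow (Suc k) = conv conv_aug (aug_pow k)"

lemma sized_aug_pow: "sized (aug_pow k)"
  by (induction k) (simp_all add: sized_units sized_conv)

text \<open>Powers are built by multiplying on the left; the version on the right is needed for the
  other one-sided inverse property of the antipode.\<close>

lemma aug_pow_Suc_right: "A \<in> asm_mats \<Longrightarrow> conv (aug_pow k) conv_aug A = (aug_pow (Suc k) A :: ('k::comm_ring_1) vec)"
proof (induction k arbitrary: A)
  case 0
  then show ?case by (simp add: conv_unit_neutral sized_units)
next
  case (Suc k)
  have "conv (aug_pow (Suc k)) conv_aug A = (conv conv_aug (conv (aug_pow k) conv_aug) A :: 'k vec)"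
    using Suc.prems by (simp add: conv_assoc sized_units sized_aug_pow)
  also have "\<dots> = conv conv_aug (aug_pow (Suc k)) A"
    by (rule conv_cong) (simp_all only: Suc.IH)
  finally show ?case by simp
qed

text \<open>Every factor \<open>conv_aug\<close> consumes a nonempty part of \<open>A\<close>, hence
  at least one row, and \<open>A\<close> has fewer than \<open>k\<close> rows to give.\<close>

lemma aug_pow_zero: "A \<in> asm_mats \<Longrightarrow> fst A < k \<Longrightarrow> aug_pow k A = (\<lambda>_. 0)"
proof (induction k arbitrary: A)
  case (Suc k)
  have "copc A A1 A2 * mult (conv_aug A1) (aug_pow k A2) M = (0 :: 'a)" for A1 A2 M
  proof (cases "copc A A1 A2 = (0 :: 'a) \<or> A1 = e0")
    case True
    then show ?thesis by (auto simp: conv_aug_def mult_def)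
  next
    case False
    then have c: "A1 \<in> asm_mats" "A2 \<in> asm_mats" "fst A1 + fst A2 = fst A" "A1 \<noteq> e0"
      using cogradedD[OF cograded_coeffs(1) Suc.prems(1)] by blast+
    then have "fst A1 \<noteq> 0" using asm_mats_size_0_iff by blast
    then have "fst A2 < k" using c Suc.prems(2) by linarith
    then show ?thesis using Suc.IH c by (simp add: mult_def)
  qed
  then show ?case by (simp add: conv_def)
qed simp

text \<open>Takeuchi's formula; the terms with \<open>k > fst A\<close> vanish.\<close>

definition antipode :: "mat \<Rightarrow> ('k::comm_ring_1) vec" where
  "antipode A = (\<lambda>M. \<Sum>k\<le>fst A. (-1) ^ k * aug_pow k A M)"

text \<open>The truncation may be raised, so that all parts of a coproduct can use one common
  bound.\<close>

lemma antipode_on: "A \<in> asm_upto n \<Longrightarrow> antipode A = (\<lambda>M. \<Sum>k\<le>n. (-1) ^ k * aug_pow k A M)"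
  unfolding antipode_def asm_upto_def
  by (rule ext, rule sum.mono_neutral_left) (auto simp: aug_pow_zero)

lemma sized_antipode: "sized (antipode :: mat \<Rightarrow> ('k::comm_ring_1) vec)"
  unfolding sized_def
proof (intro ballI subsetI)
  fix A M assume A: "A \<in> asm_mats" and "M \<in> supp (antipode A :: 'k vec)"
  then have "(\<Sum>k\<le>fst A. (-1) ^ k * aug_pow k A M) \<noteq> (0 :: 'k)" by (simp add: supp_def antipode_def)
  then obtain k where "(-1) ^ k * aug_pow k A M \<noteq> (0 :: 'k)" by (rule sum.not_neutral_contains_not_neutral)
  then have "M \<in> supp (aug_pow k A :: 'k vec)" by (auto simp: supp_def)
  then show "M \<in> asm_upto (fst A)" using sized_aug_pow A unfolding sized_def by blast
qed

lemma basis_decomp: "basis A M = conv_unit A M + conv_aug A M"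
  by (simp add: conv_unit_def conv_aug_def)

lemma conv_add:
  assumes "sized f" "sized g" "sized h" "A \<in> asm_mats"
  shows "conv f (\<lambda>B M. g B M + h B M) A M = conv f g A M + conv f h A M"
    "conv (\<lambda>B M. g B M + h B M) f A M = conv g f A M + conv h f A M"
proof -
  let ?Z = "asm_upto (fst A)"
  have s: "supp (k B) \<subseteq> ?Z" if "sized k" "B \<in> ?Z" for k :: "mat \<Rightarrow> 'a vec" and B
    using that asm_upto_mono[of "fst B" "fst A"] unfolding sized_def asm_upto_def[of "fst A"] by blast
  have gh: "supp (\<lambda>M. g B M + h B M) \<subseteq> ?Z" if "B \<in> ?Z" for B
    using s[OF assms(2) that] s[OF assms(3) that] by (fastforce simp: supp_def subset_iff)
  have "mult (f B) (\<lambda>M. g C M + h C M) M = mult (f B) (g C) M + mult (f B) (h C) M"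
    "mult (\<lambda>M. g C M + h C M) (f B) M = mult (g C) (f B) M + mult (h C) (f B) M" if "B \<in> ?Z" "C \<in> ?Z" for B C
    unfolding mult_def using s[OF assms(1) that(1)] s[OF assms(2) that(2)] s[OF assms(3) that(2)] gh[OF that(2)]
    by (simp_all add: bil_on[of ?Z ?Z] sum.distrib[symmetric] algebra_simps)
  then show "conv f (\<lambda>B M. g B M + h B M) A M = conv f g A M + conv f h A M"
    "conv (\<lambda>B M. g B M + h B M) f A M = conv g f A M + conv h f A M"
    by (simp_all add: conv_def sum.distrib[symmetric] distrib_left cong: sum.cong)
qed

lemma alternating_telescope: "(\<Sum>k\<le>n. (-1) ^ k * (x k + x (Suc k))) = x 0 + (-1) ^ n * (x (Suc n) :: 'k::comm_ring_1)"
  by (induction n) (simp_all add: algebra_simps)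

text \<open>A geometric series: the identity is \<open>conv_unit\<close> plus
  \<open>conv_aug\<close>, so convolving it with the alternating sum of powers telescopes to the
  power 0, up to a power beyond the size of \<open>A\<close>, which vanishes.\<close>

lemma conv_antipode:
  assumes A: "A \<in> asm_mats"
  shows "conv antipode basis A = (conv_unit A :: 'k::comm_ring_1 vec)" "conv basis antipode A = (conv_unit A :: 'k vec)"
proof -
  define n where "n = fst A"
  let ?Z = "asm_upto n"
  have AZ: "A \<in> ?Z" using A by (simp add: asm_upto_def n_def)
  have s: "supp (k B) \<subseteq> ?Z" if "sized k" "B \<in> ?Z" for k :: "mat \<Rightarrow> 'k vec" and B
    using that asm_upto_mono[of "fst B" n] unfolding sized_def asm_upto_def[of n] by blast
  have d: "basis = (\<lambda>B M. conv_unit B M + conv_aug B M :: 'k)" by (intro ext basis_decomp)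
  have 1: "conv (aug_pow k) basis A M = aug_pow k A M + (aug_pow (Suc k) A M :: 'k)" for k M
    unfolding d conv_add(1)[OF sized_aug_pow sized_units(1,2) A]
    using A by (simp add: conv_unit_neutral sized_aug_pow aug_pow_Suc_right del: aug_pow.simps)
  have 2: "conv basis (aug_pow k) A M = aug_pow k A M + (aug_pow (Suc k) A M :: 'k)" for k M
    unfolding d conv_add(2)[OF sized_aug_pow sized_units(1,2) A]
    using A by (simp add: conv_unit_neutral sized_aug_pow)
  have tel: "(\<Sum>k\<le>n. (-1) ^ k * (aug_pow k A M + aug_pow (Suc k) A M)) = (conv_unit A M :: 'k)" for M
  proof -
    have "aug_pow (Suc n) A = (\<lambda>_. 0 :: 'k)" using A by (rule aug_pow_zero) (simp add: n_def)
    then show ?thesis unfolding alternating_telescope[of "\<lambda>k. aug_pow k A M :: 'k" n] by simp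
  qed
  show "conv antipode basis A = (conv_unit A :: 'k vec)"
  proof
    fix M
    have "mult (antipode B) (basis C) M = (\<Sum>k\<le>n. (-1) ^ k * mult (aug_pow k B) (basis C) M :: 'k)"
      if "B \<in> ?Z" "C \<in> ?Z" for B C
      unfolding antipode_on[OF that(1)] mult_def
      by (rule bil_sum_left[OF finite_asm_upto finite_asm_upto s[OF sized_units(3) that(2)] s[OF sized_aug_pow that(1)]])
    then have "conv antipode basis A M = (\<Sum>B\<in>?Z. \<Sum>C\<in>?Z. copc A B C * (\<Sum>k\<le>n. (-1) ^ k * mult (aug_pow k B) (basis C) M :: 'k))"
      unfolding conv_on[OF AZ] by (intro sum.cong refl) simp
    also have "\<dots> = (\<Sum>B\<in>?Z. \<Sum>C\<in>?Z. \<Sum>k\<le>n. (-1) ^ k * (copc A B C * mult (aug_pow k B) (basis C) M :: 'k))"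
      by (simp add: sum_distrib_left mult_ac)
    also have "\<dots> = (\<Sum>k\<le>n. \<Sum>B\<in>?Z. \<Sum>C\<in>?Z. (-1) ^ k * (copc A B C * mult (aug_pow k B) (basis C) M :: 'k))"
      by (rule sum_swap3[symmetric])
    also have "\<dots> = (\<Sum>k\<le>n. (-1) ^ k * conv (aug_pow k) basis A M)"
      by (simp add: conv_on[OF AZ] sum_distrib_left)
    also have "\<dots> = conv_unit A M" unfolding 1 by (rule tel)
    finally show "conv antipode basis A M = (conv_unit A M :: 'k)" .
  qed
  show "conv basis antipode A = (conv_unit A :: 'k vec)"
  proof
    fix M
    have "mult (basis B) (antipode C) M = (\<Sum>k\<le>n. (-1) ^ k * mult (basis B) (aug_pow k C) M :: 'k)"
      if "B \<in> ?Z" "C \<in> ?Z" for B C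
      unfolding antipode_on[OF that(2)] mult_def
      by (rule bil_sum_right[OF finite_asm_upto finite_asm_upto s[OF sized_units(3) that(1)] s[OF sized_aug_pow that(2)]])
    then have "conv basis antipode A M = (\<Sum>B\<in>?Z. \<Sum>C\<in>?Z. copc A B C * (\<Sum>k\<le>n. (-1) ^ k * mult (basis B) (aug_pow k C) M :: 'k))"
      unfolding conv_on[OF AZ] by (intro sum.cong refl) simp
    also have "\<dots> = (\<Sum>B\<in>?Z. \<Sum>C\<in>?Z. \<Sum>k\<le>n. (-1) ^ k * (copc A B C * mult (basis B) (aug_pow k C) M :: 'k))"
      by (simp add: sum_distrib_left mult_ac)
    also have "\<dots> = (\<Sum>k\<le>n. \<Sum>B\<in>?Z. \<Sum>C\<in>?Z. (-1) ^ k * (copc A B C * mult (basis B) (aug_pow k C) M :: 'k))"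
      by (rule sum_swap3[symmetric])
    also have "\<dots> = (\<Sum>k\<le>n. (-1) ^ k * conv basis (aug_pow k) A M)"
      by (simp add: conv_on[OF AZ] sum_distrib_left)
    also have "\<dots> = conv_unit A M" unfolding 2 by (rule tel)
    finally show "conv basis antipode A M = (conv_unit A M :: 'k)" .
  qed
qed

lemma mtens_on:
  assumes "finite P" "supp X \<subseteq> P \<times> P"
  shows "mtens c X M = (\<Sum>A\<in>P. \<Sum>B\<in>P. X (A, B) * c A B M)"
  using assms by (simp add: mtens_def sum_supp[of "P \<times> P" X] sum.cartesian_product' split_def)

lemma appL_on:
  assumes "finite P" "supp X \<subseteq> P \<times> P"
  shows "appL s X (A, B) = (\<Sum>A'\<in>P. X (A', B) * s A' A)"
  unfolding appL_def split_conv
proof (rule sum.mono_neutral_left)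
  show "\<forall>A'\<in>P - fst ` supp X. X (A', B) * s A' A = 0"
  proof
    fix M assume "M \<in> P - fst ` supp X"
    then have "(M, B) \<notin> supp X" by force
    then show "X (M, B) * s M A = 0" by (simp add: supp_def)
  qed
qed (use assms in auto)

lemma appR_on:
  assumes "finite P" "supp X \<subseteq> P \<times> P"
  shows "appR s X (A, B) = (\<Sum>B'\<in>P. X (A, B') * s B' B)"
  unfolding appR_def split_conv
proof (rule sum.mono_neutral_left)
  show "\<forall>B'\<in>P - snd ` supp X. X (A, B') * s B' B = 0"
  proof
    fix M assume "M \<in> P - snd ` supp X"
    then have "(A, M) \<notin> supp X" by force
    then show "X (A, M) * s M B = 0" by (simp add: supp_def)
  qed
qed (use assms in auto)


lemma supp_subset: "(\<And>A B. A \<notin> P \<or> B \<notin> P \<Longrightarrow> X (A, B) = 0) \<Longrightarrow> supp X \<subseteq> P \<times> P"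
  unfolding supp_def by fastforce

text \<open>The composite of coproduct, antipode on one tensor factor and product is the convolution
  of \<open>antipode\<close> with the identity, extended linearly. The identity map appears as
  \<open>basis\<close>.\<close>

lemma mtens_antipode:
  fixes v :: "'k::comm_ring_1 vec"
  assumes v: "v \<in> fspace asm_mats"
  shows "mtens multc (appL antipode (cop v)) = (\<lambda>M. v e0 * basis e0 M)"
    "mtens multc (appR antipode (cop v)) = (\<lambda>M. v e0 * basis e0 M)"
proof -
  obtain n where n: "supp v \<subseteq> asm_upto n" using fspace_bound[OF v] .
  let ?Z = "asm_upto n" and ?S = "antipode :: mat \<Rightarrow> 'k vec"
  have s: "supp (k B) \<subseteq> ?Z" if "sized k" "B \<in> ?Z" for k :: "mat \<Rightarrow> 'k vec" and B
    using that asm_upto_mono[of "fst B" n] unfolding sized_def asm_upto_def[of n] by blast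
  have c: "supp (cop v) \<subseteq> ?Z \<times> ?Z" unfolding cop_def by (rule supp_cobil[OF cograded_coeffs(1) n])
  have S0: "?S A' A = 0" if "A' \<in> ?Z" "A \<notin> ?Z" for A' A
    using s[OF sized_antipode that(1)] that(2) by (auto simp: supp_def)
  have c0: "cop v (A, B) = 0" if "A \<notin> ?Z \<or> B \<notin> ?Z" for A B
    using c that by (auto simp: supp_def)
  have cv: "cop v (A, B) = (\<Sum>K\<in>?Z. v K * copc K A B)" for A B
    unfolding cop_def by (rule cobil_on[OF finite_asm_upto n])
  have fin: "(\<Sum>K\<in>?Z. v K * conv_unit K M) = v e0 * basis e0 M" for M
  proof -
    have "(\<Sum>K\<in>?Z. v K * conv_unit K M) = (\<Sum>K\<in>?Z. if K = e0 then v e0 * basis e0 M else 0)"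
      by (rule sum.cong) (auto simp: conv_unit_def)
    then show ?thesis by (simp add: asm_upto_def finite_asm_upto[unfolded asm_upto_def])
  qed
  have collect: "(\<Sum>A\<in>?Z. \<Sum>B\<in>?Z. cop v (A, B) * mult (f A) (g B) M) = (\<Sum>K\<in>?Z. v K * conv f g K M)"
    for f g :: "mat \<Rightarrow> 'k vec" and M
  proof -
    have "(\<Sum>A\<in>?Z. \<Sum>B\<in>?Z. cop v (A, B) * mult (f A) (g B) M)
        = (\<Sum>A\<in>?Z. \<Sum>B\<in>?Z. \<Sum>K\<in>?Z. v K * (copc K A B * mult (f A) (g B) M))"
      by (simp add: cv sum_distrib_right mult.assoc)
    also have "\<dots> = (\<Sum>K\<in>?Z. \<Sum>A\<in>?Z. \<Sum>B\<in>?Z. v K * (copc K A B * mult (f A) (g B) M))"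
      by (rule sum_swap3[symmetric])
    also have "\<dots> = (\<Sum>K\<in>?Z. v K * conv f g K M)"
      by (intro sum.cong refl) (simp add: conv_on sum_distrib_left)
    finally show ?thesis .
  qed
  have bas: "mult (?S A') (basis B) M = (\<Sum>A\<in>?Z. ?S A' A * multc A B M)"
    "mult (basis B) (?S A') M = (\<Sum>A\<in>?Z. ?S A' A * multc B A M)" if "A' \<in> ?Z" for A' B M
  proof -
    have "bil multc (?S A') (basis B) M = (\<Sum>A\<in>?Z. \<Sum>C\<in>{B}. ?S A' A * basis B C * multc A C M)"
      by (rule bil_on) (simp_all add: s[OF sized_antipode that])
    then show "mult (?S A') (basis B) M = (\<Sum>A\<in>?Z. ?S A' A * multc A B M)" by (simp add: mult_def)
    have "bil multc (basis B) (?S A') M = (\<Sum>C\<in>{B}. \<Sum>A\<in>?Z. basis B C * ?S A' A * multc C A M)"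
      by (rule bil_on) (simp_all add: s[OF sized_antipode that])
    then show "mult (basis B) (?S A') M = (\<Sum>A\<in>?Z. ?S A' A * multc B A M)" by (simp add: mult_def)
  qed
  show "mtens multc (appL antipode (cop v)) = (\<lambda>M. v e0 * basis e0 M)"
  proof
    fix M
    have ap: "appL ?S (cop v) (A, B) = (\<Sum>A'\<in>?Z. cop v (A', B) * ?S A' A)" for A B
      by (rule appL_on[OF finite_asm_upto c])
    have "appL ?S (cop v) (A, B) = 0" if "A \<notin> ?Z \<or> B \<notin> ?Z" for A B
      unfolding ap using that by (intro sum.neutral ballI) (auto simp: S0 c0)
    then have "supp (appL ?S (cop v)) \<subseteq> ?Z \<times> ?Z" by (rule supp_subset)
    then have "mtens multc (appL ?S (cop v)) M = (\<Sum>A\<in>?Z. \<Sum>B\<in>?Z. (\<Sum>A'\<in>?Z. cop v (A', B) * ?S A' A) * multc A B M)"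
      by (simp add: mtens_on[OF finite_asm_upto] ap)
    also have "\<dots> = (\<Sum>A\<in>?Z. \<Sum>B\<in>?Z. \<Sum>A'\<in>?Z. cop v (A', B) * (?S A' A * multc A B M))"
      by (simp add: sum_distrib_right mult.assoc)
    also have "\<dots> = (\<Sum>B\<in>?Z. \<Sum>A'\<in>?Z. \<Sum>A\<in>?Z. cop v (A', B) * (?S A' A * multc A B M))"
      by (rule sum_swap3)
    also have "\<dots> = (\<Sum>A'\<in>?Z. \<Sum>B\<in>?Z. \<Sum>A\<in>?Z. cop v (A', B) * (?S A' A * multc A B M))"
      by (rule sum.swap)
    also have "\<dots> = (\<Sum>A'\<in>?Z. \<Sum>B\<in>?Z. cop v (A', B) * mult (?S A') (basis B) M)"
      by (intro sum.cong refl) (simp add: bas sum_distrib_left)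
    also have "\<dots> = (\<Sum>K\<in>?Z. v K * conv_unit K M)"
      unfolding collect by (intro sum.cong refl) (simp add: conv_antipode asm_uptoD(1)[of _ n])
    finally show "mtens multc (appL antipode (cop v)) M = v e0 * basis e0 M" by (simp add: fin)
  qed
  show "mtens multc (appR antipode (cop v)) = (\<lambda>M. v e0 * basis e0 M)"
  proof
    fix M
    have ap: "appR ?S (cop v) (A, B) = (\<Sum>B'\<in>?Z. cop v (A, B') * ?S B' B)" for A B
      by (rule appR_on[OF finite_asm_upto c])
    have "appR ?S (cop v) (A, B) = 0" if "A \<notin> ?Z \<or> B \<notin> ?Z" for A B
      unfolding ap using that by (intro sum.neutral ballI) (auto simp: S0 c0)
    then have "supp (appR ?S (cop v)) \<subseteq> ?Z \<times> ?Z" by (rule supp_subset)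
    then have "mtens multc (appR ?S (cop v)) M = (\<Sum>A\<in>?Z. \<Sum>B\<in>?Z. (\<Sum>B'\<in>?Z. cop v (A, B') * ?S B' B) * multc A B M)"
      by (simp add: mtens_on[OF finite_asm_upto] ap)
    also have "\<dots> = (\<Sum>A\<in>?Z. \<Sum>B\<in>?Z. \<Sum>B'\<in>?Z. cop v (A, B') * (?S B' B * multc A B M))"
      by (simp add: sum_distrib_right mult.assoc)
    also have "\<dots> = (\<Sum>A\<in>?Z. \<Sum>B'\<in>?Z. \<Sum>B\<in>?Z. cop v (A, B') * (?S B' B * multc A B M))"
      by (intro sum.cong refl sum.swap)
    also have "\<dots> = (\<Sum>A\<in>?Z. \<Sum>B'\<in>?Z. cop v (A, B') * mult (basis A) (?S B') M)"
      by (intro sum.cong refl) (simp add: bas sum_distrib_left)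
    also have "\<dots> = (\<Sum>K\<in>?Z. v K * conv_unit K M)"
      unfolding collect by (intro sum.cong refl) (simp add: conv_antipode asm_uptoD(1)[of _ n])
    finally show "mtens multc (appR antipode (cop v)) M = v e0 * basis e0 M" by (simp add: fin)
  qed
qed

lemma hopf_alg_asm: "hopf_alg (fspace asm_mats :: ('k::comm_ring_1) vec set) asm_mats"
  unfolding hopf_alg_def
proof (intro conjI ballI)
  show "basis e0 \<in> (fspace asm_mats :: 'k vec set)" by (simp add: basis_fspace)
  show "mult v w \<in> fspace asm_mats" if "v \<in> fspace asm_mats" "w \<in> fspace asm_mats" for v w :: "'k vec"
    unfolding mult_def using that by (rule bil_fspace[OF _ _ graded_coeffs(1)])
  fix v :: "'k vec" assume v: "v \<in> fspace asm_mats"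
  obtain n where n: "supp v \<subseteq> asm_upto n" using fspace_bound[OF v] .
  have c: "supp (cop v) \<subseteq> asm_upto n \<times> asm_upto n"
    unfolding cop_def by (rule supp_cobil[OF cograded_coeffs(1) n])
  show "finite (supp (cop v))" by (rule finite_subset[OF c]) simp
  have "asm_upto n \<subseteq> asm_mats" by (auto simp: asm_upto_def)
  then show "supp (cop v) \<subseteq> asm_mats \<times> asm_mats" using c by blast
next
  have "finite {M. antipode A M \<noteq> (0 :: 'k)} \<and> {M. antipode A M \<noteq> (0 :: 'k)} \<subseteq> asm_mats" if "A \<in> asm_mats" for A
    using sized_fspace[OF sized_antipode that, where 'a = 'k] by (simp add: fspace_def supp_def)
  then show "\<exists>s. (\<forall>A\<in>asm_mats. finite {M. s A M \<noteq> (0 :: 'k)} \<and> {M. s A M \<noteq> 0} \<subseteq> asm_mats)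
      \<and> (\<forall>v\<in>fspace asm_mats. mtens multc (appL s (cop v)) = (\<lambda>M. v e0 * basis e0 M)
          \<and> mtens multc (appR s (cop v)) = (\<lambda>M. v e0 * basis e0 M))"
    using mtens_antipode by blast
qed (use mult_assoc mult_unit cop_coassoc cop_counit cop_mult mult_counit cop_unit in blast)+

section \<open>Triangular families\<close>

text \<open>The leading coefficients are 1, so that solving for the basis requires no division. The
  rank compares terms within one vector; preservation of the bidegree is recorded because the dual
  family inherits it.\<close>

definition triangular :: "'i set \<Rightarrow> ('i \<Rightarrow> ('k::comm_ring_1) vec) \<Rightarrow> ('i \<Rightarrow> mat) \<Rightarrow> (mat \<Rightarrow> nat) \<Rightarrow> bool" where
  "triangular I b ld rk \<longleftrightarrow> bij_betw ld I asm_mats \<and> (\<forall>i\<in>I. b i \<in> fspace asm_mats \<and> b i (ld i) = 1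
    \<and> (\<forall>M. b i M \<noteq> 0 \<longrightarrow> M \<noteq> ld i \<longrightarrow> rk M < rk (ld i) \<and> fst M = fst (ld i) \<and> card (snd M) = card (snd (ld i))))"

lemma triangularD:
  assumes "triangular I b ld rk"
  shows "bij_betw ld I asm_mats" "\<And>i. i \<in> I \<Longrightarrow> b i \<in> fspace asm_mats" "\<And>i. i \<in> I \<Longrightarrow> b i (ld i) = 1"
    "\<And>i M. i \<in> I \<Longrightarrow> b i M \<noteq> 0 \<Longrightarrow> M \<noteq> ld i \<Longrightarrow> rk M < rk (ld i) \<and> fst M = fst (ld i) \<and> card (snd M) = card (snd (ld i))"
  using assms unfolding triangular_def by blast+

text \<open>Among the indices with nonzero coefficient take one whose leading matrix has maximal
  rank. No other vector of the combination contains that matrix, so its coefficient cannot be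
  cancelled.\<close>

lemma triangular_independent:
  fixes c :: "'i \<Rightarrow> 'k::comm_ring_1"
  assumes T: "triangular I b ld rk" and W: "finite W" "W \<subseteq> I" and z: "lincomb c W b = (\<lambda>_. 0)" and w: "w \<in> W"
  shows "c w = 0"
proof (rule ccontr)
  assume "c w \<noteq> 0"
  let ?V = "{w \<in> W. c w \<noteq> 0}"
  have "finite ?V" "?V \<noteq> {}" using W w \<open>c w \<noteq> 0\<close> by auto
  then obtain v where v: "v \<in> ?V" "\<And>u. u \<in> ?V \<Longrightarrow> rk (ld u) \<le> rk (ld v)"
    using Max_in[of "(\<lambda>u. rk (ld u)) ` ?V"] Max_ge[of "(\<lambda>u. rk (ld u)) ` ?V"]
    by (smt (verit, ccfv_SIG) finite_imageI image_iff image_is_empty)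
  have "c u * b u (ld v) = (if u = v then c v else 0)" if "u \<in> W" for u
  proof (cases "u = v \<or> c u = 0 \<or> b u (ld v) = 0")
    case True
    then show ?thesis using triangularD(3)[OF T, of v] v W by auto
  next
    case False
    have "ld v \<noteq> ld u"
      using inj_onD[OF bij_betw_imp_inj_on[OF triangularD(1)[OF T]], of v u] False that v(1) W by blast
    then have "rk (ld v) < rk (ld u)" using triangularD(4)[OF T, of u "ld v"] False that W by blast
    then show ?thesis using v(2)[of u] that False by auto
  qed
  then have "lincomb c W b (ld v) = (\<Sum>u\<in>W. if u = v then c v else 0)"
    unfolding lincomb_def by (rule sum.cong[OF refl])
  also have "\<dots> = c v" using v W by simp
  finally show False using z v by simp
qed

lemma lincomb_superset:
  assumes "finite W" "{w. c w \<noteq> 0} \<subseteq> W"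
  shows "lincomb c {w. c w \<noteq> 0} b = lincomb c W b"
  unfolding lincomb_def using assms by (intro ext sum.mono_neutral_left) auto

text \<open>\<open>\<alpha>\<close> is the row at \<open>M\<close> of the inverse of the transition
  matrix, with the information that this inverse is again unitriangular and respects the bidegree.
  These extra clauses are what makes the dual family triangular.\<close>

definition expansion :: "'i set \<Rightarrow> ('i \<Rightarrow> ('k::comm_ring_1) vec) \<Rightarrow> ('i \<Rightarrow> mat) \<Rightarrow> (mat \<Rightarrow> nat) \<Rightarrow> mat \<Rightarrow> ('i \<Rightarrow> 'k) \<Rightarrow> bool" where
  "expansion I b ld rk M \<alpha> \<longleftrightarrow> finite {w. \<alpha> w \<noteq> 0} \<and> {w. \<alpha> w \<noteq> 0} \<subseteq> I \<and> lincomb \<alpha> {w. \<alpha> w \<noteq> 0} b = basis M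
    \<and> (\<forall>w\<in>I. ld w = M \<longrightarrow> \<alpha> w = 1)
    \<and> (\<forall>w\<in>I. \<alpha> w \<noteq> 0 \<longrightarrow> ld w \<noteq> M \<longrightarrow> rk (ld w) < rk M)
    \<and> (\<forall>w\<in>I. \<alpha> w \<noteq> 0 \<longrightarrow> fst (ld w) = fst M \<and> card (snd (ld w)) = card (snd M))"

text \<open>Back substitution by induction on the rank: \<open>b i\<close> with leading matrix
  \<open>M\<close> equals the basis vector of \<open>M\<close> plus terms of lower rank, which are
  already expanded.\<close>

lemma triangular_expansion:
  fixes b :: "'i \<Rightarrow> 'k::comm_ring_1 vec"
  assumes T: "triangular I b ld rk"
  shows "M \<in> asm_mats \<Longrightarrow> \<exists>\<alpha>. expansion I b ld rk M \<alpha>"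
proof (induction "rk M" arbitrary: M rule: less_induct)
  case less
  have "M \<in> ld ` I" using less.prems bij_betw_imp_surj_on[OF triangularD(1)[OF T]] by simp
  then obtain i where i: "i \<in> I" "ld i = M" by (metis imageE)
  have inj: "inj_on ld I" using triangularD(1)[OF T] by (rule bij_betw_imp_inj_on)
  define F where "F = supp (b i) - {M}"
  have F: "finite F" "F \<subseteq> asm_mats" using triangularD(2)[OF T i(1)] by (auto simp: F_def fspace_def)
  have rkF: "rk N < rk M \<and> fst N = fst M \<and> card (snd N) = card (snd M)" if "N \<in> F" for N
    using triangularD(4)[OF T i(1), of N] that i(2) by (auto simp: F_def supp_def)
  have "\<forall>N\<in>F. \<exists>\<alpha>. expansion I b ld rk N \<alpha>" using less.hyps rkF F(2) by blast
  then obtain a where "\<forall>N\<in>F. expansion I b ld rk N (a N)" by metis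
  then have a: "finite {w. a N w \<noteq> 0}" "{w. a N w \<noteq> 0} \<subseteq> I" "lincomb (a N) {w. a N w \<noteq> 0} b = basis N"
    "\<And>w. w \<in> I \<Longrightarrow> a N w \<noteq> 0 \<Longrightarrow> rk (ld w) \<le> rk N \<and> fst (ld w) = fst N \<and> card (snd (ld w)) = card (snd N)"
    if "N \<in> F" for N
    using that unfolding expansion_def by (blast, blast, blast, metis less_imp_le order_refl)
  \<comment> \<open>The basis vector of \<open>M\<close> is \<open>b i\<close> minus the lower terms
    of \<open>b i\<close>, each replaced by its own expansion.\<close>
  define \<alpha> where "\<alpha> w = (if w = i then 1 else 0) - (\<Sum>N\<in>F. b i N * a N w)" for w
  define W where "W = insert i (\<Union>N\<in>F. {w. a N w \<noteq> 0})"
  have W: "finite W" "W \<subseteq> I"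
    unfolding W_def using F(1) a(1,2) i(1) by (intro finite.insertI finite_UN_I, simp_all add: UN_least)
  have ex: "\<exists>N\<in>F. a N w \<noteq> 0" if "\<alpha> w \<noteq> 0" "w \<noteq> i" for w
  proof (rule ccontr)
    assume "\<not> (\<exists>N\<in>F. a N w \<noteq> 0)"
    then have "(\<Sum>N\<in>F. b i N * a N w) = 0" by (intro sum.neutral) auto
    then show False using that by (simp add: \<alpha>_def)
  qed
  have sub: "{w. \<alpha> w \<noteq> 0} \<subseteq> W"
  proof
    fix w assume "w \<in> {w. \<alpha> w \<noteq> 0}"
    then show "w \<in> W" using ex[of w] by (cases "w = i") (auto simp: W_def)
  qed
  have small: "rk (ld w) < rk M \<and> fst (ld w) = fst M \<and> card (snd (ld w)) = card (snd M)"
    if w: "w \<in> I" "\<alpha> w \<noteq> 0" "w \<noteq> i" for w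
  proof -
    obtain N where N: "N \<in> F" "a N w \<noteq> 0" using ex[OF w(2,3)] by blast
    show ?thesis using a(4)[OF N(1) w(1) N(2)] rkF[OF N(1)] by auto
  qed
  \<comment> \<open>The index \<open>i\<close> cannot occur in a lower expansion, since its leading
    matrix has the rank of \<open>M\<close>; so its coefficient stays exactly 1.\<close>
  have "a N i = 0" if "N \<in> F" for N
    using a(4)[OF that i(1)] rkF[OF that] i(2) by force
  then have \<alpha>i: "\<alpha> i = 1" by (simp add: \<alpha>_def)
  have "lincomb \<alpha> W b = basis M"
  proof
    fix K
    have "lincomb \<alpha> W b K = (\<Sum>w\<in>W. if w = i then b i K else 0) - (\<Sum>w\<in>W. \<Sum>N\<in>F. b i N * (a N w * b w K))"
      unfolding lincomb_def \<alpha>_def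
      by (simp add: left_diff_distrib sum_subtractf sum_distrib_right mult.assoc if_distrib[of "\<lambda>x. x * _"] cong: if_cong)
    also have "\<dots> = b i K - (\<Sum>N\<in>F. b i N * lincomb (a N) W b K)"
    proof -
      have "(\<Sum>w\<in>W. \<Sum>N\<in>F. b i N * (a N w * b w K)) = (\<Sum>N\<in>F. b i N * lincomb (a N) W b K)"
        by (subst sum.swap) (simp add: lincomb_def sum_distrib_left)
      moreover have "i \<in> W" by (simp add: W_def)
      ultimately show ?thesis using W(1) by simp
    qed
    also have "(\<Sum>N\<in>F. b i N * lincomb (a N) W b K) = (\<Sum>N\<in>F. b i N * basis N K)"
    proof (intro sum.cong refl)
      fix N assume N: "N \<in> F"
      then have "{w. a N w \<noteq> 0} \<subseteq> W" unfolding W_def by blast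
      from lincomb_superset[OF W(1) this, of b] have "lincomb (a N) W b = basis N"
        using a(3)[OF N] by simp
      then show "b i N * lincomb (a N) W b K = b i N * basis N K" by simp
    qed
    also have "\<dots> = (\<Sum>N\<in>F. if N = K then b i N else 0)"
      by (intro sum.cong refl) (auto simp: basis_def)
    also have "\<dots> = (if K \<in> F then b i K else 0)" using F by simp
    also have "b i K - \<dots> = basis M K"
      using triangularD(3)[OF T i(1)] i(2) by (auto simp: F_def supp_def basis_def)
    finally show "lincomb \<alpha> W b K = basis M K" .
  qed
  then have "lincomb \<alpha> {w. \<alpha> w \<noteq> 0} b = basis M" using lincomb_superset[OF W(1) sub] by simp
  moreover have "\<alpha> w = 1" if "w \<in> I" "ld w = M" for w
    using that i inj \<alpha>i by (auto simp: inj_on_def)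
  moreover have "rk (ld w) < rk M" if "w \<in> I" "\<alpha> w \<noteq> 0" "ld w \<noteq> M" for w
    using small[OF that(1,2)] that(3) i by blast
  moreover have "fst (ld w) = fst M \<and> card (snd (ld w)) = card (snd M)" if "w \<in> I" "\<alpha> w \<noteq> 0" for w
    using small[OF that] i by blast
  ultimately have "expansion I b ld rk M \<alpha>"
    unfolding expansion_def using finite_subset[OF sub W(1)] sub W(2) by blast
  then show ?case by blast
qed

lemma expansion_lincomb:
  assumes "expansion I b ld rk M \<alpha>" "finite W" "{w. \<alpha> w \<noteq> 0} \<subseteq> W"
  shows "basis M = lincomb \<alpha> W b"
  using assms lincomb_superset[OF assms(2,3)] unfolding expansion_def by metis

lemma sum_expansions:
  assumes "\<And>M. M \<in> F \<Longrightarrow> expansion I b ld rk M (a M)" "finite F" "finite W" "\<And>M. M \<in> F \<Longrightarrow> {w. a M w \<noteq> 0} \<subseteq> W"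
  shows "(\<Sum>M\<in>F. r M * basis M K) = lincomb (\<lambda>w. \<Sum>M\<in>F. r M * a M w) W b K"
proof -
  have "(\<Sum>M\<in>F. r M * basis M K) = (\<Sum>M\<in>F. r M * lincomb (a M) W b K)"
    using assms by (intro sum.cong refl) (metis expansion_lincomb)
  also have "\<dots> = (\<Sum>M\<in>F. \<Sum>w\<in>W. r M * a M w * b w K)"
    by (simp add: lincomb_def sum_distrib_left mult.assoc)
  also have "\<dots> = (\<Sum>w\<in>W. \<Sum>M\<in>F. r M * a M w * b w K)" by (rule sum.swap)
  finally show ?thesis by (simp add: lincomb_def sum_distrib_right)
qed

lemma vec_as_sum:
  fixes v :: "('k::comm_ring_1) vec"
  assumes "finite F" "supp v \<subseteq> F"
  shows "v K = (\<Sum>M\<in>F. v M * basis M K)"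
proof -
  have "(\<Sum>M\<in>F. v M * basis M K) = (\<Sum>M\<in>F. if M = K then v K else 0)"
    by (rule sum.cong) (auto simp: basis_def)
  then show ?thesis using assms by (auto simp: supp_def)
qed

lemma triangular_is_basis:
  fixes b :: "'i \<Rightarrow> 'k::comm_ring_1 vec"
  assumes T: "triangular I b ld rk"
  shows "is_basis_fam (fspace asm_mats) I b"
  unfolding is_basis_fam_def
proof (intro conjI ballI allI impI)
  show "b i \<in> fspace asm_mats" if "i \<in> I" for i using triangularD(2)[OF T that] .
  show "c w = 0" if "finite W \<and> W \<subseteq> I \<and> lincomb c W b = (\<lambda>_. 0)" "w \<in> W" for W c w
    using triangular_independent[OF T] that by blast
  fix v :: "'k vec" assume v: "v \<in> fspace asm_mats"
  then have fin: "finite (supp v)" "supp v \<subseteq> asm_mats" by (auto simp: fspace_def)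
  then have "\<forall>M\<in>supp v. \<exists>\<alpha>. expansion I b ld rk M \<alpha>" using triangular_expansion[OF T] by blast
  then obtain a where a: "\<And>M. M \<in> supp v \<Longrightarrow> expansion I b ld rk M (a M)" by metis
  let ?W = "\<Union>M\<in>supp v. {w. a M w \<noteq> 0}"
  have W: "finite ?W" "?W \<subseteq> I" using a fin unfolding expansion_def by blast+
  have "v = lincomb (\<lambda>w. \<Sum>M\<in>supp v. v M * a M w) ?W b"
    using vec_as_sum[OF fin(1) order_refl] sum_expansions[OF a fin(1) W(1)] by (intro ext) fastforce
  then show "\<exists>W c. finite W \<and> W \<subseteq> I \<and> v = lincomb c W b" using W by blast
qed

section \<open>Block diagonal factorization\<close>

definition oplus :: "mat \<Rightarrow> mat \<Rightarrow> mat" where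
  "oplus A B = (fst A + fst B, snd A \<union> map_prod ((+) (fst A)) ((+) (fst A)) ` snd B)"

lemma fst_oplus [simp]: "fst (oplus A B) = fst A + fst B"
  by (simp add: oplus_def)

lemma oplus_in_shc: "oplus A B \<in> shc A B"
proof (rule shcI)
  show "strict_mono_on {..<fst A} id" "strict_mono_on {..<fst B} ((+) (fst A))"
    by (auto simp: strict_mono_on_def)
  show "id ` {..<fst A} \<union> (+) (fst A) ` {..<fst B} = {..<fst A + fst B}" by (simp add: lessThan_add)
  show "id ` {..<fst A} \<inter> (+) (fst A) ` {..<fst B} = {}" by auto
qed (simp_all add: oplus_def map_prod.id)

lemma oplus_asm [simp]: "A \<in> asm_mats \<Longrightarrow> B \<in> asm_mats \<Longrightarrow> oplus A B \<in> asm_mats"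
  using shc_asm oplus_in_shc by blast

lemma oplus_assoc: "oplus (oplus A B) C = oplus A (oplus B C)"
proof -
  have "(+) (fst A + fst B) = (\<lambda>x. fst A + (fst B + x))" by (simp add: fun_eq_iff add.assoc)
  then show ?thesis by (simp add: oplus_def image_Un map_prod_comp_image o_def add.assoc Un_assoc)
qed

lemma oplus_e0: "oplus e0 A = A" "oplus A e0 = A"
proof -
  have "map_prod ((+) 0) ((+) 0) p = p" for p :: "nat \<times> nat" by (cases p) simp
  then show "oplus e0 A = A" by (simp add: oplus_def)
  show "oplus A e0 = A" by (simp add: oplus_def)
qed

lemma oplus_diag:
  assumes "A \<in> asm_mats" "(i, j) \<in> snd (oplus A B)"
  shows "i < fst A \<longleftrightarrow> j < fst A"
  using assms asm_mats_bounds[OF assms(1)] by (auto simp: oplus_def)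

lemma cols_upper_oplus:
  assumes "A \<in> asm_mats" "B \<in> asm_mats"
  shows "snd ` upper (fst A) (snd (oplus A B)) = {..<fst A}"
proof -
  have M: "oplus A B \<in> asm_mats" using assms by simp
  have "j \<in> snd ` upper (fst A) (snd (oplus A B)) \<longleftrightarrow> j < fst A" for j
  proof
    assume "j < fst A"
    then have "j \<in> snd ` snd (oplus A B)" using asm_matsD(4)[OF M] by simp
    then obtain i where "(i, j) \<in> snd (oplus A B)" by auto
    then show "j \<in> snd ` upper (fst A) (snd (oplus A B))"
      using oplus_diag[OF assms(1), of i j B] \<open>j < fst A\<close> by (force simp: upper_def)
  next
    assume "j \<in> snd ` upper (fst A) (snd (oplus A B))"
    then show "j < fst A" using oplus_diag[OF assms(1), of _ j B] by (auto simp: upper_def)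
  qed
  then show ?thesis by blast
qed

lemma oplus_eqI:
  assumes "A \<in> asm_mats" "B \<in> asm_mats" "M \<in> shc A B" "snd ` upper (fst A) (snd M) = {..<fst A}"
  shows "M = oplus A B"
  using shc_cols_unique[OF assms(1,2,3) oplus_in_shc] assms(4) cols_upper_oplus[OF assms(1,2)] by simp

text \<open>The size of the first factor fixes the cut, and the cut returns both factors.\<close>

lemma shc_right_unique:
  assumes "A \<in> asm_mats" "B \<in> asm_mats" "A' \<in> asm_mats" "B' \<in> asm_mats" "M \<in> shc A B" "M \<in> shc A' B'" "fst A = fst A'"
  shows "A = A' \<and> B = B'"
  using assms by (auto simp: shc_iff cut_def)

text \<open>A block diagonal pattern is in particular column separated, so the blocks compress to
  ASMs, and the only shuffle of them in which the first one takes the first columns is their block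
  diagonal sum.\<close>

lemma diag_split:
  assumes M: "M \<in> asm_mats" and k: "k \<le> fst M" and diag: "\<And>i j. (i, j) \<in> snd M \<Longrightarrow> i < k \<longleftrightarrow> j < k"
  obtains A B where "A \<in> asm_mats" "B \<in> asm_mats" "fst A = k" "fst B = fst M - k" "M = oplus A B"
proof -
  let ?A = "compress (upper k (snd M))" and ?B = "compress (lower k (snd M))"
  have sep: "colsep k (snd M)" unfolding colsep_def using diag by blast
  have sh: "asm_shape (upper k (snd M))" "asm_shape (lower k (snd M))"
    using sep asm_matsD[OF M] by (simp_all add: asm_shape_upper asm_shape_lower)
  have AB: "?A \<in> asm_mats" "?B \<in> asm_mats" using sh by (simp_all add: compress_in_asm_mats)
  have kA: "fst ?A = k" using k asm_matsD[OF M] by (simp add: fst_compress_upper rnk_lessThan)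
  have M': "M \<in> shc ?A ?B" using AB M sep kA by (simp add: shc_iff cut_def)
  have "snd ` upper k (snd M) = {..<k}"
  proof -
    have "j \<in> snd ` upper k (snd M) \<longleftrightarrow> j < k" for j
    proof
      assume "j < k"
      then have "j \<in> snd ` snd M" using asm_matsD(4)[OF M] k by simp
      then obtain i where "(i, j) \<in> snd M" by auto
      then show "j \<in> snd ` upper k (snd M)" using diag[of i j] \<open>j < k\<close> by (force simp: upper_def)
    next
      assume "j \<in> snd ` upper k (snd M)"
      then show "j < k" using diag[of _ j] by (auto simp: upper_def)
    qed
    then show ?thesis by blast
  qed
  then have "M = oplus ?A ?B" using oplus_eqI[OF AB M'] kA by simp
  moreover have "fst ?B = fst M - k" using fst_shc[OF M'] kA by simp
  ultimately show thesis using that AB kA by blast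
qed

definition indec :: "mat set" where
  "indec = {M \<in> asm_mats. M \<noteq> e0 \<and> (\<forall>A\<in>asm_mats. \<forall>B\<in>asm_mats. M = oplus A B \<longrightarrow> A = e0 \<or> B = e0)}"

primrec osum :: "mat list \<Rightarrow> mat" where
  "osum [] = e0"
| "osum (A # As) = oplus A (osum As)"

lemma indec_asm: "A \<in> indec \<Longrightarrow> A \<in> asm_mats"
  by (simp add: indec_def)

lemma osum_asm [simp]: "As \<in> lists indec \<Longrightarrow> osum As \<in> asm_mats"
  by (induction As) (simp_all add: indec_asm)

lemma osum_append: "osum (As @ Bs) = oplus (osum As) (osum Bs)"
  by (induction As) (simp_all add: oplus_e0 oplus_assoc)

lemma osum_exists: "M \<in> asm_mats \<Longrightarrow> \<exists>As\<in>lists indec. osum As = M"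
proof (induction "fst M" arbitrary: M rule: less_induct)
  case less
  show ?case
  proof (cases "M = e0 \<or> M \<in> indec")
    case True
    then show ?thesis
    proof
      assume "M = e0"
      then show ?thesis by (intro bexI[of _ "[]"]) simp_all
    next
      assume "M \<in> indec"
      then show ?thesis by (intro bexI[of _ "[M]"]) (simp_all add: oplus_e0)
    qed
  next
    case False
    then obtain A B where AB: "A \<in> asm_mats" "B \<in> asm_mats" "M = oplus A B" "A \<noteq> e0" "B \<noteq> e0"
      using less.prems unfolding indec_def by blast
    then have "fst A \<noteq> 0" "fst B \<noteq> 0" using asm_mats_size_0_iff by blast+
    then have "fst A < fst M" "fst B < fst M" using AB(3) by simp_all
    then obtain As Bs where "As \<in> lists indec" "osum As = A" "Bs \<in> lists indec" "osum Bs = B"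
      using less.hyps AB(1,2) by metis
    then show ?thesis using AB(3) by (intro bexI[of _ "As @ Bs"]) (simp_all add: osum_append)
  qed
qed

text \<open>Otherwise the boundary of the smaller block \<open>A\<close> would run through
  \<open>A'\<close> and split it into two nonempty diagonal blocks. Applied in both directions, it
  shows that the first factor is determined, whence unique factorization.\<close>

lemma indec_size_le:
  assumes A: "A \<in> indec" and A': "A' \<in> indec" and B: "B \<in> asm_mats" "B' \<in> asm_mats" and eq: "oplus A B = oplus A' B'"
  shows "fst A' \<le> fst A"
proof (rule ccontr)
  assume "\<not> fst A' \<le> fst A"
  then have lt: "fst A < fst A'" by simp
  have "i < fst A \<longleftrightarrow> j < fst A" if "(i, j) \<in> snd A'" for i j
  proof -
    have "(i, j) \<in> snd (oplus A' B')" using that by (simp add: oplus_def)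
    then show ?thesis using oplus_diag[of A i j B] A indec_asm eq by simp
  qed
  then obtain C D where CD: "C \<in> asm_mats" "D \<in> asm_mats" "fst C = fst A" "fst D = fst A' - fst A" "A' = oplus C D"
    using diag_split[of A' "fst A"] lt A' indec_asm by (metis less_imp_le)
  then have "C = e0 \<or> D = e0" using A' unfolding indec_def by blast
  moreover have "fst A \<noteq> 0" using A asm_mats_size_0_iff unfolding indec_def by blast
  ultimately show False using CD lt by auto
qed

lemma osum_inj: "As \<in> lists indec \<Longrightarrow> Bs \<in> lists indec \<Longrightarrow> osum As = osum Bs \<Longrightarrow> As = Bs"
proof (induction As arbitrary: Bs)
  case Nil
  show ?case
  proof (cases Bs)
    case (Cons B Cs)
    then have B: "B \<in> indec" using Nil by simp
    then have "fst B \<noteq> 0" using asm_mats_size_0_iff unfolding indec_def by blast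
    moreover have "fst (osum Bs) = 0" using Nil(3) by (metis fst_e0 osum.simps(1))
    ultimately show ?thesis using Cons by simp
  qed simp
next
  case (Cons A As)
  have A: "A \<in> indec" "As \<in> lists indec" using Cons.prems by simp_all
  have "fst A \<noteq> 0" using A asm_mats_size_0_iff unfolding indec_def by blast
  then have "fst (osum Bs) \<noteq> 0" using Cons.prems(3) by (metis add_is_0 fst_oplus osum.simps(2))
  then obtain B Cs where Bs: "Bs = B # Cs" by (cases Bs) auto
  have B: "B \<in> indec" "Cs \<in> lists indec" using Cons.prems Bs by simp_all
  have eq: "oplus A (osum As) = oplus B (osum Cs)" using Cons.prems Bs by simp
  have "fst A = fst B"
    using indec_size_le[OF A(1) B(1) _ _ eq] indec_size_le[OF B(1) A(1) _ _ eq[symmetric]] A B by simp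
  then have "A = B \<and> osum As = osum Cs"
    using shc_right_unique[of A "osum As" B "osum Cs" "oplus A (osum As)"] A B indec_asm
      oplus_in_shc[of A "osum As"] oplus_in_shc[of B "osum Cs"] eq by simp
  then show ?case using Cons.IH[OF A(2) B(2)] Bs by simp
qed

section \<open>Inversions\<close>

text \<open>For a permutation matrix this is the set of inversions in the usual sense; with several
  nonzero entries in a row or a column, entries sharing a line are never inverted.\<close>

definition invs :: "(nat \<times> nat) set \<Rightarrow> ((nat \<times> nat) \<times> (nat \<times> nat)) set" where
  "invs S = {(p, q) \<in> S \<times> S. fst p < fst q \<and> snd q < snd p}"

lemma invs_finite: "finite S \<Longrightarrow> finite (invs S)"
  by (rule finite_subset[of _ "S \<times> S"]) (auto simp: invs_def)

lemma card_invs_le: "finite S \<Longrightarrow> card (invs S) \<le> card S * card S"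
  using card_mono[of "S \<times> S" "invs S"] by (auto simp: invs_def card_cartesian_product)

lemma card_invs_map_prod:
  assumes "strict_mono_on (fst ` S) \<phi>" "strict_mono_on (snd ` S) \<psi>"
  shows "card (invs (map_prod \<phi> \<psi> ` S)) = card (invs S)"
proof -
  let ?f = "map_prod \<phi> \<psi>"
  have less: "fst (?f p) < fst (?f q) \<longleftrightarrow> fst p < fst q" "snd (?f q) < snd (?f p) \<longleftrightarrow> snd q < snd p"
    if "p \<in> S" "q \<in> S" for p q
    using strict_mono_on_less[OF assms(1) imageI[OF that(1)] imageI[OF that(2)]]
      strict_mono_on_less[OF assms(2) imageI[OF that(2)] imageI[OF that(1)]] by simp_all
  have "inj_on ?f (fst ` S \<times> snd ` S)"
    using assms by (intro map_prod_inj_on strict_mono_on_imp_inj_on)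
  then have inj: "inj_on ?f S" by (rule inj_on_subset) (rule subset_fst_snd)
  have "invs (?f ` S) = map_prod ?f ?f ` invs S"
  proof (intro set_eqI iffI)
    fix x assume x: "x \<in> invs (?f ` S)"
    obtain y z where yz: "x = (y, z)" by (cases x)
    have "y \<in> ?f ` S" "z \<in> ?f ` S" "fst y < fst z" "snd z < snd y" using x by (simp_all add: invs_def yz)
    then obtain p q where pq: "p \<in> S" "q \<in> S" "y = ?f p" "z = ?f q" by (elim imageE)
    then have "(p, q) \<in> invs S"
      using less[OF pq(1,2)] \<open>fst y < fst z\<close> \<open>snd z < snd y\<close> by (simp add: invs_def)
    then have "map_prod ?f ?f (p, q) \<in> map_prod ?f ?f ` invs S" by (rule imageI)
    then show "x \<in> map_prod ?f ?f ` invs S" using pq by (simp add: yz)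
  next
    fix x assume "x \<in> map_prod ?f ?f ` invs S"
    then obtain y where y: "y \<in> invs S" "x = map_prod ?f ?f y" by (rule imageE)
    obtain p q where pq: "y = (p, q)" by (cases y)
    have "p \<in> S" "q \<in> S" "fst p < fst q" "snd q < snd p" using y by (simp_all add: invs_def pq)
    then show "x \<in> invs (?f ` S)" using less[of p q] by (simp add: invs_def y pq)
  qed
  moreover have "inj_on (map_prod ?f ?f) (S \<times> S)" using inj by (intro map_prod_inj_on)
  then have "inj_on (map_prod ?f ?f) (invs S)" by (rule inj_on_subset) (auto simp: invs_def)
  ultimately show ?thesis by (simp add: card_image)
qed

lemma card_invs_compress: "finite T \<Longrightarrow> card (invs (snd (compress T))) = card (invs T)"
  by (simp add: compress_eq card_invs_map_prod strict_mono_on_rnk)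

abbreviation ninv :: "mat \<Rightarrow> nat" where
  "ninv M \<equiv> card (invs (snd M))"

text \<open>Inversions inside a block survive compression unchanged, so the excess over both factors
  counts the inverted pairs across the cut.\<close>

lemma ninv_shc:
  assumes A: "A \<in> asm_mats" and B: "B \<in> asm_mats" and M: "M \<in> shc A B"
  shows "ninv M = ninv A + ninv B + card {(p, q) \<in> upper (fst A) (snd M) \<times> lower (fst A) (snd M). snd q < snd p}"
proof -
  let ?U = "upper (fst A) (snd M)" and ?D = "lower (fst A) (snd M)"
  let ?X = "{(p, q) \<in> ?U \<times> ?D. snd q < snd p}"
  have MA: "M \<in> asm_mats" "A = compress ?U" "B = compress ?D" using M by (auto simp: shc_iff A B cut_def)
  have fin: "finite ?U" "finite ?D" using asm_matsD(2)[OF MA(1)] by (auto simp: upper_def lower_def)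
  have nA: "ninv A = card (invs ?U)" and nB: "ninv B = card (invs ?D)"
    using card_invs_compress[OF fin(1)] card_invs_compress[OF fin(2)] MA(2,3) by simp_all
  have eq: "invs (snd M) = (invs ?U \<union> invs ?D) \<union> ?X"
    unfolding invs_def upper_def lower_def by (auto simp: not_less)
  have "finite ?X" by (rule finite_subset[of _ "?U \<times> ?D"]) (use fin in auto)
  moreover have "invs ?U \<inter> invs ?D = {}" "(invs ?U \<union> invs ?D) \<inter> ?X = {}"
    unfolding invs_def upper_def lower_def by auto
  ultimately show ?thesis
    unfolding nA nB eq using fin by (simp add: card_Un_disjoint invs_finite)
qed

lemma down_closed_eq_lessThan:
  assumes "finite X" "\<And>x y. x \<in> X \<Longrightarrow> y < x \<Longrightarrow> y \<in> X"
  shows "X = {..<card X :: nat}"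
proof -
  have "rnk X x = x" if "x \<in> X" for x
  proof -
    have "{y \<in> X. y < x} = {..<x}" using assms(2) that by auto
    then show ?thesis by (simp add: rnk_def)
  qed
  then have "rnk X ` X = X" by force
  then show ?thesis using rnk_image[OF assms(1)] by simp
qed

text \<open>Without inverted pairs across the cut, all columns of the upper block precede those of
  the lower one, and the shuffle is block diagonal.\<close>

lemma ninv_shc_oplus:
  assumes A: "A \<in> asm_mats" and B: "B \<in> asm_mats" and M: "M \<in> shc A B"
  shows "ninv A + ninv B \<le> ninv M" "ninv M = ninv A + ninv B \<longleftrightarrow> M = oplus A B"
proof -
  let ?U = "upper (fst A) (snd M)" and ?D = "lower (fst A) (snd M)"
  let ?X = "{(p, q) \<in> ?U \<times> ?D. snd q < snd p}"
  show "ninv A + ninv B \<le> ninv M" using ninv_shc[OF assms] by simp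
  have MA: "M \<in> asm_mats" "cut (fst A) (snd M) A B" using M by (auto simp: shc_iff A B)
  have sep: "colsep (fst A) (snd M)" using MA(2) by (simp add: cut_def)
  have fin: "finite ?U" "finite ?D" using asm_matsD(2)[OF MA(1)] by (auto simp: upper_def lower_def)
  have cols: "snd ` ?U \<union> snd ` ?D = {..<fst M}"
    using asm_matsD(4)[OF MA(1)] by (simp add: image_Un[symmetric] upper_Un_lower)
  have card: "card (snd ` ?U) = fst A"
    using asm_shape_square[OF asm_shape_upper[OF sep asm_matsD(1)[OF MA(1)]]] MA(2) fst_compress[of ?U]
    by (simp add: cut_def)
  have finX: "finite ?X" by (rule finite_subset[of _ "?U \<times> ?D"]) (use fin in auto)
  show "ninv M = ninv A + ninv B \<longleftrightarrow> M = oplus A B"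
  proof
    assume "ninv M = ninv A + ninv B"
    then have "?X = {}" using ninv_shc[OF assms] finX by simp
    then have less: "j \<le> j'" if "j \<in> snd ` ?U" "j' \<in> snd ` ?D" for j j' using that by force
    have "snd ` ?U = {..<card (snd ` ?U)}"
    proof (rule down_closed_eq_lessThan)
      fix x y assume xy: "x \<in> snd ` ?U" "y < x"
      then have "x \<in> {..<fst M}" unfolding cols[symmetric] by blast
      then have "y < fst M" using xy(2) by simp
      then have "y \<in> snd ` ?U \<union> snd ` ?D" using cols by simp
      then show "y \<in> snd ` ?U" using less[OF xy(1), of y] xy(2) by auto
    qed (use fin in simp)
    then show "M = oplus A B" using oplus_eqI[OF assms] card by simp
  next
    assume eq: "M = oplus A B"
    have "snd p < fst A" if "p \<in> ?U" for p
      using that oplus_diag[OF A, of "fst p" "snd p" B] eq by (simp add: upper_def)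
    moreover have "\<not> snd q < fst A" if "q \<in> ?D" for q
      using that oplus_diag[OF A, of "fst q" "snd q" B] eq by (simp add: lower_def)
    ultimately have X: "?X = {}" by fastforce
    show "ninv M = ninv A + ninv B" unfolding ninv_shc[OF assms] X by simp
  qed
qed

section \<open>Freeness and cofreeness\<close>

text \<open>\<open>free_alg\<close> and \<open>cofree_coalg\<close> use words over natural numbers,
  so the indecomposable matrices have to be coded by numbers.\<close>

lemma countable_indec: "countable indec"
proof -
  have "asm_mats = (\<Union>n. asm_upto n)" by (auto simp: asm_upto_def)
  moreover have "countable (\<Union>n. asm_upto n)" by (intro countable_UN countableI_type countable_finite finite_asm_upto)
  ultimately have "countable asm_mats" by simp
  then show ?thesis by (rule countable_subset[rotated]) (auto simp: indec_def)
qed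

definition indec_code :: "nat set" where
  "indec_code = to_nat_on indec ` indec"

definition gen :: "nat \<Rightarrow> mat" where
  "gen = inv_into indec (to_nat_on indec)"

lemma bij_gen: "bij_betw gen indec_code indec"
  unfolding gen_def indec_code_def
  by (rule bij_betw_inv_into[OF inj_on_imp_bij_betw[OF inj_on_to_nat_on[OF countable_indec]]])

lemma gen_indec: "i \<in> indec_code \<Longrightarrow> gen i \<in> indec"
  using bij_betwE[OF bij_gen] by blast

definition lead :: "nat list \<Rightarrow> mat" where
  "lead w = osum (map gen w)"

lemma bij_lead: "bij_betw lead (lists indec_code) asm_mats"
proof (rule bij_betw_imageI)
  have inj: "inj_on gen indec_code" and im: "gen ` indec_code = indec"
    using bij_gen by (auto simp: bij_betw_def)
  have mem: "map gen w \<in> lists indec" if "w \<in> lists indec_code" for w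
    using that gen_indec by (induction w) auto
  show "inj_on lead (lists indec_code)"
  proof (rule inj_onI)
    fix u v assume uv: "u \<in> lists indec_code" "v \<in> lists indec_code" "lead u = lead v"
    then have "map gen u = map gen v" using osum_inj[OF mem mem] by (simp add: lead_def)
    then show "u = v" using inj uv
      by (metis in_lists_conv_set inj_on_map_eq_map inj_on_subset le_sup_iff subsetI)
  qed
  show "lead ` lists indec_code = asm_mats"
  proof
    show "lead ` lists indec_code \<subseteq> asm_mats" unfolding lead_def by (intro image_subsetI osum_asm mem)
    show "asm_mats \<subseteq> lead ` lists indec_code"
    proof
      fix M assume "M \<in> asm_mats"
      then obtain As where As: "As \<in> lists indec" "osum As = M" using osum_exists by blast
      then have "As \<in> lists (gen ` indec_code)" by (simp only: im)
      then obtain w where "w \<in> lists indec_code" "As = map gen w" by (auto simp: lists_image)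
      then show "M \<in> lead ` lists indec_code" using As(2) by (auto simp: lead_def)
    qed
  qed
qed

lemma lead_asm: "w \<in> lists indec_code \<Longrightarrow> lead w \<in> asm_mats"
  using bij_betwE[OF bij_lead] by blast

abbreviation gvec :: "nat \<Rightarrow> ('k::comm_ring_1) vec" where
  "gvec i \<equiv> basis (gen i)"

lemma mult_basis_left:
  "mult (basis A) v M = (\<Sum>N\<in>supp v. v N * multc A N M)"
  by (simp add: mult_def bil_def)

lemma wprod_fspace: "w \<in> lists indec_code \<Longrightarrow> (wprod gvec w :: ('k::comm_ring_1) vec) \<in> fspace asm_mats"
proof (induction w)
  case Nil
  then show ?case by (simp add: basis_fspace)
next
  case (Cons i w)
  then have "(basis (gen i) :: 'k vec) \<in> fspace asm_mats" using gen_indec indec_asm by (simp add: basis_fspace)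
  then show ?case using Cons unfolding wprod.simps mult_def by (intro bil_fspace graded_coeffs) simp_all
qed

text \<open>Inversion numbers of the factors add up to at most that of a term, with equality only
  for the block diagonal one. So a term attains the minimum only if its second factor is the leading
  one and the shuffle is block diagonal; that matrix arises once, by
  \<open>shc_right_unique\<close>, hence the coefficient 1.\<close>

lemma wprod_lead:
  "w \<in> lists indec_code \<Longrightarrow> (wprod gvec w :: ('k::comm_ring_1) vec) (lead w) = 1 \<and>
    (\<forall>M. (wprod gvec w :: 'k vec) M \<noteq> 0 \<longrightarrow> M \<noteq> lead w \<longrightarrow>
      ninv (lead w) < ninv M \<and> fst M = fst (lead w) \<and> card (snd M) = card (snd (lead w)))"
proof (induction w)
  case Nil
  then show ?case by (simp add: lead_def basis_def)
next
  case (Cons i w)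
  define A where "A = gen i"
  define v where "v = (wprod gvec w :: 'k vec)"
  define B where "B = lead w"
  have w: "w \<in> lists indec_code" and A: "A \<in> asm_mats"
    using Cons.prems gen_indec indec_asm by (auto simp: A_def)
  have B: "B \<in> asm_mats" unfolding B_def using lead_asm[OF w] .
  have v1: "v B = 1" and v2: "\<And>M. v M \<noteq> 0 \<Longrightarrow> M \<noteq> B \<Longrightarrow> ninv B < ninv M \<and> fst M = fst B \<and> card (snd M) = card (snd B)"
    using Cons.IH[OF w] by (auto simp: v_def B_def)
  have vf: "finite (supp v)" "supp v \<subseteq> asm_mats"
    using wprod_fspace[OF w, where 'k = 'k] by (auto simp: v_def fspace_def)
  have l: "lead (i # w) = oplus A B" by (simp add: lead_def A_def B_def)
  have p: "wprod gvec (i # w) M = (\<Sum>N\<in>supp v. v N * multc A N M)" for M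
    by (simp add: mult_basis_left A_def v_def)
  have "v N * multc A N (oplus A B) = (if N = B then 1 else 0)" if "N \<in> supp v" for N
  proof (cases "N = B")
    case True
    then show ?thesis using v1 oplus_in_shc by (simp add: multc_def)
  next
    case False
    have "oplus A B \<notin> shc A N"
      using shc_right_unique[OF A B A _ oplus_in_shc] False that vf by blast
    then show ?thesis using False by (simp add: multc_def)
  qed
  then have "wprod gvec (i # w) (oplus A B) = (\<Sum>N\<in>supp v. if N = B then 1 else (0 :: 'k))"
    unfolding p by (rule sum.cong[OF refl])
  also have "\<dots> = 1" using vf v1 by (simp add: supp_def)
  finally have 1: "wprod gvec (i # w) (oplus A B) = (1 :: 'k)" .
  have "ninv (oplus A B) < ninv M \<and> fst M = fst (oplus A B) \<and> card (snd M) = card (snd (oplus A B))"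
    if M: "wprod gvec (i # w) M \<noteq> (0 :: 'k)" "M \<noteq> oplus A B" for M
  proof -
    obtain N where "N \<in> supp v" "v N * multc A N M \<noteq> 0"
      using M(1) unfolding p by (rule sum.not_neutral_contains_not_neutral)
    then have N: "v N \<noteq> 0" "M \<in> shc A N" "N \<in> asm_mats" using vf by (auto simp: multc_def split: if_splits)
    have NB: "ninv B \<le> ninv N \<and> fst N = fst B \<and> card (snd N) = card (snd B)"
      using v2[OF N(1)] by (cases "N = B") auto
    have AB: "ninv (oplus A B) = ninv A + ninv B"
      using ninv_shc_oplus(2)[OF A B oplus_in_shc] by simp
    have "ninv A + ninv B < ninv M"
    proof (cases "N = B")
      case True
      then show ?thesis using ninv_shc_oplus[OF A N(3,2)] M(2) by simp
    next
      case False
      then show ?thesis using v2[OF N(1) False] ninv_shc_oplus(1)[OF A N(3,2)] by simp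
    qed
    then show ?thesis
      using AB NB fst_shc[OF N(2)] card_snd_shc[OF A N(3,2)] card_snd_shc[OF A B oplus_in_shc] by simp
  qed
  then show ?case using 1 unfolding l by blast
qed

text \<open>Leading matrices have the fewest inversions, while \<open>triangular\<close> wants the
  largest rank. The complement is taken in the square of the number of entries, which bounds the
  inversions and is constant on each word product, so that truncated subtraction does no
  harm.\<close>

lemma triangular_wprod:
  "triangular (lists indec_code) (wprod gvec :: nat list \<Rightarrow> ('k::comm_ring_1) vec) lead
    (\<lambda>M. card (snd M) * card (snd M) - ninv M)"
  unfolding triangular_def
proof (intro conjI ballI allI impI)
  show "bij_betw lead (lists indec_code) asm_mats" by (rule bij_lead)
  fix w assume w: "w \<in> lists indec_code"
  show "(wprod gvec w :: 'k vec) \<in> fspace asm_mats" "(wprod gvec w :: 'k vec) (lead w) = 1"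
    using wprod_fspace[OF w] wprod_lead[OF w] by auto
  fix M assume M: "(wprod gvec w :: 'k vec) M \<noteq> 0" "M \<noteq> lead w"
  then have *: "ninv (lead w) < ninv M" "fst M = fst (lead w)" "card (snd M) = card (snd (lead w))"
    using wprod_lead[OF w, where 'k = 'k] by blast+
  then show "fst M = fst (lead w)" "card (snd M) = card (snd (lead w))" by blast+
  have "M \<in> asm_mats" using wprod_fspace[OF w, where 'k = 'k] M(1) by (auto simp: fspace_def supp_def)
  then have "ninv M \<le> card (snd M) * card (snd M)" using card_invs_le asm_matsD(2) by blast
  then show "card (snd M) * card (snd M) - ninv M < card (snd (lead w)) * card (snd (lead w)) - ninv (lead w)"
    using * by simp
qed

lemma bihomogI: "(\<And>M. v M \<noteq> 0 \<Longrightarrow> fst M = n \<and> card (snd M) = k) \<Longrightarrow> bihomog v"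
  unfolding bihomog_def supp_def by blast

lemma free_alg_asm: "free_alg (fspace asm_mats :: ('k::comm_ring_1) vec set)"
  unfolding free_alg_def
proof (intro exI conjI ballI)
  show "is_basis_fam (fspace asm_mats) (lists indec_code) (wprod gvec :: nat list \<Rightarrow> 'k vec)"
    by (rule triangular_is_basis[OF triangular_wprod])
  fix i assume "i \<in> indec_code"
  then show "(basis (gen i) :: 'k vec) \<in> fspace asm_mats"
    using gen_indec indec_asm by (simp add: basis_fspace)
  show "bihomog (basis (gen i) :: 'k vec)"
    by (rule bihomogI[of _ "fst (gen i)" "card (snd (gen i))"]) (simp add: basis_def split: if_splits)
qed

lemma wprod_append:
  assumes "u \<in> lists indec_code" "v \<in> lists indec_code"
  shows "wprod gvec (u @ v) = mult (wprod gvec u) (wprod gvec v :: ('k::comm_ring_1) vec)"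
  using assms(1)
proof (induction u)
  case Nil
  then show ?case by (simp add: mult_unit(1)[OF wprod_fspace[OF assms(2)]])
next
  case (Cons i u)
  have "(basis (gen i) :: 'k vec) \<in> fspace asm_mats"
    using Cons.hyps by (simp add: basis_fspace gen_indec indec_asm)
  then show ?case using Cons by (simp add: mult_assoc wprod_fspace assms(2))
qed

section \<open>The dual basis\<close>

text \<open>The coordinates of the basis vector of \<open>M\<close> with respect to the products of
  words. Independence of these products makes the choice unique.\<close>

definition wcoeff :: "mat \<Rightarrow> nat list \<Rightarrow> 'k::comm_ring_1" where
  "wcoeff M = (SOME \<alpha>. expansion (lists indec_code) (wprod gvec) lead (\<lambda>M. card (snd M) * card (snd M) - ninv M) M \<alpha>)"

lemma wcoeff_expansion:
  assumes "M \<in> asm_mats"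
  shows "expansion (lists indec_code) (wprod gvec) lead (\<lambda>M. card (snd M) * card (snd M) - ninv M) M
    (wcoeff M :: nat list \<Rightarrow> 'k::comm_ring_1)"
  unfolding wcoeff_def by (rule someI_ex[OF triangular_expansion[OF triangular_wprod assms]])

lemma wcoeffD:
  assumes "M \<in> asm_mats"
  shows "finite {w. wcoeff M w \<noteq> (0 :: 'k::comm_ring_1)}" "{w. wcoeff M w \<noteq> (0 :: 'k)} \<subseteq> lists indec_code"
    "lincomb (wcoeff M) {w. wcoeff M w \<noteq> (0 :: 'k)} (wprod gvec) = (basis M :: 'k vec)"
    "\<And>w. w \<in> lists indec_code \<Longrightarrow> lead w = M \<Longrightarrow> wcoeff M w = (1 :: 'k)"
    "\<And>w. w \<in> lists indec_code \<Longrightarrow> wcoeff M w \<noteq> (0 :: 'k) \<Longrightarrow> fst (lead w) = fst M \<and> card (snd (lead w)) = card (snd M)"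
    "\<And>w. w \<in> lists indec_code \<Longrightarrow> wcoeff M w \<noteq> (0 :: 'k) \<Longrightarrow> lead w \<noteq> M \<Longrightarrow> ninv M < ninv (lead w)"
proof -
  note e = wcoeff_expansion[OF assms, where 'k = 'k, unfolded expansion_def]
  show "finite {w. wcoeff M w \<noteq> (0 :: 'k)}" by (rule e[THEN conjunct1])
  show "{w. wcoeff M w \<noteq> (0 :: 'k)} \<subseteq> lists indec_code" by (rule e[THEN conjunct2, THEN conjunct1])
  show "lincomb (wcoeff M) {w. wcoeff M w \<noteq> (0 :: 'k)} (wprod gvec) = (basis M :: 'k vec)"
    by (rule e[THEN conjunct2, THEN conjunct2, THEN conjunct1])
  note e' = e[THEN conjunct2, THEN conjunct2, THEN conjunct2]
  show "wcoeff M w = (1 :: 'k)" if "w \<in> lists indec_code" "lead w = M" for w using e' that by blast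
  show d: "fst (lead w) = fst M \<and> card (snd (lead w)) = card (snd M)"
    if "w \<in> lists indec_code" "wcoeff M w \<noteq> (0 :: 'k)" for w using e' that by blast
  fix w assume w: "w \<in> lists indec_code" "wcoeff M w \<noteq> (0 :: 'k)" "lead w \<noteq> M"
  then have "card (snd (lead w)) * card (snd (lead w)) - ninv (lead w) < card (snd M) * card (snd M) - ninv M"
    using e' by blast
  then show "ninv M < ninv (lead w)" using d[OF w(1,2)] by simp
qed

text \<open>The ways of writing \<open>w\<close> as a concatenation correspond to the cut positions
  from 0 to \<open>length w\<close>. This turns concatenation of words into the deconcatenation
  sum.\<close>

lemma sum_take_drop:
  fixes F :: "'a list \<Rightarrow> 'a list \<Rightarrow> 'k::comm_ring_1"
  assumes "finite U" "finite V" "\<And>u v. u \<notin> U \<or> v \<notin> V \<Longrightarrow> F u v = 0"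
  shows "(\<Sum>u\<in>U. \<Sum>v\<in>V. if u @ v = w then F u v else 0) = (\<Sum>k\<le>length w. F (take k w) (drop k w))"
proof -
  let ?s = "\<lambda>k. (take k w, drop k w)"
  have inj: "inj_on ?s {..length w}"
    by (rule inj_onI) (metis Pair_inject atMost_iff length_take min.absorb2)
  have im: "?s ` {..length w} = {(u, v). u @ v = w}"
  proof (intro set_eqI iffI)
    fix p assume "p \<in> {(u, v). u @ v = w}"
    then obtain u v where "p = (u, v)" "u @ v = w" by blast
    then have "p = ?s (length u)" "length u \<in> {..length w}" by auto
    then show "p \<in> ?s ` {..length w}" by blast
  qed auto
  have fin: "finite {(u, v). u @ v = w}" using im by (metis finite_atMost finite_imageI)
  have "(\<Sum>u\<in>U. \<Sum>v\<in>V. if u @ v = w then F u v else 0) = (\<Sum>p\<in>U \<times> V. if p \<in> {(u, v). u @ v = w} then F (fst p) (snd p) else 0)"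
    by (simp add: sum.cartesian_product split_def)
  also have "\<dots> = (\<Sum>p\<in>(U \<times> V) \<inter> {(u, v). u @ v = w}. F (fst p) (snd p))"
    using assms by (simp add: sum.inter_restrict)
  also have "\<dots> = (\<Sum>p\<in>{(u, v). u @ v = w}. F (fst p) (snd p))"
    using fin by (intro sum.mono_neutral_left) (auto intro!: assms(3))
  also have "\<dots> = (\<Sum>k\<le>length w. F (take k w) (drop k w))"
    unfolding im[symmetric] by (subst sum.reindex[OF inj]) simp
  finally show ?thesis .
qed

text \<open>The product of the basis vectors of \<open>A\<close> and \<open>B\<close> is expanded in
  words twice: as a sum over shuffles, and by multiplying the expansions of \<open>A\<close> and
  \<open>B\<close>, where words are concatenated. Independence allows the coordinates to be
  compared.\<close>

lemma wcoeff_mult: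
  assumes A: "A \<in> asm_mats" and B: "B \<in> asm_mats"
  shows "(\<Sum>N\<in>shc A B. wcoeff N w) = (\<Sum>k\<le>length w. wcoeff A (take k w) * (wcoeff B (drop k w) :: 'k::comm_ring_1))"
proof -
  let ?b = "wprod gvec :: nat list \<Rightarrow> 'k vec"
  define U where "U = {w. wcoeff A w \<noteq> (0 :: 'k)}"
  define V where "V = {w. wcoeff B w \<noteq> (0 :: 'k)}"
  define P where "P = shc A B"
  have P: "finite P" "P \<subseteq> asm_mats" using shc_finite[OF A B] shc_asm[OF A B] by (auto simp: P_def)
  have U: "finite U" "U \<subseteq> lists indec_code" and V: "finite V" "V \<subseteq> lists indec_code"
    using wcoeffD(1,2)[OF A, where 'k = 'k] wcoeffD(1,2)[OF B, where 'k = 'k] by (simp_all add: U_def V_def)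
  \<comment> \<open>A finite set of words containing all that occur on either side. The factor 1 in
    the next definition is the coefficient expected by \<open>sum_expansions\<close>.\<close>
  define W where "W = (\<Union>N\<in>P. {w. wcoeff N w \<noteq> (0 :: 'k)}) \<union> (\<lambda>(u, v). u @ v) ` (U \<times> V)"
  define \<alpha> where "\<alpha> w = (\<Sum>N\<in>P. 1 * wcoeff N w :: 'k)" for w
  define \<beta> where "\<beta> w = (\<Sum>u\<in>U. \<Sum>v\<in>V. if u @ v = w then wcoeff A u * wcoeff B v else 0 :: 'k)" for w
  have W: "finite W" "W \<subseteq> lists indec_code"
  proof -
    show "finite W" unfolding W_def using P U V wcoeffD(1)[where 'k = 'k] by (intro finite_UnI finite_UN_I) auto
    have "(\<lambda>(u, v). u @ v) ` (U \<times> V) \<subseteq> lists indec_code"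
    proof
      fix x assume "x \<in> (\<lambda>(u, v). u @ v) ` (U \<times> V)"
      then obtain u v where "u \<in> U" "v \<in> V" "x = u @ v" by auto
      moreover from this have "u \<in> lists indec_code" "v \<in> lists indec_code" using U(2) V(2) by blast+
      ultimately show "x \<in> lists indec_code" by simp
    qed
    moreover have "{w. wcoeff N w \<noteq> (0 :: 'k)} \<subseteq> lists indec_code" if "N \<in> P" for N
      using wcoeffD(2) P that by blast
    ultimately show "W \<subseteq> lists indec_code"
      unfolding W_def by (intro Un_least UN_least)
  qed
  have "lincomb \<alpha> W ?b K = lincomb \<beta> W ?b K" for K
  proof -
    have "lincomb \<alpha> W ?b K = (\<Sum>N\<in>P. 1 * basis N K)"
      unfolding \<alpha>_def
      by (rule sum_expansions[OF wcoeff_expansion P(1) W(1), symmetric]) (use P in \<open>auto simp: W_def\<close>)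
    also have "\<dots> = multc A B K" using P by (auto simp: multc_def basis_def P_def)
    also have "\<dots> = mult (basis A) (basis B) K" by (simp add: mult_basis_left)
    also have "\<dots> = mult (\<lambda>M. \<Sum>u\<in>U. wcoeff A u * ?b u M) (\<lambda>M. \<Sum>v\<in>V. wcoeff B v * ?b v M) K"
      using wcoeffD(3)[OF A, where 'k = 'k] wcoeffD(3)[OF B, where 'k = 'k] by (simp add: lincomb_def U_def V_def)
    also have "\<dots> = (\<Sum>u\<in>U. \<Sum>v\<in>V. wcoeff A u * wcoeff B v * mult (?b u) (?b v) K)"
    proof -
      define F where "F = (\<Union>u\<in>U. supp (?b u)) \<union> (\<Union>v\<in>V. supp (?b v))"
      have fF: "finite F"
        unfolding F_def using U V wprod_fspace[where 'k = 'k] by (auto simp: fspace_def subset_iff)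
      have sU: "supp (?b u) \<subseteq> F" if "u \<in> U" for u using that by (auto simp: F_def)
      have sV: "supp (?b v) \<subseteq> F" if "v \<in> V" for v using that by (auto simp: F_def)
      have sB: "supp (\<lambda>M. \<Sum>v\<in>V. wcoeff B v * ?b v M) \<subseteq> {B}"
        using wcoeffD(3)[OF B, where 'k = 'k] supp_basis[of B, where 'k = 'k] by (simp add: lincomb_def V_def)
      have "mult (\<lambda>M. \<Sum>u\<in>U. wcoeff A u * ?b u M) (\<lambda>M. \<Sum>v\<in>V. wcoeff B v * ?b v M) K
          = (\<Sum>u\<in>U. wcoeff A u * mult (?b u) (\<lambda>M. \<Sum>v\<in>V. wcoeff B v * ?b v M) K)"
        unfolding mult_def by (rule bil_sum_left[OF fF _ sB sU]) simp_all
      also have "\<dots> = (\<Sum>u\<in>U. wcoeff A u * (\<Sum>v\<in>V. wcoeff B v * mult (?b u) (?b v) K))"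
        unfolding mult_def
        by (intro sum.cong refl arg_cong2[where f = "(*)"] bil_sum_right[OF fF fF sU sV]) simp_all
      finally show ?thesis by (simp add: sum_distrib_left mult.assoc)
    qed
    also have "\<dots> = (\<Sum>u\<in>U. \<Sum>v\<in>V. wcoeff A u * wcoeff B v * ?b (u @ v) K)"
      using U V by (intro sum.cong refl) (simp add: wprod_append subset_iff)
    also have "\<dots> = (\<Sum>u\<in>U. \<Sum>v\<in>V. \<Sum>w\<in>W. if u @ v = w then wcoeff A u * wcoeff B v * ?b w K else 0)"
    proof (intro sum.cong refl)
      fix u v assume "u \<in> U" "v \<in> V"
      then have "u @ v \<in> W" by (force simp: W_def)
      then show "wcoeff A u * wcoeff B v * ?b (u @ v) K
          = (\<Sum>w\<in>W. if u @ v = w then wcoeff A u * wcoeff B v * ?b w K else 0)"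
        using W(1) by simp
    qed
    also have "\<dots> = (\<Sum>w\<in>W. \<Sum>u\<in>U. \<Sum>v\<in>V. if u @ v = w then wcoeff A u * wcoeff B v * ?b w K else 0)"
      by (rule sum_swap3[symmetric])
    also have "\<dots> = lincomb \<beta> W ?b K"
      unfolding lincomb_def \<beta>_def sum_distrib_right by (intro sum.cong refl) simp
    finally show ?thesis .
  qed
  then have "lincomb (\<lambda>w. \<alpha> w - \<beta> w) W ?b = (\<lambda>_. 0)"
    by (simp add: lincomb_def left_diff_distrib sum_subtractf fun_eq_iff)
  then have "\<alpha> w - \<beta> w = 0" if "w \<in> W" for w
    using triangular_independent[OF triangular_wprod W _ that, where c = "\<lambda>w. \<alpha> w - \<beta> w"] by simp
  moreover have "\<alpha> w = 0 \<and> \<beta> w = 0" if "w \<notin> W" for w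
    using that unfolding \<alpha>_def \<beta>_def W_def by (auto intro!: sum.neutral)
  ultimately have "\<alpha> w = \<beta> w" by (metis eq_iff_diff_eq_0)
  moreover have "\<beta> w = (\<Sum>k\<le>length w. wcoeff A (take k w) * wcoeff B (drop k w))"
    unfolding \<beta>_def by (rule sum_take_drop[OF U(1) V(1)]) (auto simp: U_def V_def)
  ultimately show ?thesis by (simp add: \<alpha>_def P_def)
qed

text \<open>The family dual to the words in the generators, for the pairing given by transposition.\<close>

definition cofree_vec :: "nat list \<Rightarrow> ('k::comm_ring_1) vec" where
  "cofree_vec w M = (if M \<in> asm_mats then wcoeff (mat_transp M) w else 0)"

lemma cofree_vec_degree:
  assumes "w \<in> lists indec_code" "cofree_vec w M \<noteq> (0 :: 'k::comm_ring_1)"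
  shows "M \<in> asm_mats" "fst M = fst (lead w)" "card (snd M) = card (snd (lead w))"
  using assms wcoeffD(5)[of "mat_transp M" w, where 'k = 'k] by (auto simp: cofree_vec_def split: if_splits)

text \<open>The family reads the inverse transition matrix with the word fixed and the matrix
  varying. This exchange of rows and columns reverses the order, so the rank is now the inversion
  number itself instead of its complement.\<close>

lemma triangular_cofree:
  "triangular (lists indec_code) (cofree_vec :: nat list \<Rightarrow> ('k::comm_ring_1) vec) (\<lambda>w. mat_transp (lead w))
    (\<lambda>M. ninv (mat_transp M))"
  unfolding triangular_def
proof (intro conjI ballI allI impI)
  have "bij_betw mat_transp asm_mats asm_mats"
    by (rule bij_betw_byWitness[of _ mat_transp]) auto
  then show "bij_betw (\<lambda>w. mat_transp (lead w)) (lists indec_code) asm_mats"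
    using bij_betw_trans[OF bij_lead] by (simp add: o_def)
  fix w assume w: "w \<in> lists indec_code"
  have "supp (cofree_vec w :: 'k vec) \<subseteq> asm_upto (fst (lead w))"
  proof
    fix M assume "M \<in> supp (cofree_vec w :: 'k vec)"
    then show "M \<in> asm_upto (fst (lead w))"
      using cofree_vec_degree[OF w, of M, where 'k = 'k] by (simp add: supp_def asm_upto_def)
  qed
  then show "(cofree_vec w :: 'k vec) \<in> fspace asm_mats" by (rule fspaceI)
  show "cofree_vec w (mat_transp (lead w)) = (1 :: 'k)"
    using lead_asm[OF w] w by (simp add: cofree_vec_def wcoeffD(4))
  fix M assume M: "cofree_vec w M \<noteq> (0 :: 'k)" "M \<noteq> mat_transp (lead w)"
  note deg = cofree_vec_degree[OF w M(1)]
  show "fst M = fst (mat_transp (lead w))" "card (snd M) = card (snd (mat_transp (lead w)))"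
    using deg by simp_all
  have "lead w \<noteq> mat_transp M" using M(2) by auto
  then show "ninv (mat_transp M) < ninv (mat_transp (mat_transp (lead w)))"
    using wcoeffD(6)[of "mat_transp M" w, where 'k = 'k] w M(1) deg by (simp add: cofree_vec_def)
qed

text \<open>The transpose of \<open>wcoeff_mult\<close>: summing over the matrices that split into
  \<open>A\<close> and \<open>B\<close> is summing over the shuffles of their transposes.\<close>

lemma cop_cofree_vec:
  assumes w: "w \<in> lists indec_code"
  shows "cop (cofree_vec w) (A, B) = (\<Sum>k\<le>length w. cofree_vec (take k w) A * (cofree_vec (drop k w) B :: 'k::comm_ring_1))"
proof (cases "A \<in> asm_mats \<and> B \<in> asm_mats")
  case True
  \<comment> \<open>Large enough for the support of \<open>cofree_vec w\<close>, which lies in size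
    \<open>fst (lead w)\<close>, and for all shuffles of the transposes of \<open>A\<close> and
    \<open>B\<close>.\<close>
  let ?n = "fst A + fst B + fst (lead w)"
  let ?Z = "asm_upto ?n"
  have "supp (cofree_vec w :: 'k vec) \<subseteq> ?Z"
  proof
    fix M assume "M \<in> supp (cofree_vec w :: 'k vec)"
    then show "M \<in> ?Z" using cofree_vec_degree[OF w, of M, where 'k = 'k] by (simp add: supp_def asm_upto_def)
  qed
  then have "cop (cofree_vec w) (A, B) = (\<Sum>M\<in>?Z. cofree_vec w M * copc M A B :: 'k)"
    unfolding cop_def by (intro cobil_on) simp_all
  also have "\<dots> = (\<Sum>N\<in>?Z. wcoeff N w * multc (mat_transp A) (mat_transp B) N)"
    by (rule sum.reindex_bij_witness[of _ mat_transp mat_transp])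
      (use True in \<open>auto simp: asm_upto_def cofree_vec_def copc_eq_dualc dualc_def\<close>)
  also have "\<dots> = (\<Sum>N\<in>?Z. if N \<in> shc (mat_transp A) (mat_transp B) then wcoeff N w else 0)"
    by (intro sum.cong refl) (simp add: multc_def)
  also have "\<dots> = (\<Sum>N\<in>?Z \<inter> shc (mat_transp A) (mat_transp B). wcoeff N w)"
    by (simp add: sum.inter_restrict)
  also have "?Z \<inter> shc (mat_transp A) (mat_transp B) = shc (mat_transp A) (mat_transp B)"
    using shc_subset[of "mat_transp A" "mat_transp B"] True asm_upto_mono[of "fst A + fst B" ?n] by auto
  also have "(\<Sum>N\<in>shc (mat_transp A) (mat_transp B). wcoeff N w)
      = (\<Sum>k\<le>length w. wcoeff (mat_transp A) (take k w) * (wcoeff (mat_transp B) (drop k w) :: 'k))"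
    using True by (intro wcoeff_mult) simp_all
  also have "\<dots> = (\<Sum>k\<le>length w. cofree_vec (take k w) A * cofree_vec (drop k w) B)"
    using True by (intro sum.cong refl) (simp add: cofree_vec_def)
  finally show ?thesis .
next
  case False
  then have "cofree_vec w M * copc M A B = (0 :: 'k)" for M
    by (cases "M \<in> asm_mats") (auto simp: cofree_vec_def copc_eq_dualc dualc_def)
  moreover have "cofree_vec u A * (cofree_vec v B :: 'k) = 0" for u v
    using False by (auto simp: cofree_vec_def)
  ultimately show ?thesis by (simp add: cop_def cobil_def)
qed

lemma cofree_coalg_asm: "cofree_coalg (fspace asm_mats :: ('k::comm_ring_1) vec set)"
  unfolding cofree_coalg_def
proof (intro exI conjI ballI)
  show "is_basis_fam (fspace asm_mats) (lists indec_code) (cofree_vec :: nat list \<Rightarrow> 'k vec)"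
    by (rule triangular_is_basis[OF triangular_cofree])
  fix w assume w: "w \<in> lists indec_code"
  show "bihomog (cofree_vec w :: 'k vec)"
    by (rule bihomogI) (use cofree_vec_degree[OF w, where 'k = 'k] in blast)
  show "cop (cofree_vec w) = (\<lambda>(A, B). \<Sum>k\<le>length w. cofree_vec (take k w) A * (cofree_vec (drop k w) B :: 'k))"
    by (rule ext) (simp add: split_def cop_cofree_vec[OF w, symmetric])
qed

theorem theorem4p1:
  shows "hopf_alg (fspace asm_mats :: ('k::field_char_0) vec set) asm_mats
       \<and> bigraded_connected asm_mats
       \<and> free_alg (fspace asm_mats :: 'k vec set)
       \<and> cofree_coalg (fspace asm_mats :: 'k vec set)
       \<and> self_dual (fspace asm_mats :: 'k vec set) asm_mats
       \<and> admits_bidendriform (fspace asm_mats :: 'k vec set) asm_mats"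
  unfolding admits_bidendriform_def
  using hopf_alg_asm bigraded_connected_asm free_alg_asm cofree_coalg_asm self_dual_asm bidendriform_asm
  by blast

end
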